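(* Let $s>\frac52$ and let $w_0=(\rho_0,u_0,v_0)\in H^{s-1}(\mathbb{R})\times H^s(\mathbb{R})\times H^s(\mathbb{R})$. Let $T=T(w_0)>0$ be the lifespan of the solution $w=(\rho,u,v)$, with initial data $w_0$, of $$\begin{cases}\rho_t+(\rho uv)_x=0,\\ m_t+uvm_x+3vu_xm+\rho^2u=0,\\ n_t+uvn_x+3v_xun-\rho^2v=0,\\ m=u-u_{xx},\quad n=v-v_{xx}.\end{cases}$$ If, for $\beta\in(0,\infty)$, the initial data satisfy $$\left\|(\rho_0,u_0,u_{0,x},u_{0,xx},v_0,v_{0,x},v_{0,xx})\,(\ln(e+\beta+|x|))^\beta\right\|_{L^\infty}\le C_0,$$ then $$\left\|(\rho,u,u_x,u_{xx},v,v_x,v_{xx})\,(\ln(e+\beta+|x|))^\beta\right\|_{L^\infty}\le C_1$$ uniformly in $t\in[0,T_0]$ for some $T_0<T$. The constant $C_1$ depends on $M$, $C_\beta$, $C_0$.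
   Context: The solution is $w\in C([0,T);H^{s-1}\times H^s\times H^s)$ on $\mathbb{R}$. The $L^\infty$ norm of a tuple is the sum of the $L^\infty$ norms of its components. $M=\sup_{t\in[0,T_0]}\left(\|\rho(t,\cdot)\|_{H^{s-1}}+\|u(t,\cdot)\|_{H^s}+\|v(t,\cdot)\|_{H^s}\right)$. $C_\beta$ is a constant depending only on $\beta$ such that $\psi_N(x)\int_{\mathbb{R}}\frac{e^{-|x-y|}}{\psi_N(y)}dy\le C_\beta$ for all $x\in\mathbb{R}$ and $N\in\mathbb{R}^+$, where $\psi_N(x)=(\ln(e+\beta+|x|))^\beta$ for $0\le|x|<N$ and $\psi_N(x)=(\ln(e+\beta+N))^\beta$ for $|x|\ge N$. *)

theory Defs
  imports "HOL-Probability.Probability"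
begin

(* Sobolev spaces on the line, for orders s \<ge> 0 only, so that every element is an L^2 function.
   The Fourier transform on L^2 is Plancherel's: the L^2 limit of the truncated integrals. *)

definition fourier_truncated :: "real \<Rightarrow> (real \<Rightarrow> real) \<Rightarrow> real \<Rightarrow> complex" where
  "fourier_truncated R f \<xi> =
     of_real (1 / sqrt (2 * pi)) * (LINT x:{-R..R}|lborel. cis (- (\<xi> * x)) * of_real (f x))"

definition has_L2_fourier :: "(real \<Rightarrow> real) \<Rightarrow> (real \<Rightarrow> complex) \<Rightarrow> bool" where
  "has_L2_fourier f g \<longleftrightarrow>
     f \<in> borel_measurable lborel \<and> integrable lborel (\<lambda>x. (f x)\<^sup>2) \<and>
     g \<in> borel_measurable lborel \<and> integrable lborel (\<lambda>\<xi>. (cmod (g \<xi>))\<^sup>2) \<and>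
     ((\<lambda>R. \<integral>\<^sup>+ \<xi>. ennreal ((cmod (fourier_truncated R f \<xi> - g \<xi>))\<^sup>2) \<partial>lborel)
        \<longlongrightarrow> 0) at_top"

(* Determined up to a null set. *)
definition L2_fourier :: "(real \<Rightarrow> real) \<Rightarrow> real \<Rightarrow> complex" where
  "L2_fourier f = (SOME g. has_L2_fourier f g)"

definition sobolev :: "real \<Rightarrow> (real \<Rightarrow> real) set" where
  "sobolev s = {f. (\<exists>g. has_L2_fourier f g) \<and>
     integrable lborel (\<lambda>\<xi>. (1 + \<xi>\<^sup>2) powr s * (cmod (L2_fourier f \<xi>))\<^sup>2)}"

definition sobolev_norm :: "real \<Rightarrow> (real \<Rightarrow> real) \<Rightarrow> real" where
  "sobolev_norm s f = sqrt (LINT \<xi>|lborel. (1 + \<xi>\<^sup>2) powr s * (cmod (L2_fourier f \<xi>))\<^sup>2)"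

(* For s > 1/2 every class in H^s has exactly one continuous representative, and we always use that
   one.  For s > 5/2 it is of class C^2, so that deriv below is the classical derivative and
   agrees with the weak one. *)
definition sobolev_cont :: "real \<Rightarrow> (real \<Rightarrow> real) set" where
  "sobolev_cont s = {f \<in> sobolev s. continuous_on UNIV f}"

(* The interval [0,T), where T may be infinite.  Functions of time and space are written u t x;
   their values at times outside this interval are irrelevant. *)
definition time_interval :: "ereal \<Rightarrow> real set" where
  "time_interval T = {t. 0 \<le> t \<and> ereal t < T}"

definition continuous_into_sobolev :: "real \<Rightarrow> ereal \<Rightarrow> (real \<Rightarrow> real \<Rightarrow> real) \<Rightarrow> bool" where
  "continuous_into_sobolev s T f \<longleftrightarrow>
     (\<forall>t\<in>time_interval T. f t \<in> sobolev_cont s \<and>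
        ((\<lambda>r. sobolev_norm s (\<lambda>x. f r x - f t x)) \<longlongrightarrow> 0) (at t within time_interval T))"

definition test_function :: "(real \<Rightarrow> real) \<Rightarrow> bool" where
  "test_function \<phi> \<longleftrightarrow>
     (\<forall>k x. (deriv ^^ k) \<phi> differentiable (at x)) \<and> (\<exists>R. \<forall>x. \<bar>x\<bar> > R \<longrightarrow> \<phi> x = 0)"

definition momentum :: "(real \<Rightarrow> real) \<Rightarrow> real \<Rightarrow> real" where
  "momentum f x = f x - deriv (deriv f) x"

(* Since m_x, n_x and the time derivatives need not be functions, the equations are required in the
   sense of distributions in x at every time t, the time derivative being that of the pairing with
   a fixed test function.  After integration by parts the transport term u v m_x tested against \<phi>
   becomes minus the integral of m (u v \<phi>)_x. *)
definition is_solution ::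
  "real \<Rightarrow> (real \<Rightarrow> real) \<Rightarrow> (real \<Rightarrow> real) \<Rightarrow> (real \<Rightarrow> real) \<Rightarrow> ereal \<Rightarrow>
   (real \<Rightarrow> real \<Rightarrow> real) \<Rightarrow> (real \<Rightarrow> real \<Rightarrow> real) \<Rightarrow> (real \<Rightarrow> real \<Rightarrow> real) \<Rightarrow> bool" where
  "is_solution s \<rho>0 u0 v0 T \<rho> u v \<longleftrightarrow>
     continuous_into_sobolev (s - 1) T \<rho> \<and>
     continuous_into_sobolev s T u \<and>
     continuous_into_sobolev s T v \<and>
     \<rho> 0 = \<rho>0 \<and> u 0 = u0 \<and> v 0 = v0 \<and>
     (\<forall>\<phi> t. test_function \<phi> \<longrightarrow> t \<in> time_interval T \<longrightarrow>
        ((\<lambda>r. LINT x|lborel. \<rho> r x * \<phi> x) has_real_derivative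
           (LINT x|lborel. \<rho> t x * u t x * v t x * deriv \<phi> x))
          (at t within time_interval T) \<and>
        ((\<lambda>r. LINT x|lborel. momentum (u r) x * \<phi> x) has_real_derivative
           (LINT x|lborel. momentum (u t) x * deriv (\<lambda>y. u t y * v t y * \<phi> y) x
              - 3 * v t x * deriv (u t) x * momentum (u t) x * \<phi> x
              - (\<rho> t x)\<^sup>2 * u t x * \<phi> x))
          (at t within time_interval T) \<and>
        ((\<lambda>r. LINT x|lborel. momentum (v r) x * \<phi> x) has_real_derivative
           (LINT x|lborel. momentum (v t) x * deriv (\<lambda>y. u t y * v t y * \<phi> y) x
              - 3 * deriv (v t) x * u t x * momentum (v t) x * \<phi> x
              + (\<rho> t x)\<^sup>2 * v t x * \<phi> x))
          (at t within time_interval T))"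

definition lifespan :: "real \<Rightarrow> (real \<Rightarrow> real) \<Rightarrow> (real \<Rightarrow> real) \<Rightarrow> (real \<Rightarrow> real) \<Rightarrow> ereal" where
  "lifespan s \<rho>0 u0 v0 = Sup {T. 0 < T \<and> (\<exists>\<rho> u v. is_solution s \<rho>0 u0 v0 T \<rho> u v)}"

definition sup_sobolev_norm ::
  "real \<Rightarrow> real \<Rightarrow> (real \<Rightarrow> real \<Rightarrow> real) \<Rightarrow> (real \<Rightarrow> real \<Rightarrow> real) \<Rightarrow> (real \<Rightarrow> real \<Rightarrow> real) \<Rightarrow> real" where
  "sup_sobolev_norm s T0 \<rho> u v =
     (SUP t\<in>{0..T0}. sobolev_norm (s - 1) (\<rho> t) + sobolev_norm s (u t) + sobolev_norm s (v t))"

definition Linf_norm :: "(real \<Rightarrow> real) \<Rightarrow> ereal" where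
  "Linf_norm f = esssup lborel (\<lambda>x. ereal \<bar>f x\<bar>)"

definition weighted_norm ::
  "real \<Rightarrow> (real \<Rightarrow> real) \<Rightarrow> (real \<Rightarrow> real) \<Rightarrow> (real \<Rightarrow> real) \<Rightarrow> ereal" where
  "weighted_norm \<beta> \<rho> u v =
     (\<Sum>f\<leftarrow>[\<rho>, u, deriv u, deriv (deriv u), v, deriv v, deriv (deriv v)].
        Linf_norm (\<lambda>x. f x * ln (exp 1 + \<beta> + \<bar>x\<bar>) powr \<beta>))"

definition psi :: "real \<Rightarrow> real \<Rightarrow> real \<Rightarrow> real" where
  "psi \<beta> N x =
     (if \<bar>x\<bar> < N then ln (exp 1 + \<beta> + \<bar>x\<bar>) powr \<beta> else ln (exp 1 + \<beta> + N) powr \<beta>)"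

definition convolution_constant :: "real \<Rightarrow> real \<Rightarrow> bool" where
  "convolution_constant \<beta> C \<longleftrightarrow>
     (\<forall>x N. N > 0 \<longrightarrow> psi \<beta> N x * (LINT y|lborel. exp (- \<bar>x - y\<bar>) / psi \<beta> N y) \<le> C)"

end

theory Submission
  imports Defs
begin

text \<open>
  For $s>5/2$ the Sobolev embedding, obtained from Fourier inversion, bounds $\rho,u,u_x,u_{xx},v,v_x,v_{xx}$
  by a multiple of $M$ on $[0,T_0]$ and makes them continuous in time uniformly in space. So
  $\rho$, $m$ and $n$ are weak solutions of scalar equations $f_t+uv\,f_x=g$ with bounded Lipschitz
  velocity $uv$, where $|g|$ is at most a multiple of $|f|$ plus a source controlled by $\rho$. Testing with a mollifier
  centred on a characteristic bounds $f(t,x)$ by the data on an interval of radius $O(t)$ around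
  $x$. A characteristic moves by at most a bounded distance and the weight $w$ varies by a bounded
  factor over bounded distances, hence $|\rho|$, then $|m|$ and $|n|$, stay below a multiple of
  $1/w$. Finally $u-u_{xx}=m$ gives $(e^{\mp x}(u\pm u_x))_x=\mp e^{\mp x}m$, and the decay of $m$
  passes to $u$ and $u_x$ because $w(x)\le w(y)e^{\kappa|x-y|}$ with $\kappa=\beta/(e+\beta)<1$.
\<close>

section \<open>Gaussian regularisation of the Plancherel transform\<close>

text \<open>For \<open>s\<close> just above 5/2 the functions m and n are only continuous: their
  x-derivatives are distributions, the equations cannot be evaluated along a characteristic, and
  every estimate has to go through mollified pairings. It is replaced by a supremum over all times
  and positions, half of which is absorbed. That supremum must be known to be finite, and w|f| is
  not known to be bounded for t > 0. Hence \<open>transport_bound\<close> uses the decaying weight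
  exp(-|x - x1|), for which boundedness of f suffices, and w enters only through its slow variation.
  The hierarchy closes because, once M bounds u, v and their derivatives, the equation for \<rho> is
  linear and source-free, and the sources of m and n inherit the decay of \<rho>. On the Fourier
  side the transform is only an L^2 limit; a Gaussian factor makes its pairings absolutely
  convergent, which leads to pointwise inversion.\<close>

lemma borel_measurable_cis [measurable]: "cis \<in> borel_measurable borel"
  by (intro borel_measurable_continuous_onI continuous_intros)

lemma set_integrable_of_square_integrable:
  fixes f :: "real \<Rightarrow> real"
  assumes "f \<in> borel_measurable lborel" and "integrable lborel (\<lambda>x. (f x)\<^sup>2)"
  shows "set_integrable lborel {-R..R} f"
proof -
  note [measurable] = assms(1)
  have int: "integrable lborel (\<lambda>x. indicator {-R..R} x + (f x)\<^sup>2)"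
    by (intro Bochner_Integration.integrable_add assms(2)) (simp add: integrable_indicator_iff emeasure_lborel_Icc_eq)
  have le: "norm (indicator {-R..R} x *\<^sub>R f x) \<le> norm (indicator {-R..R} x + (f x)\<^sup>2)" for x
  proof -
    have "\<bar>f x\<bar> \<le> 1 + (f x)\<^sup>2"
      using zero_le_power2[of "\<bar>f x\<bar> - 1"] by (simp add: power2_diff)
    then show ?thesis by (auto simp: indicator_def)
  qed
  show ?thesis
    unfolding set_integrable_def
    by (rule Bochner_Integration.integrable_bound[OF int _ AE_I2[OF le]]) simp
qed

lemma fourier_truncated_integrand_integrable:
  fixes f :: "real \<Rightarrow> real"
  assumes "f \<in> borel_measurable lborel" and "integrable lborel (\<lambda>x. (f x)\<^sup>2)"
  shows "set_integrable lborel {-R..R} (\<lambda>x. cis (- (\<xi> * x)) * of_real (f x))"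
proof -
  note [measurable] = assms(1)
  from set_integrable_of_square_integrable[OF assms, of R] show ?thesis
    unfolding set_integrable_def
    by (rule Bochner_Integration.integrable_bound) (auto simp: norm_mult)
qed

lemma fourier_truncated_measurable:
  fixes f :: "real \<Rightarrow> real"
  assumes "f \<in> borel_measurable lborel"
  shows "fourier_truncated R f \<in> borel_measurable lborel"
proof -
  note [measurable] = assms(1)
  show ?thesis unfolding fourier_truncated_def[abs_def] set_lebesgue_integral_def
    by measurable
qed

lemma fourier_truncated_norm_le:
  fixes f :: "real \<Rightarrow> real"
  assumes "f \<in> borel_measurable lborel" and "integrable lborel (\<lambda>x. (f x)\<^sup>2)"
  shows "cmod (fourier_truncated R f \<xi>) \<le> 1 / sqrt (2 * pi) * (LINT x:{-R..R}|lborel. \<bar>f x\<bar>)"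
proof -
  have "cmod (LINT x:{-R..R}|lborel. cis (- (\<xi> * x)) * of_real (f x))
      \<le> (LINT x:{-R..R}|lborel. \<bar>f x\<bar>)"
    unfolding set_lebesgue_integral_def
    by (rule order_trans[OF integral_norm_bound]) (simp add: norm_mult)
  then show ?thesis
    unfolding fourier_truncated_def norm_mult by (simp add: norm_divide divide_right_mono)
qed

text \<open>This is the characteristic function of the standard normal law after the substitution of
  \<open>sqrt e * \<xi>\<close>; up to 2 pi a Gaussian cutoff of variance 1/e in frequency is a
  normal density of variance \<open>e\<close> in space.\<close>

lemma gauss_fourier:
  fixes t e :: real
  assumes "e > 0"
  shows "integrable lborel (\<lambda>\<xi>. exp (- e * \<xi>\<^sup>2 / 2))"
    and "(LINT \<xi>|lborel. cis (t * \<xi>) * of_real (exp (- e * \<xi>\<^sup>2 / 2)))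
      = of_real (2 * pi * normal_density 0 (sqrt e) t)"
proof -
  have d: "exp (- (sqrt e * \<xi>)\<^sup>2 / 2) = exp (- e * \<xi>\<^sup>2 / 2)" for \<xi>
    using assms by (simp add: power_mult_distrib)
  have "integrable lborel (\<lambda>\<xi>. sqrt (2 * pi) * std_normal_density (0 + sqrt e * \<xi>))"
    using assms by (intro integrable_mult_right lborel_integrable_real_affine) auto
  then show i: "integrable lborel (\<lambda>\<xi>. exp (- e * \<xi>\<^sup>2 / 2))"
    using d by (simp add: std_normal_density_def)
  have "of_real (exp (- (t / sqrt e)\<^sup>2 / 2)) = char std_normal_distribution (t / sqrt e)"
    unfolding char_std_normal_distribution by simp
  also have "\<dots> = (LINT z|lborel. std_normal_density z *\<^sub>R cis (t / sqrt e * z))"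
    unfolding char_def by (subst integral_density) (auto simp: cis_conv_exp)
  also have "\<dots> = sqrt e *\<^sub>R (LINT \<xi>|lborel. std_normal_density (0 + sqrt e * \<xi>) *\<^sub>R cis (t / sqrt e * (0 + sqrt e * \<xi>)))"
    using assms by (subst lborel_integral_real_affine[of "sqrt e" _ 0]) auto
  also have "(\<lambda>\<xi>. std_normal_density (0 + sqrt e * \<xi>) *\<^sub>R cis (t / sqrt e * (0 + sqrt e * \<xi>)))
     = (\<lambda>\<xi>. of_real (1 / sqrt (2 * pi)) * (cis (t * \<xi>) * of_real (exp (- e * \<xi>\<^sup>2 / 2))))"
    using assms d by (auto simp: std_normal_density_def fun_eq_iff scaleR_conv_of_real)
  finally have "of_real (exp (- (t / sqrt e)\<^sup>2 / 2)) = of_real (sqrt e / sqrt (2 * pi)) *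
      (LINT \<xi>|lborel. cis (t * \<xi>) * of_real (exp (- e * \<xi>\<^sup>2 / 2)))" 
    by (simp add: scaleR_conv_of_real)
  moreover have "sqrt e / sqrt (2 * pi) \<noteq> 0" using assms by simp
  ultimately have "(LINT \<xi>|lborel. cis (t * \<xi>) * of_real (exp (- e * \<xi>\<^sup>2 / 2)))
     = complex_of_real (exp (- (t / sqrt e)\<^sup>2 / 2)) / of_real (sqrt e / sqrt (2 * pi))"
    by simp
  also have "\<dots> = complex_of_real (exp (- (t / sqrt e)\<^sup>2 / 2) / (sqrt e / sqrt (2 * pi)))"
    by simp
  also have "exp (- (t / sqrt e)\<^sup>2 / 2) / (sqrt e / sqrt (2 * pi)) = 2 * pi * normal_density 0 (sqrt e) t"
  proof -
    have "(t / sqrt e)\<^sup>2 / 2 = t\<^sup>2 / (2 * e)" using assms by (simp add: power_divide)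
    moreover have "2 * pi = sqrt (2*pi) * sqrt (2*pi)" by simp
    ultimately show ?thesis using assms
      by (simp add: normal_density_def real_sqrt_mult field_simps)
  qed
  finally show "(LINT \<xi>|lborel. cis (t * \<xi>) * of_real (exp (- e * \<xi>\<^sup>2 / 2)))
      = of_real (2 * pi * normal_density 0 (sqrt e) t)" .
qed

text \<open>Fubini: the truncation to \<open>{-R..R}\<close> makes \<open>f\<close> integrable in
  space and the Gaussian gives integrability in frequency, so both orders of integration are
  legitimate.\<close>

lemma gauss_fourier_truncated:
  fixes f :: "real \<Rightarrow> real"
  assumes "f \<in> borel_measurable lborel" and "integrable lborel (\<lambda>x. (f x)\<^sup>2)" and "e > 0"
  shows "(LINT \<xi>|lborel. fourier_truncated R f \<xi> * (cis (x * \<xi>) * of_real (exp (- e * \<xi>\<^sup>2 / 2))))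
     = of_real (sqrt (2 * pi) * (LINT y:{-R..R}|lborel. f y * normal_density x (sqrt e) y))"
proof -
  note [measurable] = assms(1)
  let ?c = "complex_of_real (1 / sqrt (2 * pi))"
  let ?G = "\<lambda>\<xi>::real. exp (- e * \<xi>\<^sup>2 / 2)"
  define h where "h = (\<lambda>\<xi> y. indicator {-R..R} y *\<^sub>R (cis (- (\<xi> * y)) * of_real (f y)) * (cis (x * \<xi>) * of_real (?G \<xi>)))"
  have hn: "norm (h \<xi> y) = norm (indicator {-R..R} y * f y) * ?G \<xi>" for \<xi> y
    unfolding h_def by (simp add: norm_mult abs_mult)
  have fi: "integrable lborel (\<lambda>y. indicator {-R..R} y * f y)"
    using set_integrable_of_square_integrable[OF assms(1,2), of R] by (simp add: set_integrable_def)
  have hi: "integrable (lborel \<Otimes>\<^sub>M lborel) (case_prod h)"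
  proof (rule lborel_pair.Fubini_integrable)
    show "case_prod h \<in> borel_measurable (lborel \<Otimes>\<^sub>M lborel)"
      unfolding h_def by measurable
    show "integrable lborel (\<lambda>\<xi>. LINT y|lborel. norm (case_prod h (\<xi>, y)))"
      unfolding prod.case hn using gauss_fourier(1)[OF assms(3)] by simp
    show "AE \<xi> in lborel. integrable lborel (\<lambda>y. case_prod h (\<xi>, y))"
    proof (rule AE_I2)
      fix \<xi>
      have "integrable lborel (\<lambda>y. norm (indicator {-R..R} y * f y) * ?G \<xi>)"
        using fi by auto
      then show "integrable lborel (\<lambda>y. case_prod h (\<xi>, y))"
        by (rule Bochner_Integration.integrable_bound) (auto simp: hn, auto simp: h_def)
    qed
  qed
  have "(LINT \<xi>|lborel. fourier_truncated R f \<xi> * (cis (x * \<xi>) * of_real (?G \<xi>)))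
      = ?c * (LINT \<xi>|lborel. (LINT y|lborel. h \<xi> y))"
    unfolding fourier_truncated_def set_lebesgue_integral_def h_def
    by (simp only: mult.assoc integral_mult_left_zero integral_mult_right_zero)
  also have "(LINT \<xi>|lborel. (LINT y|lborel. h \<xi> y)) = (LINT y|lborel. (LINT \<xi>|lborel. h \<xi> y))"
    by (rule lborel_pair.Fubini_integral[symmetric]) (rule hi)
  also have "(\<lambda>y. (LINT \<xi>|lborel. h \<xi> y)) =
     (\<lambda>y. complex_of_real (2 * pi * (indicator {-R..R} y *\<^sub>R (f y * normal_density x (sqrt e) y))))"
  proof
    fix y
    have nd: "normal_density 0 (sqrt e) (x - y) = normal_density x (sqrt e) y"
      by (simp add: normal_density_def power2_commute)
    have "h \<xi> y = (indicator {-R..R} y * f y) * (cis ((x - y) * \<xi>) * of_real (?G \<xi>))" for \<xi>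
      unfolding h_def by (auto simp: indicator_def cis_mult algebra_simps)
    then have "(LINT \<xi>|lborel. h \<xi> y) = of_real (indicator {-R..R} y * f y) * of_real (2 * pi * normal_density x (sqrt e) y)"
      by (simp only: integral_mult_right_zero gauss_fourier(2)[OF assms(3)] nd)
    then show "(LINT \<xi>|lborel. h \<xi> y) = complex_of_real (2 * pi * (indicator {-R..R} y *\<^sub>R (f y * normal_density x (sqrt e) y)))"
      by simp
  qed
  also have "(LINT y|lborel. complex_of_real (2 * pi * (indicator {-R..R} y *\<^sub>R (f y * normal_density x (sqrt e) y))))
    = of_real (2 * pi * (LINT y:{-R..R}|lborel. f y * normal_density x (sqrt e) y))"
    unfolding set_lebesgue_integral_def by (simp only: integral_complex_of_real integral_mult_right_zero)
  finally have "(LINT \<xi>|lborel. fourier_truncated R f \<xi> * (cis (x * \<xi>) * of_real (?G \<xi>)))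
      = of_real ((1 / sqrt (2 * pi)) * (2 * pi * (LINT y:{-R..R}|lborel. f y * normal_density x (sqrt e) y)))"
    by simp
  moreover have "(1 / sqrt (2 * pi)) * (2 * pi * L) = sqrt (2 * pi) * L" for L
    using real_div_sqrt[of "2 * pi"] by (simp add: field_simps)
  ultimately show ?thesis by (simp only:)
qed


lemma integrable_mult_of_squares:
  fixes f g :: "'a \<Rightarrow> 'b::{real_normed_field,banach,second_countable_topology}"
  assumes "f \<in> borel_measurable M" "g \<in> borel_measurable M"
    and "integrable M (\<lambda>x. (norm (f x))\<^sup>2)" and "integrable M (\<lambda>x. (norm (g x))\<^sup>2)"
  shows "integrable M (\<lambda>x. f x * g x)"
proof (rule Bochner_Integration.integrable_bound)
  show "integrable M (\<lambda>x. (norm (f x))\<^sup>2 + (norm (g x))\<^sup>2)"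
    using assms(3,4) by simp
  show "(\<lambda>x. f x * g x) \<in> borel_measurable M" using assms(1,2) by simp
  have "norm (f x) * norm (g x) \<le> (norm (f x))\<^sup>2 + (norm (g x))\<^sup>2" for x
    using sum_squares_bound[of "norm (f x)" "norm (g x)"]
      mult_nonneg_nonneg[OF norm_ge_zero norm_ge_zero, of "f x" "g x"]
    unfolding mult.assoc by linarith
  then show "AE x in M. norm (f x * g x) \<le> norm ((norm (f x))\<^sup>2 + (norm (g x))\<^sup>2)"
    by (simp add: norm_mult)
qed

lemma normal_density_le: "normal_density m s y \<le> 1 / sqrt (2 * pi * s\<^sup>2)"
  unfolding normal_density_def by (simp add: divide_right_mono)

lemma integrable_mult_normal_density:
  fixes f :: "real \<Rightarrow> real"
  assumes "f \<in> borel_measurable lborel" and "integrable lborel (\<lambda>x. (f x)\<^sup>2)" and "s > 0"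
  shows "integrable lborel (\<lambda>y. f y * normal_density m s y)"
proof (rule integrable_mult_of_squares)
  show "integrable lborel (\<lambda>y. (norm (normal_density m s y))\<^sup>2)"
  proof (rule Bochner_Integration.integrable_bound)
    show "integrable lborel (\<lambda>y. 1 / sqrt (2 * pi * s\<^sup>2) * normal_density m s y)"
      using assms(3) by (intro integrable_mult_right) auto
    show "AE y in lborel. norm ((norm (normal_density m s y))\<^sup>2) \<le> norm (1 / sqrt (2 * pi * s\<^sup>2) * normal_density m s y)"
      using mult_right_mono[OF normal_density_le[of m s] normal_density_nonneg[of m s]]
      by (auto simp: power2_eq_square)
  qed simp
qed (use assms(1,2) in simp_all)

text \<open>Cauchy-Schwarz against the fixed square integrable \<open>k\<close>. The estimate is
  made in extended reals because \<open>has_L2_fourier\<close> does not say that the L^2 distance is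
  finite before the limit; for the same reason the integrability of each \<open>F R * k\<close> is
  assumed and not derived.\<close>

lemma nn_integral_L2_pairing_tendsto:
  fixes F :: "'i \<Rightarrow> real \<Rightarrow> complex"
  assumes lim: "((\<lambda>R. \<integral>\<^sup>+ \<xi>. ennreal ((cmod (F R \<xi> - g \<xi>))\<^sup>2) \<partial>lborel) \<longlongrightarrow> 0) A"
    and [measurable]: "\<And>R. F R \<in> borel_measurable lborel" "g \<in> borel_measurable lborel" "k \<in> borel_measurable lborel"
    and k2: "integrable lborel (\<lambda>\<xi>. (cmod (k \<xi>))\<^sup>2)"
    and Fk: "\<And>R. integrable lborel (\<lambda>\<xi>. F R \<xi> * k \<xi>)" and gk: "integrable lborel (\<lambda>\<xi>. g \<xi> * k \<xi>)"
  shows "((\<lambda>R. LINT \<xi>|lborel. F R \<xi> * k \<xi>) \<longlongrightarrow> (LINT \<xi>|lborel. g \<xi> * k \<xi>)) A"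
proof -
  let ?I = "\<lambda>R. (LINT \<xi>|lborel. F R \<xi> * k \<xi>) - (LINT \<xi>|lborel. g \<xi> * k \<xi>)"
  define K where "K = (\<integral>\<^sup>+ \<xi>. ennreal ((cmod (k \<xi>))\<^sup>2) \<partial>lborel)"
  have K: "K < top" unfolding K_def using k2 by (simp add: integrable_iff_bounded)
  have le: "ennreal ((cmod (?I R))\<^sup>2) \<le> K * (\<integral>\<^sup>+ \<xi>. ennreal ((cmod (F R \<xi> - g \<xi>))\<^sup>2) \<partial>lborel)" for R
  proof -
    have "?I R = (LINT \<xi>|lborel. (F R \<xi> - g \<xi>) * k \<xi>)"
      using Fk gk by (simp add: left_diff_distrib)
    then have "ennreal (cmod (?I R)) \<le> (\<integral>\<^sup>+ \<xi>. ennreal (cmod ((F R \<xi> - g \<xi>) * k \<xi>)) \<partial>lborel)"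
      by (simp only:) (rule integral_norm_bound_ennreal, use Fk gk in \<open>simp add: left_diff_distrib\<close>)
    also have "\<dots> = (\<integral>\<^sup>+ \<xi>. ennreal (cmod (F R \<xi> - g \<xi>)) * ennreal (cmod (k \<xi>)) \<partial>lborel)"
      by (simp add: norm_mult ennreal_mult)
    finally have "(ennreal (cmod (?I R)))\<^sup>2 \<le> (\<integral>\<^sup>+ \<xi>. ennreal (cmod (F R \<xi> - g \<xi>)) * ennreal (cmod (k \<xi>)) \<partial>lborel)\<^sup>2"
      by (intro power_mono) auto
    also have "\<dots> \<le> (\<integral>\<^sup>+ \<xi>. (ennreal (cmod (F R \<xi> - g \<xi>)))\<^sup>2 \<partial>lborel) * (\<integral>\<^sup>+ \<xi>. (ennreal (cmod (k \<xi>)))\<^sup>2 \<partial>lborel)"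
      by (rule Cauchy_Schwarz_nn_integral) auto
    finally show ?thesis unfolding K_def by (simp add: ennreal_power mult.commute)
  qed
  have "((\<lambda>R. K * (\<integral>\<^sup>+ \<xi>. ennreal ((cmod (F R \<xi> - g \<xi>))\<^sup>2) \<partial>lborel)) \<longlongrightarrow> K * 0) A"
    using K lim by (intro ennreal_tendsto_cmult)
  then have "((\<lambda>R. K * (\<integral>\<^sup>+ \<xi>. ennreal ((cmod (F R \<xi> - g \<xi>))\<^sup>2) \<partial>lborel)) \<longlongrightarrow> 0) A"
    by simp
  then have "((\<lambda>R. ennreal ((cmod (?I R))\<^sup>2)) \<longlongrightarrow> 0) A"
    by (rule tendsto_sandwich[OF always_eventually always_eventually tendsto_const, rotated 2]) (simp, blast intro: le)
  then have "((\<lambda>R. (cmod (?I R))\<^sup>2) \<longlongrightarrow> 0) A"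
    by (rule tendsto_ennrealD[where x = 0, unfolded ennreal_0]) auto
  then have "((\<lambda>R. sqrt ((cmod (?I R))\<^sup>2)) \<longlongrightarrow> sqrt 0) A"
    by (rule tendsto_real_sqrt)
  then have "((\<lambda>R. ?I R) \<longlongrightarrow> 0) A"
    by (simp add: tendsto_norm_zero_iff)
  then show ?thesis by (simp only: LIM_zero_iff)
qed

text \<open>Gaussian regularisation of the inversion formula: both sides make sense for $g$ merely in $L^2$.\<close>

lemma has_L2_fourier_gauss:
  assumes f: "has_L2_fourier f g" and e: "e > 0"
  shows "(LINT \<xi>|lborel. g \<xi> * (cis (x * \<xi>) * of_real (exp (- e * \<xi>\<^sup>2 / 2))))
     = of_real (sqrt (2 * pi) * (LINT y|lborel. f y * normal_density x (sqrt e) y))"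
proof -
  let ?k = "\<lambda>\<xi>. cis (x * \<xi>) * complex_of_real (exp (- e * \<xi>\<^sup>2 / 2))"
  have fm[measurable]: "f \<in> borel_measurable lborel" and f2: "integrable lborel (\<lambda>x. (f x)\<^sup>2)"
    and gm[measurable]: "g \<in> borel_measurable lborel" and g2: "integrable lborel (\<lambda>\<xi>. (cmod (g \<xi>))\<^sup>2)"
    and lim: "((\<lambda>R. \<integral>\<^sup>+ \<xi>. ennreal ((cmod (fourier_truncated R f \<xi> - g \<xi>))\<^sup>2) \<partial>lborel) \<longlongrightarrow> 0) at_top"
    using f unfolding has_L2_fourier_def by auto
  have kn: "cmod (?k \<xi>) = exp (- e * \<xi>\<^sup>2 / 2)" for \<xi> by (simp add: norm_mult)
  have km: "?k \<in> borel_measurable lborel" by measurable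
  have k2: "integrable lborel (\<lambda>\<xi>. (cmod (?k \<xi>))\<^sup>2)"
    using gauss_fourier(1)[of "2 * e"] e unfolding kn by (simp add: exp_double[symmetric])
  have "((\<lambda>R. LINT \<xi>|lborel. fourier_truncated R f \<xi> * ?k \<xi>) \<longlongrightarrow> (LINT \<xi>|lborel. g \<xi> * ?k \<xi>)) at_top"
  proof (rule nn_integral_L2_pairing_tendsto[OF lim _ gm km k2])
    show "fourier_truncated R f \<in> borel_measurable lborel" for R
      by (rule fourier_truncated_measurable[OF fm])
    show "integrable lborel (\<lambda>\<xi>. g \<xi> * ?k \<xi>)"
      by (rule integrable_mult_of_squares[OF gm km g2 k2])
    \<comment> \<open>Only boundedness of the truncated transform is used: a constant times the
      Gaussian dominates the product.\<close>
    show "integrable lborel (\<lambda>\<xi>. fourier_truncated R f \<xi> * ?k \<xi>)" for R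
    proof (rule Bochner_Integration.integrable_bound)
      let ?C = "1 / sqrt (2 * pi) * (LINT x:{-R..R}|lborel. \<bar>f x\<bar>)"
      show "integrable lborel (\<lambda>\<xi>. ?C * exp (- e * \<xi>\<^sup>2 / 2))"
        by (intro integrable_mult_right gauss_fourier(1)[OF e])
      show "(\<lambda>\<xi>. fourier_truncated R f \<xi> * ?k \<xi>) \<in> borel_measurable lborel"
        by (intro borel_measurable_times km fourier_truncated_measurable fm)
      show "AE \<xi> in lborel. norm (fourier_truncated R f \<xi> * ?k \<xi>) \<le> norm (?C * exp (- e * \<xi>\<^sup>2 / 2))"
        unfolding norm_mult[of "fourier_truncated R f _"] kn
        by (intro AE_I2, unfold real_norm_def)
          (rule order_trans[OF mult_right_mono abs_ge_self], rule fourier_truncated_norm_le[OF fm f2], simp)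
    qed
  qed
  moreover have "((\<lambda>R. LINT \<xi>|lborel. fourier_truncated R f \<xi> * ?k \<xi>) \<longlongrightarrow>
     of_real (sqrt (2 * pi) * (LINT y|lborel. f y * normal_density x (sqrt e) y))) at_top"
    unfolding gauss_fourier_truncated[OF fm f2 e] set_lebesgue_integral_def
  proof (intro tendsto_of_real tendsto_mult tendsto_const integral_dominated_convergence_at_top
      [where w = "\<lambda>y. \<bar>f y * normal_density x (sqrt e) y\<bar>"])
    show "integrable lborel (\<lambda>y. \<bar>f y * normal_density x (sqrt e) y\<bar>)"
      by (intro integrable_abs integrable_mult_normal_density fm f2) (use e in simp)
    show "AE y in lborel. ((\<lambda>R. indicat_real {- R..R} y *\<^sub>R (f y * normal_density x (sqrt e) y))
             \<longlongrightarrow> f y * normal_density x (sqrt e) y) at_top"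
    proof (rule AE_I2)
      fix y
      have "\<forall>\<^sub>F R in at_top. indicat_real {- R..R} y *\<^sub>R (f y * normal_density x (sqrt e) y) = f y * normal_density x (sqrt e) y"
        using eventually_ge_at_top[of "\<bar>y\<bar>"] by eventually_elim (auto simp: indicator_def)
      then show "((\<lambda>R. indicat_real {- R..R} y *\<^sub>R (f y * normal_density x (sqrt e) y))
             \<longlongrightarrow> f y * normal_density x (sqrt e) y) at_top"
        by (rule tendsto_eventually)
    qed
  qed (auto simp: indicator_def intro!: always_eventually AE_I2)
  ultimately show ?thesis by (rule tendsto_unique[rotated 1]) simp
qed

text \<open>exp(-q) is at most 1/q, here with q = (y - x)^2 / (2 e). This crude bound already makes
  the density uniformly small, of order \<open>sqrt e\<close>, away from its centre.\<close>

lemma normal_density_le_far: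
  assumes "0 < d" "d \<le> \<bar>y - x\<bar>" "0 < e"
  shows "normal_density x (sqrt e) y \<le> 2 * sqrt e / d\<^sup>2"
proof -
  let ?t = "(y - x)\<^sup>2 / (2 * e)"
  have dd: "d\<^sup>2 \<le> (y - x)\<^sup>2" using assms(1,2) by (metis abs_le_square_iff abs_of_pos)
  have d2: "0 < d\<^sup>2" using assms by simp
  have t: "0 < ?t" using dd d2 assms(3) by (intro divide_pos_pos) auto
  have "exp (- q) \<le> 1 / q" if "q > 0" for q :: real
  proof -
    have "q \<le> exp q" using exp_ge_add_one_self[of q] by linarith
    then show ?thesis using that by (simp add: exp_minus field_simps)
  qed
  then have "exp (- ?t) \<le> 1 / ?t" using t .
  also have "1 / ?t = 2 * e / (y - x)\<^sup>2" by simp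
  also have "\<dots> \<le> 2 * e / d\<^sup>2" using dd d2 assms(3) by (intro divide_left_mono) (auto intro!: mult_pos_pos)
  finally have "exp (- ?t) \<le> 2 * e / d\<^sup>2" .
  moreover have "1 / sqrt (2 * pi * e) \<le> 1 / sqrt e"
  proof (rule divide_left_mono)
    have "1 * e \<le> (2 * pi) * e" using assms(3) pi_gt3 by (intro mult_right_mono) auto
    then show "sqrt e \<le> sqrt (2 * pi * e)" by simp
  qed (use assms(3) in auto)
  ultimately have "1 / sqrt (2 * pi * e) * exp (- ?t) \<le> 1 / sqrt e * (2 * e / d\<^sup>2)"
    using assms(3) by (intro mult_mono) auto
  also have "1 / sqrt e * (2 * e / d\<^sup>2) = e / sqrt e * (2 / d\<^sup>2)" by simp
  also have "\<dots> = 2 * sqrt e / d\<^sup>2"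
    using assms(3) by (simp add: real_div_sqrt)
  finally show ?thesis using assms(3) by (simp add: normal_density_def)
qed

lemma normal_density_approximate_identity:
  fixes f :: "real \<Rightarrow> real"
  assumes fm: "f \<in> borel_measurable lborel" and f2: "integrable lborel (\<lambda>x. (f x)\<^sup>2)"
    and cont: "isCont f x"
  shows "((\<lambda>e. LINT y|lborel. f y * normal_density x (sqrt e) y) \<longlongrightarrow> f x) (at_right 0)"
proof (rule tendstoI)
  fix r :: real assume r: "r > 0"
  obtain d where d: "d > 0" "\<And>y. \<bar>y - x\<bar> < d \<Longrightarrow> \<bar>f y - f x\<bar> < r / 2"
    using cont r unfolding continuous_at_eps_delta by (metis dist_real_def half_gt_zero)
  define S where "S = (LINT y|lborel. (f y)\<^sup>2)"
  \<comment> \<open>The three terms: the oscillation of \<open>f\<close> within distance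
    \<open>d\<close>; a Chebyshev bound with variance \<open>e\<close> for the constant 1 + |f x|;
    and the smallness of the density off the centre, paired with f^2. The last two come from |f y|
    being at most 1 + f(y)^2, since \<open>f\<close> need not be bounded far from
    \<open>x\<close>.\<close>
  define B where "B = (\<lambda>e. r / 2 + (1 + \<bar>f x\<bar>) / d\<^sup>2 * e + 2 * sqrt e / d\<^sup>2 * S)"
  have "(B \<longlongrightarrow> r / 2 + (1 + \<bar>f x\<bar>) / d\<^sup>2 * 0 + 2 * sqrt 0 / d\<^sup>2 * S) (at_right 0)"
    unfolding B_def using d(1) by (intro tendsto_intros) auto
  then have "(B \<longlongrightarrow> r / 2) (at_right 0)" by simp
  then have "\<forall>\<^sub>F e in at_right 0. B e < r"
    by (rule order_tendstoD(2)) (use r in simp)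
  moreover have "\<forall>\<^sub>F e in at_right 0. (0::real) < e"
    by (rule eventually_at_right_less)
  ultimately show "\<forall>\<^sub>F e in at_right 0. dist (LINT y|lborel. f y * normal_density x (sqrt e) y) (f x) < r"
  proof eventually_elim
    case (elim e)
    let ?n = "normal_density x (sqrt e)"
    have s: "0 < sqrt e" using elim by simp
    have i1: "integrable lborel ?n" "(LINT y|lborel. ?n y) = 1" using s by auto
    have fn: "integrable lborel (\<lambda>y. f y * ?n y)"
      by (rule integrable_mult_normal_density[OF fm f2 s])
    have mom: "has_bochner_integral lborel (\<lambda>y. ?n y * (y - x)\<^sup>2) e"
      using normal_moment_even[OF s, of x 1] elim by simp
    have le: "\<bar>(f y - f x) * ?n y\<bar> \<le> r / 2 * ?n y + (1 + \<bar>f x\<bar>) / d\<^sup>2 * (?n y * (y - x)\<^sup>2)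
        + 2 * sqrt e / d\<^sup>2 * (f y)\<^sup>2" (is "_ \<le> ?R y") for y
    proof (cases "\<bar>y - x\<bar> < d")
      case True
      have "\<bar>(f y - f x) * ?n y\<bar> \<le> r / 2 * ?n y"
        using mult_right_mono[OF less_imp_le[OF d(2)[OF True]] normal_density_nonneg, of x "sqrt e" y]
        by (simp only: abs_mult abs_of_nonneg[OF normal_density_nonneg])
      moreover have "0 \<le> (1 + \<bar>f x\<bar>) / d\<^sup>2 * (?n y * (y - x)\<^sup>2)" "0 \<le> 2 * sqrt e / d\<^sup>2 * (f y)\<^sup>2"
        using elim by auto
      ultimately show ?thesis by linarith
    next
      case False
      then have "d\<^sup>2 \<le> (y - x)\<^sup>2" using d(1) by (metis abs_le_square_iff abs_of_pos linorder_not_less)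
      then have one: "1 \<le> (y - x)\<^sup>2 / d\<^sup>2" using d(1) by simp
      have "\<bar>f y\<bar> \<le> 1 + (f y)\<^sup>2"
        using zero_le_power2[of "\<bar>f y\<bar> - 1"] by (simp add: power2_diff)
      then have "\<bar>f y - f x\<bar> * ?n y \<le> ((1 + \<bar>f x\<bar>) + (f y)\<^sup>2) * ?n y"
        by (intro mult_right_mono) auto
      also have "\<dots> = (1 + \<bar>f x\<bar>) * ?n y * 1 + (f y)\<^sup>2 * ?n y" by (simp add: algebra_simps)
      also have "\<dots> \<le> (1 + \<bar>f x\<bar>) * ?n y * ((y - x)\<^sup>2 / d\<^sup>2) + (f y)\<^sup>2 * (2 * sqrt e / d\<^sup>2)"
        using one normal_density_le_far[of d y x e] False d(1) elim
        by (intro add_mono mult_left_mono) auto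
      finally have "\<bar>f y - f x\<bar> * ?n y \<le> (1 + \<bar>f x\<bar>) / d\<^sup>2 * (?n y * (y - x)\<^sup>2) + 2 * sqrt e / d\<^sup>2 * (f y)\<^sup>2"
        by (simp add: field_simps)
      moreover have "0 \<le> r / 2 * ?n y" using r by auto
      ultimately show ?thesis by (simp add: abs_mult)
    qed
    have R: "integrable lborel ?R" "(LINT y|lborel. ?R y) = B e"
      using mom i1 f2 by (auto simp: has_bochner_integral_iff B_def S_def)
    have eq: "(LINT y|lborel. f y * ?n y) - f x = (LINT y|lborel. (f y - f x) * ?n y)"
      using fn i1 by (simp add: left_diff_distrib)
    have "\<bar>LINT y|lborel. (f y - f x) * ?n y\<bar> \<le> (LINT y|lborel. \<bar>(f y - f x) * ?n y\<bar>)"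
      by (rule integral_abs_bound)
    also have "\<dots> \<le> (LINT y|lborel. ?R y)"
    proof (rule integral_mono[OF integrable_abs R(1) le])
      show "integrable lborel (\<lambda>y. (f y - f x) * ?n y)"
        using fn i1(1) by (simp add: left_diff_distrib)
    qed
    finally show ?case using elim R(2) eq by (simp add: dist_real_def)
  qed
qed

text \<open>The Gaussian is removed along e = 1/(n+1) in \<open>has_L2_fourier_gauss\<close>: the
  frequency side is dominated by |g|, and the space side is an approximate identity at the
  continuity point \<open>x\<close>.\<close>

theorem has_L2_fourier_inversion:
  assumes f: "has_L2_fourier f g" and cont: "isCont f x" and g1: "integrable lborel g"
  shows "(LINT \<xi>|lborel. cis (x * \<xi>) * g \<xi>) = of_real (sqrt (2 * pi) * f x)"
proof -
  have fm: "f \<in> borel_measurable lborel" and f2: "integrable lborel (\<lambda>x. (f x)\<^sup>2)"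
    using f unfolding has_L2_fourier_def by auto
  let ?X = "\<lambda>n. 1 / real (Suc n)"
  have X: "filterlim ?X (at_right 0) sequentially"
    unfolding filterlim_at
    using LIMSEQ_inverse_real_of_nat by (auto simp: inverse_eq_divide intro!: always_eventually)
  note [measurable] = borel_measurable_integrable[OF g1]
  have "(\<lambda>n. LINT \<xi>|lborel. g \<xi> * (cis (x * \<xi>) * of_real (exp (- ?X n * \<xi>\<^sup>2 / 2))))
      \<longlonglongrightarrow> (LINT \<xi>|lborel. g \<xi> * (cis (x * \<xi>) * of_real (exp (- 0 * \<xi>\<^sup>2 / 2))))"
  proof (rule integral_dominated_convergence[where w="\<lambda>\<xi>. norm (g \<xi>)"])
    show "AE \<xi> in lborel. (\<lambda>n. g \<xi> * (cis (x * \<xi>) * complex_of_real (exp (- ?X n * \<xi>\<^sup>2 / 2))))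
          \<longlonglongrightarrow> g \<xi> * (cis (x * \<xi>) * of_real (exp (- 0 * \<xi>\<^sup>2 / 2)))"
      by (intro AE_I2 tendsto_intros LIMSEQ_inverse_real_of_nat[unfolded inverse_eq_divide]) auto
    show "AE \<xi> in lborel. norm (g \<xi> * (cis (x * \<xi>) * complex_of_real (exp (- ?X n * \<xi>\<^sup>2 / 2)))) \<le> norm (g \<xi>)" for n
    proof (intro AE_I2)
      fix \<xi> :: real
      have "exp (- ?X n * \<xi>\<^sup>2 / 2) \<le> 1" by (simp add: divide_nonneg_pos)
      then show "norm (g \<xi> * (cis (x * \<xi>) * complex_of_real (exp (- ?X n * \<xi>\<^sup>2 / 2)))) \<le> norm (g \<xi>)"
        by (simp only: norm_mult norm_cis norm_of_real abs_exp_cancel mult_1 mult_left_le norm_ge_zero)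
    qed
  qed (use g1 in auto)
  moreover have "(\<lambda>n. LINT \<xi>|lborel. g \<xi> * (cis (x * \<xi>) * of_real (exp (- ?X n * \<xi>\<^sup>2 / 2))))
      \<longlonglongrightarrow> of_real (sqrt (2 * pi) * f x)"
    using filterlim_compose[OF normal_density_approximate_identity[OF fm f2 cont] X]
    by (subst has_L2_fourier_gauss[OF f]) (auto intro!: tendsto_intros)
  ultimately show ?thesis
    using LIMSEQ_unique by (fastforce simp: mult.commute)
qed

section \<open>Uniqueness and linearity of the transform; Sobolev norms of differences\<close>

lemma square_add_le: "(norm (a + b))\<^sup>2 \<le> 2 * (norm a)\<^sup>2 + 2 * (norm b)\<^sup>2"
proof -
  have "(norm (a + b))\<^sup>2 \<le> (norm a + norm b)\<^sup>2"
    by (intro power_mono norm_triangle_ineq) auto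
  also have "\<dots> \<le> 2 * (norm a)\<^sup>2 + 2 * (norm b)\<^sup>2"
    using sum_squares_bound[of "norm a" "norm b"] by (simp add: power2_sum)
  finally show ?thesis .
qed

text \<open>\<open>L2_fourier\<close> is a Hilbert choice, so it can be linear only almost
  everywhere; uniqueness of the L^2 limit is what provides this.\<close>

lemma has_L2_fourier_unique:
  assumes "has_L2_fourier f g" and "has_L2_fourier f h"
  shows "AE \<xi> in lborel. g \<xi> = h \<xi>"
proof -
  let ?D = "\<lambda>g R. \<integral>\<^sup>+ \<xi>. ennreal ((cmod (fourier_truncated R f \<xi> - g \<xi>))\<^sup>2) \<partial>lborel"
  have [measurable]: "g \<in> borel_measurable lborel" "h \<in> borel_measurable lborel" "f \<in> borel_measurable lborel"
    and lim: "((?D g) \<longlongrightarrow> 0) at_top" "((?D h) \<longlongrightarrow> 0) at_top"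
    using assms unfolding has_L2_fourier_def by auto
  have [measurable]: "fourier_truncated R f \<in> borel_measurable lborel" for R
    by (rule fourier_truncated_measurable) simp
  let ?I = "\<integral>\<^sup>+ \<xi>. ennreal ((cmod (g \<xi> - h \<xi>))\<^sup>2) \<partial>lborel"
  have "?I \<le> 2 * ?D g R + 2 * ?D h R" for R
  proof -
    have "ennreal ((cmod (g \<xi> - h \<xi>))\<^sup>2) \<le> 2 * ennreal ((cmod (fourier_truncated R f \<xi> - g \<xi>))\<^sup>2)
       + 2 * ennreal ((cmod (fourier_truncated R f \<xi> - h \<xi>))\<^sup>2)" for \<xi>
    proof -
      have "(cmod (g \<xi> - h \<xi>))\<^sup>2 \<le> 2 * (cmod (fourier_truncated R f \<xi> - g \<xi>))\<^sup>2
         + 2 * (cmod (fourier_truncated R f \<xi> - h \<xi>))\<^sup>2"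
        using square_add_le[of "g \<xi> - fourier_truncated R f \<xi>" "fourier_truncated R f \<xi> - h \<xi>"]
        by (simp add: norm_minus_commute)
      then have "ennreal ((cmod (g \<xi> - h \<xi>))\<^sup>2) \<le> ennreal (2 * (cmod (fourier_truncated R f \<xi> - g \<xi>))\<^sup>2
         + 2 * (cmod (fourier_truncated R f \<xi> - h \<xi>))\<^sup>2)"
        by (rule ennreal_leI)
      then show ?thesis by (simp add: ennreal_mult)
    qed
    then have "?I \<le> (\<integral>\<^sup>+ \<xi>. 2 * ennreal ((cmod (fourier_truncated R f \<xi> - g \<xi>))\<^sup>2)
       + 2 * ennreal ((cmod (fourier_truncated R f \<xi> - h \<xi>))\<^sup>2) \<partial>lborel)"
      by (rule nn_integral_mono)
    also have "\<dots> = 2 * ?D g R + 2 * ?D h R"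
      by (simp add: nn_integral_add nn_integral_cmult)
    finally show ?thesis .
  qed
  moreover have "((\<lambda>R. 2 * ?D g R + 2 * ?D h R) \<longlongrightarrow> 2 * 0 + 2 * 0) at_top"
    by (intro tendsto_add ennreal_tendsto_cmult lim) auto
  ultimately have "?I \<le> 2 * 0 + 2 * 0"
    by (intro tendsto_lowerbound[of _ _ at_top]) auto
  then have "AE \<xi> in lborel. ennreal ((cmod (g \<xi> - h \<xi>))\<^sup>2) = 0"
    by (subst nn_integral_0_iff_AE[symmetric]) auto
  then show ?thesis by eventually_elim simp
qed

lemma has_L2_fourier_diff:
  assumes "has_L2_fourier f g" and "has_L2_fourier f' g'"
  shows "has_L2_fourier (\<lambda>x. f x - f' x) (\<lambda>\<xi>. g \<xi> - g' \<xi>)"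
proof -
  let ?D = "\<lambda>f g R. \<integral>\<^sup>+ \<xi>. ennreal ((cmod (fourier_truncated R f \<xi> - g \<xi>))\<^sup>2) \<partial>lborel"
  have m[measurable]: "g \<in> borel_measurable lborel" "g' \<in> borel_measurable lborel"
      "f \<in> borel_measurable lborel" "f' \<in> borel_measurable lborel"
    and i: "integrable lborel (\<lambda>x. (f x)\<^sup>2)" "integrable lborel (\<lambda>x. (f' x)\<^sup>2)"
      "integrable lborel (\<lambda>x. (cmod (g x))\<^sup>2)" "integrable lborel (\<lambda>x. (cmod (g' x))\<^sup>2)"
    and lim: "((?D f g) \<longlongrightarrow> 0) at_top" "((?D f' g') \<longlongrightarrow> 0) at_top"
    using assms unfolding has_L2_fourier_def by auto
  have [measurable]: "fourier_truncated R f \<in> borel_measurable lborel" "fourier_truncated R f' \<in> borel_measurable lborel" for R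
    by (rule fourier_truncated_measurable, simp)+
  have sq: "integrable lborel (\<lambda>x. (norm (p x - q x))\<^sup>2)"
    if "p \<in> borel_measurable lborel" "q \<in> borel_measurable lborel"
      "integrable lborel (\<lambda>x. (norm (p x))\<^sup>2)" "integrable lborel (\<lambda>x. (norm (q x))\<^sup>2)"
    for p q :: "real \<Rightarrow> 'b::{real_normed_vector,second_countable_topology}"
  proof (rule Bochner_Integration.integrable_bound)
    show "integrable lborel (\<lambda>x. 2 * (norm (p x))\<^sup>2 + 2 * (norm (q x))\<^sup>2)"
      using that by auto
    show "AE x in lborel. norm ((norm (p x - q x))\<^sup>2) \<le> norm (2 * (norm (p x))\<^sup>2 + 2 * (norm (q x))\<^sup>2)"
      using square_add_le[of "p _" "- q _"] by auto
    show "(\<lambda>x. (norm (p x - q x))\<^sup>2) \<in> borel_measurable lborel" using that(1,2) by simp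
  qed
  have "fourier_truncated R (\<lambda>x. f x - f' x) \<xi> = fourier_truncated R f \<xi> - fourier_truncated R f' \<xi>" for R \<xi>
    unfolding fourier_truncated_def
    by (simp add: right_diff_distrib set_integral_diff(2)[OF fourier_truncated_integrand_integrable[OF m(3) i(1)]
      fourier_truncated_integrand_integrable[OF m(4) i(2)]])
  then have "ennreal ((cmod (fourier_truncated R (\<lambda>x. f x - f' x) \<xi> - (g \<xi> - g' \<xi>)))\<^sup>2)
     \<le> 2 * ennreal ((cmod (fourier_truncated R f \<xi> - g \<xi>))\<^sup>2) + 2 * ennreal ((cmod (fourier_truncated R f' \<xi> - g' \<xi>))\<^sup>2)" for R \<xi>
  proof -
    have "(cmod (fourier_truncated R f \<xi> - fourier_truncated R f' \<xi> - (g \<xi> - g' \<xi>)))\<^sup>2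
     \<le> 2 * (cmod (fourier_truncated R f \<xi> - g \<xi>))\<^sup>2 + 2 * (cmod (fourier_truncated R f' \<xi> - g' \<xi>))\<^sup>2"
      using square_add_le[of "fourier_truncated R f \<xi> - g \<xi>" "- (fourier_truncated R f' \<xi> - g' \<xi>)"]
      unfolding norm_minus_cancel by (simp add: algebra_simps)
    then have "ennreal ((cmod (fourier_truncated R f \<xi> - fourier_truncated R f' \<xi> - (g \<xi> - g' \<xi>)))\<^sup>2)
     \<le> ennreal (2 * (cmod (fourier_truncated R f \<xi> - g \<xi>))\<^sup>2 + 2 * (cmod (fourier_truncated R f' \<xi> - g' \<xi>))\<^sup>2)"
      by (rule ennreal_leI)
    then show ?thesis
      using \<open>fourier_truncated R (\<lambda>x. f x - f' x) \<xi> = _\<close> by (simp add: ennreal_mult)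
  qed
  then have "?D (\<lambda>x. f x - f' x) (\<lambda>\<xi>. g \<xi> - g' \<xi>) R \<le>
      (\<integral>\<^sup>+ \<xi>. 2 * ennreal ((cmod (fourier_truncated R f \<xi> - g \<xi>))\<^sup>2)
       + 2 * ennreal ((cmod (fourier_truncated R f' \<xi> - g' \<xi>))\<^sup>2) \<partial>lborel)" for R
    by (rule nn_integral_mono)
  moreover have "(\<integral>\<^sup>+ \<xi>. 2 * ennreal ((cmod (fourier_truncated R f \<xi> - g \<xi>))\<^sup>2)
       + 2 * ennreal ((cmod (fourier_truncated R f' \<xi> - g' \<xi>))\<^sup>2) \<partial>lborel) = 2 * ?D f g R + 2 * ?D f' g' R" for R
    by (simp add: nn_integral_add nn_integral_cmult)
  ultimately have le: "?D (\<lambda>x. f x - f' x) (\<lambda>\<xi>. g \<xi> - g' \<xi>) R \<le> 2 * ?D f g R + 2 * ?D f' g' R" for R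
    by simp
  have "((\<lambda>R. 2 * ?D f g R + 2 * ?D f' g' R) \<longlongrightarrow> 2 * 0 + 2 * 0) at_top"
    by (intro tendsto_add ennreal_tendsto_cmult lim) auto
  then have "((\<lambda>R. 2 * ?D f g R + 2 * ?D f' g' R) \<longlongrightarrow> 0) at_top" by simp
  then have "((?D (\<lambda>x. f x - f' x) (\<lambda>\<xi>. g \<xi> - g' \<xi>)) \<longlongrightarrow> 0) at_top"
    by (rule tendsto_sandwich[OF always_eventually always_eventually tendsto_const, rotated 2]) (simp, blast intro: le)
  then show ?thesis
    using sq[OF m(1,2) i(3,4)] sq[OF m(3,4)] i(1,2) unfolding has_L2_fourier_def by simp
qed

lemma L2_fourier_works: "has_L2_fourier f g \<Longrightarrow> has_L2_fourier f (L2_fourier f)"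
  unfolding L2_fourier_def by (rule someI[where P="has_L2_fourier f"])

lemma sobolev_diff:
  assumes "f \<in> sobolev s" and "g \<in> sobolev s"
  shows "(\<lambda>x. f x - g x) \<in> sobolev s"
    and "AE \<xi> in lborel. L2_fourier (\<lambda>x. f x - g x) \<xi> = L2_fourier f \<xi> - L2_fourier g \<xi>"
proof -
  have f: "has_L2_fourier f (L2_fourier f)" "integrable lborel (\<lambda>\<xi>. (1 + \<xi>\<^sup>2) powr s * (cmod (L2_fourier f \<xi>))\<^sup>2)"
   and g: "has_L2_fourier g (L2_fourier g)" "integrable lborel (\<lambda>\<xi>. (1 + \<xi>\<^sup>2) powr s * (cmod (L2_fourier g \<xi>))\<^sup>2)"
    using assms L2_fourier_works unfolding sobolev_def by auto
  note d = has_L2_fourier_diff[OF f(1) g(1)]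
  note w = L2_fourier_works[OF d]
  show ae: "AE \<xi> in lborel. L2_fourier (\<lambda>x. f x - g x) \<xi> = L2_fourier f \<xi> - L2_fourier g \<xi>"
    by (rule has_L2_fourier_unique[OF w d])
  have [measurable]: "L2_fourier (\<lambda>x. f x - g x) \<in> borel_measurable lborel"
    using w unfolding has_L2_fourier_def by auto
  have "integrable lborel (\<lambda>\<xi>. 2 * ((1 + \<xi>\<^sup>2) powr s * (cmod (L2_fourier f \<xi>))\<^sup>2)
       + 2 * ((1 + \<xi>\<^sup>2) powr s * (cmod (L2_fourier g \<xi>))\<^sup>2))"
    by (intro Bochner_Integration.integrable_add integrable_mult_right f(2) g(2))
  then have "integrable lborel (\<lambda>\<xi>. (1 + \<xi>\<^sup>2) powr s * (cmod (L2_fourier (\<lambda>x. f x - g x) \<xi>))\<^sup>2)"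
  proof (rule Bochner_Integration.integrable_bound)
    show "AE \<xi> in lborel. norm ((1 + \<xi>\<^sup>2) powr s * (cmod (L2_fourier (\<lambda>x. f x - g x) \<xi>))\<^sup>2)
      \<le> norm (2 * ((1 + \<xi>\<^sup>2) powr s * (cmod (L2_fourier f \<xi>))\<^sup>2)
       + 2 * ((1 + \<xi>\<^sup>2) powr s * (cmod (L2_fourier g \<xi>))\<^sup>2))"
      using ae
    proof eventually_elim
      case (elim \<xi>)
      have "(1 + \<xi>\<^sup>2) powr s * (cmod (L2_fourier f \<xi> - L2_fourier g \<xi>))\<^sup>2
        \<le> (1 + \<xi>\<^sup>2) powr s * (2 * (cmod (L2_fourier f \<xi>))\<^sup>2 + 2 * (cmod (L2_fourier g \<xi>))\<^sup>2)"
        using square_add_le[of "L2_fourier f \<xi>" "- L2_fourier g \<xi>"] by (intro mult_left_mono) auto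
      then show ?case unfolding elim by (simp add: algebra_simps)
    qed
  qed simp
  then show "(\<lambda>x. f x - g x) \<in> sobolev s"
    unfolding sobolev_def using w by auto
qed

text \<open>A substitute for the triangle inequality, taken pointwise in frequency from
  \<open>square_add_le\<close>. The factor 2 is harmless because it serves only to bound the norm
  locally in time.\<close>

lemma sobolev_norm_square_le:
  assumes "f \<in> sobolev s" and "g \<in> sobolev s"
  shows "(sobolev_norm s f)\<^sup>2 \<le> 2 * (sobolev_norm s g)\<^sup>2 + 2 * (sobolev_norm s (\<lambda>x. f x - g x))\<^sup>2"
proof -
  let ?e = "\<lambda>f \<xi>. (1 + \<xi>\<^sup>2) powr s * (cmod (L2_fourier f \<xi>))\<^sup>2"
  note d = sobolev_diff[OF assms]
  have i: "integrable lborel (?e f)" "integrable lborel (?e g)" "integrable lborel (?e (\<lambda>x. f x - g x))"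
    using assms d unfolding sobolev_def by auto
  have sq: "(sobolev_norm s h)\<^sup>2 = (LINT \<xi>|lborel. ?e h \<xi>)" for h
    unfolding sobolev_norm_def by (simp add: integral_nonneg_AE)
  have "(LINT \<xi>|lborel. ?e f \<xi>) \<le> (LINT \<xi>|lborel. 2 * ?e g \<xi> + 2 * ?e (\<lambda>x. f x - g x) \<xi>)"
  proof (rule integral_mono_AE)
    show "AE \<xi> in lborel. ?e f \<xi> \<le> 2 * ?e g \<xi> + 2 * ?e (\<lambda>x. f x - g x) \<xi>"
      using d(2)
    proof eventually_elim
      case (elim \<xi>)
      have "(1 + \<xi>\<^sup>2) powr s * (cmod (L2_fourier f \<xi>))\<^sup>2
        \<le> (1 + \<xi>\<^sup>2) powr s * (2 * (cmod (L2_fourier g \<xi>))\<^sup>2 + 2 * (cmod (L2_fourier f \<xi> - L2_fourier g \<xi>))\<^sup>2)"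
        using square_add_le[of "L2_fourier g \<xi>" "L2_fourier f \<xi> - L2_fourier g \<xi>"] by (intro mult_left_mono) auto
      then show ?case unfolding elim by (simp add: algebra_simps)
    qed
  qed (use i in auto)
  then show ?thesis unfolding sq using i by simp
qed

section \<open>Sobolev embedding\<close>

text \<open>Comparison with |x|^(2p) outside [-1,1], where 2p < -1; the negative half-line is
  obtained by reflection.\<close>

lemma integrable_one_plus_square_powr:
  fixes p :: real
  assumes "p < - 1 / 2"
  shows "integrable lborel (\<lambda>\<xi>::real. (1 + \<xi>\<^sup>2) powr p)"
proof -
  let ?h = "\<lambda>x::real. indicator {1..} x *\<^sub>R x powr (2 * p)"
  have "(\<lambda>x::real. x powr (2 * p)) integrable_on {1..}"
    using has_integral_powr_to_inf[of "2 * p" 1] assms by (auto simp: integrable_on_def)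
  then have "(\<lambda>x::real. x powr (2 * p)) absolutely_integrable_on {1..}"
    by (rule nonnegative_absolutely_integrable_1) simp
  then have "integrable lebesgue ?h" by (simp add: set_integrable_def)
  then have h: "integrable lborel ?h" by (subst (asm) integrable_completion) auto
  have h': "integrable lborel (\<lambda>x. ?h (0 + (- 1) * x))"
    by (rule lborel_integrable_real_affine[OF h]) simp
  have "integrable lborel (\<lambda>x::real. indicator {-1..1} x + (?h x + ?h (0 + (- 1) * x)))"
    by (intro Bochner_Integration.integrable_add h h') (simp add: integrable_indicator_iff emeasure_lborel_Icc_eq)
  then show ?thesis
  proof (rule Bochner_Integration.integrable_bound)
    have far: "(1 + x\<^sup>2) powr p \<le> \<bar>x\<bar> powr (2 * p)" if "1 \<le> \<bar>x\<bar>" for x :: real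
    proof -
      have "(1 + x\<^sup>2) powr p \<le> (x\<^sup>2) powr p"
        using assms that by (intro powr_mono2') auto
      also have "(x\<^sup>2) powr p = \<bar>x\<bar> powr (2 * p)"
        using that powr_powr[of "\<bar>x\<bar>" 2 p] by simp
      finally show ?thesis .
    qed
    have near: "(1 + x\<^sup>2) powr p \<le> 1" for x :: real
      using powr_mono[of p 0 "1 + x\<^sup>2"] assms by (auto split: if_splits)
    show "AE x in lborel. norm ((1 + x\<^sup>2) powr p) \<le> norm (indicator {-1..1} x + (?h x + ?h (0 + (- 1) * x)))"
    proof (rule AE_I2)
      fix x :: real
      consider "\<bar>x\<bar> < 1" | "1 \<le> x" | "x \<le> -1" by linarith
      then show "norm ((1 + x\<^sup>2) powr p) \<le> norm (indicator {-1..1} x + (?h x + ?h (0 + (- 1) * x)))"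
        by cases (use near[of x] far[of x] in \<open>auto simp: indicator_def abs_if\<close>)
    qed
  qed simp
qed

lemma Cauchy_Schwarz_integral:
  fixes f g :: "'a \<Rightarrow> real"
  assumes [measurable]: "f \<in> borel_measurable M" "g \<in> borel_measurable M"
    and f2: "integrable M (\<lambda>x. (f x)\<^sup>2)" and g2: "integrable M (\<lambda>x. (g x)\<^sup>2)"
    and nn: "\<And>x. 0 \<le> f x" "\<And>x. 0 \<le> g x"
  shows "integrable M (\<lambda>x. f x * g x)"
    and "(LINT x|M. f x * g x) \<le> sqrt (LINT x|M. (f x)\<^sup>2) * sqrt (LINT x|M. (g x)\<^sup>2)"
proof -
  show fg: "integrable M (\<lambda>x. f x * g x)"
    by (rule integrable_mult_of_squares) (use f2 g2 in auto)
  let ?I = "LINT x|M. f x * g x" and ?F = "LINT x|M. (f x)\<^sup>2" and ?G = "LINT x|M. (g x)\<^sup>2"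
  have pos: "0 \<le> ?I" "0 \<le> ?F" "0 \<le> ?G" using nn by (auto intro!: integral_nonneg_AE)
  have "(\<integral>\<^sup>+x. ennreal (f x) * ennreal (g x) \<partial>M)\<^sup>2 \<le> (\<integral>\<^sup>+x. (ennreal (f x))\<^sup>2 \<partial>M) * (\<integral>\<^sup>+x. (ennreal (g x))\<^sup>2 \<partial>M)"
    by (rule Cauchy_Schwarz_nn_integral) auto
  also have "(\<integral>\<^sup>+x. ennreal (f x) * ennreal (g x) \<partial>M) = ennreal ?I"
    using nn nn_integral_eq_integral[OF fg] by (simp add: ennreal_mult)
  also have "(\<integral>\<^sup>+x. (ennreal (f x))\<^sup>2 \<partial>M) = ennreal ?F"
    using nn nn_integral_eq_integral[OF f2] by (simp add: ennreal_power)
  also have "(\<integral>\<^sup>+x. (ennreal (g x))\<^sup>2 \<partial>M) = ennreal ?G"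
    using nn nn_integral_eq_integral[OF g2] by (simp add: ennreal_power)
  finally have "ennreal (?I\<^sup>2) \<le> ennreal (?F * ?G)"
    using pos by (simp add: ennreal_power ennreal_mult)
  then have "?I\<^sup>2 \<le> ?F * ?G" using pos by simp
  then have "sqrt (?I\<^sup>2) \<le> sqrt (?F * ?G)" by (rule real_sqrt_le_mono)
  then show "?I \<le> sqrt ?F * sqrt ?G" using pos by (simp add: real_sqrt_mult)
qed

text \<open>Cauchy-Schwarz after splitting (1 + \<xi>^2)^(k/2), which dominates |\<xi>|^k, into the
  powers (k - s)/2 and s/2. The first factor is square integrable because s - k > 1/2; this is the
  origin of the threshold in the embedding.\<close>

lemma weighted_L1_bound:
  fixes g :: "real \<Rightarrow> complex" and s :: real and k :: nat
  assumes s: "s > k + 1 / 2" and [measurable]: "g \<in> borel_measurable lborel"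
    and g2: "integrable lborel (\<lambda>\<xi>. (1 + \<xi>\<^sup>2) powr s * (cmod (g \<xi>))\<^sup>2)"
  shows "integrable lborel (\<lambda>\<xi>. \<bar>\<xi>\<bar> ^ k * cmod (g \<xi>))"
    and "(LINT \<xi>|lborel. \<bar>\<xi>\<bar> ^ k * cmod (g \<xi>)) \<le>
      sqrt (LINT \<xi>|lborel. (1 + \<xi>\<^sup>2) powr (k - s)) * sqrt (LINT \<xi>|lborel. (1 + \<xi>\<^sup>2) powr s * (cmod (g \<xi>))\<^sup>2)"
proof -
  let ?a = "\<lambda>\<xi>::real. (1 + \<xi>\<^sup>2) powr ((k - s) / 2)"
  let ?b = "\<lambda>\<xi>. (1 + \<xi>\<^sup>2) powr (s / 2) * cmod (g \<xi>)"
  have a2: "(?a \<xi>)\<^sup>2 = (1 + \<xi>\<^sup>2) powr (k - s)" for \<xi>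
    by (simp add: power2_eq_square flip: powr_add)
  have b2: "(?b \<xi>)\<^sup>2 = (1 + \<xi>\<^sup>2) powr s * (cmod (g \<xi>))\<^sup>2" for \<xi>
    by (simp add: power_mult_distrib) (simp add: power2_eq_square flip: powr_add)
  have ia: "integrable lborel (\<lambda>\<xi>. (?a \<xi>)\<^sup>2)"
    unfolding a2 using s by (intro integrable_one_plus_square_powr) simp
  have ib: "integrable lborel (\<lambda>\<xi>. (?b \<xi>)\<^sup>2)" unfolding b2 by (rule g2)
  have ab: "integrable lborel (\<lambda>\<xi>. ?a \<xi> * ?b \<xi>)"
    "(LINT \<xi>|lborel. ?a \<xi> * ?b \<xi>) \<le> sqrt (LINT \<xi>|lborel. (?a \<xi>)\<^sup>2) * sqrt (LINT \<xi>|lborel. (?b \<xi>)\<^sup>2)"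
    by (rule Cauchy_Schwarz_integral[OF _ _ ia ib], simp_all)+
  have le: "\<bar>\<xi>\<bar> ^ k * cmod (g \<xi>) \<le> ?a \<xi> * ?b \<xi>" for \<xi>
  proof -
    have pos: "0 < 1 + \<xi>\<^sup>2" by (simp add: add_pos_nonneg)
    have "\<bar>\<xi>\<bar> \<le> sqrt (1 + \<xi>\<^sup>2)" by (rule real_le_rsqrt) simp
    then have "\<bar>\<xi>\<bar> ^ k \<le> sqrt (1 + \<xi>\<^sup>2) ^ k" by (intro power_mono) auto
    also have "sqrt (1 + \<xi>\<^sup>2) = (1 + \<xi>\<^sup>2) powr (1 / 2)"
      using pos by (subst powr_half_sqrt) auto
    also have "((1 + \<xi>\<^sup>2) powr (1 / 2)) ^ k = (1 + \<xi>\<^sup>2) powr (k / 2)"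
      using pos by (subst powr_power) auto
    also have "\<dots> = (1 + \<xi>\<^sup>2) powr ((k - s) / 2) * (1 + \<xi>\<^sup>2) powr (s / 2)"
      by (simp add: diff_divide_distrib flip: powr_add)
    finally show ?thesis by (simp add: mult_right_mono flip: mult.assoc)
  qed
  show i: "integrable lborel (\<lambda>\<xi>. \<bar>\<xi>\<bar> ^ k * cmod (g \<xi>))"
    by (rule Bochner_Integration.integrable_bound[OF ab(1)]) (use le in \<open>auto simp: abs_mult\<close>)
  have "(LINT \<xi>|lborel. \<bar>\<xi>\<bar> ^ k * cmod (g \<xi>)) \<le> (LINT \<xi>|lborel. ?a \<xi> * ?b \<xi>)"
    by (rule integral_mono[OF i ab(1) le])
  with ab(2) show "(LINT \<xi>|lborel. \<bar>\<xi>\<bar> ^ k * cmod (g \<xi>)) \<le>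
      sqrt (LINT \<xi>|lborel. (1 + \<xi>\<^sup>2) powr (k - s)) * sqrt (LINT \<xi>|lborel. (1 + \<xi>\<^sup>2) powr s * (cmod (g \<xi>))\<^sup>2)"
    unfolding a2 b2 by linarith
qed

section \<open>Regularity of inverse Fourier integrals of integrable functions\<close>

lemma norm_cis_diff_le: "cmod (cis a - cis b) \<le> \<bar>a - b\<bar>"
proof -
  have "cis a - cis b = cis b * (cis (a - b) - 1)"
    by (simp add: algebra_simps cis_mult)
  also have "cmod \<dots> \<le> \<bar>a - b\<bar>"
    using iexp_approx1[of "a - b" 0] by (simp add: norm_mult cis_conv_exp)
  finally show ?thesis .
qed

lemma abs_Re_cis_mult_le: "\<bar>Re (cis t * z)\<bar> \<le> cmod z"
  using abs_Re_le_cmod[of "cis t * z"] by (simp add: norm_mult del: times_complex.sel)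

text \<open>The inverse Fourier transform up to the factor 1 / sqrt(2 pi), with real parts taken at
  once so that \<open>deriv\<close> acts on real functions.\<close>

definition cis_integral :: "(real \<Rightarrow> complex) \<Rightarrow> real \<Rightarrow> real" where
  "cis_integral h x = (LINT \<xi>|lborel. Re (cis (x * \<xi>) * h \<xi>))"

lemma cis_integral_bound:
  assumes "integrable lborel h"
  shows "\<bar>cis_integral h x\<bar> \<le> (LINT \<xi>|lborel. cmod (h \<xi>))"
proof -
  note [measurable] = borel_measurable_integrable[OF assms]
  note le = abs_Re_cis_mult_le
  have n: "integrable lborel (\<lambda>\<xi>. cmod (h \<xi>))" using assms by simp
  have i: "integrable lborel (\<lambda>\<xi>. Re (cis (x * \<xi>) * h \<xi>))"
    by (rule Bochner_Integration.integrable_bound[OF n]) (use le in \<open>simp_all del: times_complex.sel\<close>)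
  have "\<bar>cis_integral h x\<bar> \<le> (LINT \<xi>|lborel. \<bar>Re (cis (x * \<xi>) * h \<xi>)\<bar>)"
    unfolding cis_integral_def by (rule integral_abs_bound)
  also have "\<dots> \<le> (LINT \<xi>|lborel. cmod (h \<xi>))"
    by (rule integral_mono[OF integrable_abs[OF i] n le])
  finally show ?thesis .
qed

lemma cis_integral_continuous:
  assumes "integrable lborel h"
  shows "isCont (cis_integral h) x"
  unfolding continuous_at_sequentially comp_def cis_integral_def
proof (intro allI impI)
  note [measurable] = borel_measurable_integrable[OF assms]
  fix X :: "nat \<Rightarrow> real" assume X: "X \<longlonglongrightarrow> x"
  show "(\<lambda>n. LINT \<xi>|lborel. Re (cis (X n * \<xi>) * h \<xi>)) \<longlonglongrightarrow> (LINT \<xi>|lborel. Re (cis (x * \<xi>) * h \<xi>))"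
  proof (rule integral_dominated_convergence[where w="\<lambda>\<xi>. cmod (h \<xi>)"])
    have "isCont cis y" for y
      using continuous_on_cis[OF continuous_on_id, of UNIV] by (simp add: continuous_on_eq_continuous_at)
    then show "AE \<xi> in lborel. (\<lambda>n. Re (cis (X n * \<xi>) * h \<xi>)) \<longlonglongrightarrow> Re (cis (x * \<xi>) * h \<xi>)"
      using X by (intro AE_I2 tendsto_intros isCont_tendsto_compose[of _ cis]) auto
    show "AE \<xi> in lborel. norm (Re (cis (X n * \<xi>) * h \<xi>)) \<le> cmod (h \<xi>)" for n
      using abs_Re_cis_mult_le by (simp del: times_complex.sel)
  qed (use assms in auto)
qed

text \<open>Dominated convergence for difference quotients: \<open>norm_cis_diff_le\<close> bounds
  them by |\<xi>| |h|, which is the modulus of the second integrand assumed integrable.\<close>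

lemma cis_integral_has_derivative:
  assumes h: "integrable lborel h" and h1: "integrable lborel (\<lambda>\<xi>. \<i> * of_real \<xi> * h \<xi>)"
  shows "(cis_integral h has_real_derivative cis_integral (\<lambda>\<xi>. \<i> * of_real \<xi> * h \<xi>) x) (at x)"
  unfolding has_field_derivative_iff tendsto_at_iff_sequentially comp_def
proof (intro allI impI)
  note [measurable] = borel_measurable_integrable[OF h]
  fix X :: "nat \<Rightarrow> real" assume ne: "\<forall>i. X i \<in> UNIV - {x}" and X: "X \<longlonglongrightarrow> x"
  have Xn: "X n - x \<noteq> 0" for n using ne by auto
  have i: "integrable lborel (\<lambda>\<xi>. Re (cis (y * \<xi>) * h \<xi>))" for y
  proof (rule Bochner_Integration.integrable_bound)
    show "integrable lborel (\<lambda>\<xi>. cmod (h \<xi>))" using h by simp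
    show "AE \<xi> in lborel. norm (Re (cis (y * \<xi>) * h \<xi>)) \<le> norm (cmod (h \<xi>))"
      using abs_Re_cis_mult_le by (simp del: times_complex.sel)
  qed simp
  have eq: "(cis_integral h (X n) - cis_integral h x) / (X n - x)
     = (LINT \<xi>|lborel. (Re (cis (X n * \<xi>) * h \<xi>) - Re (cis (x * \<xi>) * h \<xi>)) / (X n - x))" for n
    unfolding cis_integral_def using i by (simp only: Bochner_Integration.integral_diff integral_divide_zero)
  show "(\<lambda>n. (cis_integral h (X n) - cis_integral h x) / (X n - x)) \<longlonglongrightarrow> cis_integral (\<lambda>\<xi>. \<i> * of_real \<xi> * h \<xi>) x"
    unfolding eq unfolding cis_integral_def[of _ x]
  proof (rule integral_dominated_convergence[where w="\<lambda>\<xi>. cmod (\<i> * of_real \<xi> * h \<xi>)"])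
    show "AE \<xi> in lborel. (\<lambda>n. (Re (cis (X n * \<xi>) * h \<xi>) - Re (cis (x * \<xi>) * h \<xi>)) / (X n - x))
        \<longlonglongrightarrow> Re (cis (x * \<xi>) * (\<i> * of_real \<xi> * h \<xi>))"
    proof (rule AE_I2)
      fix \<xi>
      have "((\<lambda>y. Re (cis (y * \<xi>) * h \<xi>)) has_real_derivative Re (cis (x * \<xi>) * (\<i> * of_real \<xi> * h \<xi>))) (at x)"
        by (auto intro!: derivative_eq_intros simp: algebra_simps)
      then have "((\<lambda>y. (Re (cis (y * \<xi>) * h \<xi>) - Re (cis (x * \<xi>) * h \<xi>)) / (y - x)) \<longlongrightarrow> Re (cis (x * \<xi>) * (\<i> * of_real \<xi> * h \<xi>))) (at x)"
        unfolding has_field_derivative_iff .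
      then show "(\<lambda>n. (Re (cis (X n * \<xi>) * h \<xi>) - Re (cis (x * \<xi>) * h \<xi>)) / (X n - x))
        \<longlonglongrightarrow> Re (cis (x * \<xi>) * (\<i> * of_real \<xi> * h \<xi>))"
        unfolding tendsto_at_iff_sequentially comp_def using ne X by blast
    qed
    show "AE \<xi> in lborel. norm ((Re (cis (X n * \<xi>) * h \<xi>) - Re (cis (x * \<xi>) * h \<xi>)) / (X n - x)) \<le> cmod (\<i> * of_real \<xi> * h \<xi>)" for n
    proof (rule AE_I2)
      fix \<xi>
      have "\<bar>Re (cis (X n * \<xi>) * h \<xi>) - Re (cis (x * \<xi>) * h \<xi>)\<bar> = \<bar>Re ((cis (X n * \<xi>) - cis (x * \<xi>)) * h \<xi>)\<bar>"
        by (simp add: algebra_simps)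
      also have "\<dots> \<le> cmod ((cis (X n * \<xi>) - cis (x * \<xi>)) * h \<xi>)" by (rule abs_Re_le_cmod)
      also have "\<dots> \<le> \<bar>X n * \<xi> - x * \<xi>\<bar> * cmod (h \<xi>)"
        unfolding norm_mult by (intro mult_right_mono norm_cis_diff_le) auto
      also have "\<dots> = \<bar>X n - x\<bar> * (\<bar>\<xi>\<bar> * cmod (h \<xi>))"
        by (simp add: abs_mult flip: left_diff_distrib)
      finally show "norm ((Re (cis (X n * \<xi>) * h \<xi>) - Re (cis (x * \<xi>) * h \<xi>)) / (X n - x)) \<le> cmod (\<i> * of_real \<xi> * h \<xi>)"
        using Xn[of n] by (simp add: norm_mult field_simps del: times_complex.sel)
    qed
  qed (use h1 in auto)
qed

text \<open>Inversion writes \<open>f\<close> as a \<open>cis_integral\<close>, and each derivative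
  multiplies the integrand by i \<xi>, which stays integrable up to order \<open>k\<close> by
  \<open>weighted_L1_bound\<close>. Differentiability stops at order k - 1 because order k + 1 of
  the integrand need not be integrable.\<close>

lemma sobolev_embedding:
  fixes s :: real and k :: nat
  assumes s: "s > k + 1 / 2"
  shows "\<exists>K\<ge>0. \<forall>f\<in>sobolev_cont s. \<forall>j\<le>k. \<forall>x.
     isCont ((deriv ^^ j) f) x \<and> \<bar>(deriv ^^ j) f x\<bar> \<le> K * sobolev_norm s f \<and>
     (j < k \<longrightarrow> (deriv ^^ j) f differentiable at x)"
proof -
  let ?W = "\<lambda>j::nat. sqrt (LINT \<xi>|lborel. (1 + \<xi>\<^sup>2) powr (j - s))"
  define c where "c = 1 / sqrt (2 * pi)"
  \<comment> \<open>Summing the constants over all orders gives one \<open>K\<close> for every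
    \<open>j\<close>, independent of \<open>f\<close>.\<close>
  define K where "K = c * (\<Sum>j\<le>k. ?W j)"
  have W0: "0 \<le> ?W j" for j by (auto intro!: integral_nonneg_AE)
  have c0: "0 \<le> c" unfolding c_def by simp
  have "isCont ((deriv ^^ j) f) x \<and> \<bar>(deriv ^^ j) f x\<bar> \<le> K * sobolev_norm s f \<and>
     (j < k \<longrightarrow> (deriv ^^ j) f differentiable at x)" if f: "f \<in> sobolev_cont s" and j: "j \<le> k" for f j x
  proof -
    define g where "g = L2_fourier f"
    have g: "has_L2_fourier f g" "integrable lborel (\<lambda>\<xi>. (1 + \<xi>\<^sup>2) powr s * (cmod (g \<xi>))\<^sup>2)"
      and cont: "isCont f y" for y
      using f L2_fourier_works unfolding sobolev_cont_def sobolev_def g_def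
      by (auto simp: continuous_on_eq_continuous_at)
    have gm[measurable]: "g \<in> borel_measurable lborel" using g(1) unfolding has_L2_fourier_def by auto
    define h where "h = (\<lambda>(j::nat) \<xi>. (\<i> * complex_of_real \<xi>) ^ j * g \<xi>)"
    have hn: "cmod (h j \<xi>) = \<bar>\<xi>\<bar> ^ j * cmod (g \<xi>)" for j \<xi>
      by (simp add: h_def norm_mult norm_power)
    have hS: "h (Suc j) = (\<lambda>\<xi>. \<i> * complex_of_real \<xi> * h j \<xi>)" for j
      by (simp add: h_def mult.assoc)
    have h: "integrable lborel (h j)" "(LINT \<xi>|lborel. cmod (h j \<xi>)) \<le> ?W j * sobolev_norm s f" if "j \<le> k" for j
    proof -
      have sj: "s > j + 1 / 2" using s that by simp
      show "(LINT \<xi>|lborel. cmod (h j \<xi>)) \<le> ?W j * sobolev_norm s f"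
        using weighted_L1_bound(2)[OF sj gm g(2)] unfolding hn sobolev_norm_def g_def .
      have "integrable lborel (\<lambda>\<xi>. cmod (h j \<xi>))"
        using weighted_L1_bound(1)[OF sj gm g(2)] unfolding hn .
      moreover have "h j \<in> borel_measurable lborel" unfolding h_def by measurable
      ultimately show "integrable lborel (h j)" by (simp add: integrable_norm_iff)
    qed
    \<comment> \<open>Continuity of the chosen representative makes inversion hold at every point
      and not just almost everywhere, so classical derivatives may be taken.\<close>
    have f0: "f y = c * cis_integral (h 0) y" for y
    proof -
      have "integrable lborel g" using h(1)[of 0] by (simp add: h_def)
      then have "(LINT \<xi>|lborel. cis (y * \<xi>) * g \<xi>) = of_real (sqrt (2 * pi) * f y)"
        by (rule has_L2_fourier_inversion[OF g(1) cont])
      moreover have "cis_integral (h 0) y = Re (LINT \<xi>|lborel. cis (y * \<xi>) * g \<xi>)"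
      proof -
        have "integrable lborel (\<lambda>\<xi>. cis (y * \<xi>) * g \<xi>)"
          by (rule Bochner_Integration.integrable_bound[OF \<open>integrable lborel g\<close>]) (auto simp: norm_mult)
        then show ?thesis by (simp add: cis_integral_def h_def del: times_complex.sel)
      qed
      ultimately show ?thesis by (simp add: c_def)
    qed
    have D: "((\<lambda>x. c * cis_integral (h j) x) has_real_derivative c * cis_integral (h (Suc j)) y) (at y)"
      if "j < k" for j y
      using cis_integral_has_derivative[OF h(1)[of j] h(1)[of "Suc j", unfolded hS]] that
      unfolding hS by (intro DERIV_cmult) simp
    have eq: "(deriv ^^ j) f = (\<lambda>x. c * cis_integral (h j) x)" if "j \<le> k" for j
      using that
    proof (induction j)
      case 0
      then show ?case using f0 by auto
    next
      case (Suc j)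
      then show ?case using D[of j] by (auto intro!: DERIV_imp_deriv)
    qed
    have "\<bar>c * cis_integral (h j) x\<bar> \<le> c * (?W j * sobolev_norm s f)"
      unfolding abs_mult using c0 cis_integral_bound[OF h(1)[OF j], of x] h(2)[OF j]
      by (auto intro!: mult_left_mono)
    also have "\<dots> \<le> c * ((\<Sum>j\<le>k. ?W j) * sobolev_norm s f)"
      using c0 j W0 by (intro mult_left_mono mult_right_mono member_le_sum) (auto simp: sobolev_norm_def integral_nonneg_AE)
    finally have "\<bar>c * cis_integral (h j) x\<bar> \<le> K * sobolev_norm s f" by (simp add: K_def)
    then show ?thesis unfolding eq[OF j]
      using D[of j x] cis_integral_continuous[OF h(1)[OF j]]
      by (auto simp: real_differentiable_def)
  qed
  moreover have "0 \<le> K" unfolding K_def using c0 W0 by (intro mult_nonneg_nonneg sum_nonneg) auto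
  ultimately show ?thesis by blast
qed

lemma sobolev_cont_diff:
  "f \<in> sobolev_cont s \<Longrightarrow> g \<in> sobolev_cont s \<Longrightarrow> (\<lambda>x. f x - g x) \<in> sobolev_cont s"
  unfolding sobolev_cont_def using sobolev_diff(1) by (auto intro: continuous_on_diff)

lemma sobolev_norm_nonneg: "0 \<le> sobolev_norm s f"
  by (auto simp: sobolev_norm_def intro!: integral_nonneg_AE)

text \<open>Without this bound the supremum defining the constant $M$ would be a junk value.\<close>

lemma continuous_into_sobolev_bounded:
  assumes f: "continuous_into_sobolev s T f" and T0: "ereal T0 < T"
  shows "\<exists>B. \<forall>t\<in>{0..T0}. sobolev_norm s (f t) \<le> B"
proof -
  have sub: "{0..T0} \<subseteq> time_interval T"
    using T0 by (auto simp: time_interval_def intro: le_less_trans[of _ "ereal T0"])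
  let ?P = "\<lambda>S. \<exists>B. \<forall>t\<in>S. sobolev_norm s (f t) \<le> B"
  have loc: "\<exists>d>0. \<exists>B. \<forall>r\<in>{0..T0}. \<bar>r - t\<bar> < d \<longrightarrow> sobolev_norm s (f r) \<le> B" if t: "t \<in> {0..T0}" for t
  proof -
    let ?n = "\<lambda>r. sobolev_norm s (\<lambda>x. f r x - f t x)"
    have ft: "f t \<in> sobolev s" and lim: "(?n \<longlongrightarrow> 0) (at t within time_interval T)"
      using f t sub unfolding continuous_into_sobolev_def sobolev_cont_def by auto
    have "\<forall>\<^sub>F r in at t within time_interval T. ?n r < 1"
      using lim by (rule order_tendstoD(2)) simp
    then obtain d where d: "d > 0" "\<And>r. r \<in> time_interval T \<Longrightarrow> r \<noteq> t \<Longrightarrow> dist r t < d \<Longrightarrow> ?n r < 1"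
      unfolding eventually_at by blast
    define B where "B = 2 * (sobolev_norm s (f t))\<^sup>2 + 2"
    have "sobolev_norm s (f r) \<le> max (sobolev_norm s (f t)) (sqrt B)"
      if r: "r \<in> {0..T0}" "\<bar>r - t\<bar> < d" for r
    proof (cases "r = t")
      case False
      have "f r \<in> sobolev s"
        using f r(1) sub unfolding continuous_into_sobolev_def sobolev_cont_def by auto
      from sobolev_norm_square_le[OF this ft]
      have "(sobolev_norm s (f r))\<^sup>2 \<le> 2 * (sobolev_norm s (f t))\<^sup>2 + 2 * (?n r)\<^sup>2" .
      moreover have "(?n r)\<^sup>2 \<le> 1\<^sup>2"
        using d(2)[of r] r sub False sobolev_norm_nonneg by (intro power_mono) (auto simp: dist_real_def less_imp_le)
      ultimately have "(sobolev_norm s (f r))\<^sup>2 \<le> B" by (simp add: B_def)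
      then have "sobolev_norm s (f r) \<le> sqrt B" by (rule real_le_rsqrt)
      then show ?thesis by simp
    qed simp
    then show ?thesis using d(1) by blast
  qed
  then obtain d B where dB: "\<And>t. t \<in> {0..T0} \<Longrightarrow> d t > 0"
      "\<And>t r. t \<in> {0..T0} \<Longrightarrow> r \<in> {0..T0} \<Longrightarrow> \<bar>r - t\<bar> < d t \<Longrightarrow> sobolev_norm s (f r) \<le> B t"
    by metis
  have "compact {0..T0}" by simp
  then obtain S where S: "S \<subseteq> {0..T0}" "finite S" "{0..T0} \<subseteq> (\<Union>t\<in>S. ball t (d t))"
    by (rule compactE_image[of _ "{0..T0}" "\<lambda>t. ball t (d t)"]) (use dB(1) in force)+
  have "sobolev_norm s (f r) \<le> (\<Sum>t\<in>S. \<bar>B t\<bar>)" if r: "r \<in> {0..T0}" for r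
  proof -
    obtain t where t: "t \<in> S" "r \<in> ball t (d t)" using S(3) r by auto
    then have "sobolev_norm s (f r) \<le> \<bar>B t\<bar>"
      using dB(2)[of t r] S(1) r by (force simp: dist_real_def)
    also have "\<dots> \<le> (\<Sum>t\<in>S. \<bar>B t\<bar>)" using t(1) S(2) by (intro member_le_sum) auto
    finally show ?thesis .
  qed
  then show ?thesis by blast
qed

section \<open>A compactly supported mollifier\<close>

text \<open>A family containing exp(-1/(1 - x^2)) and closed under differentiation, so that
  smoothness of all orders follows by induction from a single derivative formula.\<close>

definition bump_term :: "real poly \<Rightarrow> nat \<Rightarrow> real \<Rightarrow> real" where
  "bump_term P k x =
     (if \<bar>x\<bar> < 1 then poly P x * inverse (1 - x\<^sup>2) ^ k * exp (- inverse (1 - x\<^sup>2)) else 0)"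

text \<open>With $v=1/(1-x^2)$, so that $v'=2xv^2$, the derivative of $Pv^ke^{-v}$ is $Qv^{k+2}e^{-v}$ for this $Q$.\<close>

definition bump_deriv :: "real poly \<Rightarrow> nat \<Rightarrow> real poly" where
  "bump_deriv P k = pderiv P * [:1, 0, -1:]\<^sup>2 + smult (2 * real k) ([:0, 1:] * P * [:1, 0, -1:]) - [:0, 2:] * P"

lemma power_le_fact_exp:
  fixes v :: real
  assumes "0 \<le> v"
  shows "v ^ n \<le> fact n * exp v"
proof -
  have "v ^ n /\<^sub>R fact n \<le> exp v"
    using sum_le_suminf[OF summable_exp_generic[of v], of "{n}"] assms unfolding exp_def by simp
  then show ?thesis by (simp add: field_simps)
qed

lemma has_real_derivative_zero_if_quadratic:
  fixes f :: "real \<Rightarrow> real"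
  assumes "\<And>z. \<bar>f z - f x\<bar> \<le> C * (z - x)\<^sup>2"
  shows "(f has_real_derivative 0) (at x)"
  unfolding has_field_derivative_iff
proof (rule Lim_null_comparison)
  show "\<forall>\<^sub>F z in at x. norm ((f z - f x) / (z - x)) \<le> C * \<bar>z - x\<bar>"
    unfolding eventually_at_filter
  proof (intro always_eventually allI impI)
    fix z assume "z \<noteq> x"
    then show "norm ((f z - f x) / (z - x)) \<le> C * \<bar>z - x\<bar>"
      using assms[of z] by (simp add: field_simps power2_eq_square abs_mult[symmetric])
  qed
  have "((\<lambda>z. C * \<bar>z - x\<bar>) \<longlongrightarrow> C * \<bar>x - x\<bar>) (at x)" by (intro tendsto_intros)
  then show "((\<lambda>z. C * \<bar>z - x\<bar>) \<longlongrightarrow> 0) (at x)" by simp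
qed

text \<open>With v = 1/(1 - z^2), the bound v^(k+2) <= (k+2)! exp(v) gives v^k exp(-v) <= (k+2)! (1
  - z^2)^2, and 1 - z^2 <= 2 |z - x| since |x| >= 1. Flatness of second order yields derivative 0 at
  the endpoints and outside at once, with no one-sided limits.\<close>

lemma bump_term_quadratic:
  assumes x: "1 \<le> \<bar>x\<bar>"
  obtains C where "\<And>z. \<bar>bump_term P k z - bump_term P k x\<bar> \<le> C * (z - x)\<^sup>2"
proof -
  have "bounded (poly P ` {-1..1})"
    by (intro compact_imp_bounded compact_continuous_image continuous_intros) simp
  then obtain B where "\<forall>y\<in>poly P ` {-1..1}. norm y \<le> B"
    unfolding bounded_iff by blast
  then have B: "\<bar>poly P z\<bar> \<le> B" if "\<bar>z\<bar> \<le> 1" for z using that by (auto simp: abs_le_iff)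
  define F :: real where "F = fact (k + 2)"
  have F: "0 \<le> F" unfolding F_def by simp
  have "\<bar>bump_term P k z\<bar> \<le> (B * F * 4) * (z - x)\<^sup>2" for z
  proof (cases "\<bar>z\<bar> < 1")
    case True
    let ?y = "1 - z\<^sup>2" let ?v = "inverse ?y"
    have y: "0 < ?y" using True by (simp add: abs_square_less_1)
    have v: "0 < ?v" "?v * ?y = 1" using y by auto
    have "?v ^ k * exp (- ?v) = ?v ^ (k + 2) * exp (- ?v) * ?y\<^sup>2"
    proof -
      have "?v ^ (k + 2) * exp (- ?v) * ?y\<^sup>2 = ?v ^ k * exp (- ?v) * (?v * ?y)\<^sup>2"
        by (simp only: power_add power_mult_distrib mult_ac)
      then show ?thesis by (simp only: v(2)) simp
    qed
    also have "\<dots> \<le> (F * exp ?v) * exp (- ?v) * ?y\<^sup>2"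
      unfolding F_def using v(1) by (intro mult_right_mono power_le_fact_exp) auto
    also have "\<dots> = F * ?y\<^sup>2" by (simp add: exp_minus)
    finally have le: "?v ^ k * exp (- ?v) \<le> F * ?y\<^sup>2" .
    have "\<bar>bump_term P k z\<bar> = \<bar>poly P z\<bar> * (?v ^ k * exp (- ?v))"
      using True v(1) unfolding bump_term_def by (simp add: abs_mult)
    also have "\<dots> \<le> B * (F * ?y\<^sup>2)"
    proof (rule mult_mono[OF _ le])
      show "\<bar>poly P z\<bar> \<le> B" using B[of z] True by simp
      then show "0 \<le> B" by linarith
      show "0 \<le> ?v ^ k * exp (- ?v)" using v(1) by simp
    qed
    finally have "\<bar>bump_term P k z\<bar> \<le> B * (F * ?y\<^sup>2)" .
    moreover
    have "?y\<^sup>2 \<le> 4 * (z - x)\<^sup>2"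
    proof -
      have "?y = (1 - \<bar>z\<bar>) * (1 + \<bar>z\<bar>)" by (simp add: algebra_simps power2_eq_square)
      also have "\<dots> \<le> \<bar>z - x\<bar> * 2" using True x by (intro mult_mono) auto
      finally have "?y\<^sup>2 \<le> (\<bar>z - x\<bar> * 2)\<^sup>2" using y by (intro power_mono) auto
      then show ?thesis by (simp add: power_mult_distrib)
    qed
    then have "B * (F * ?y\<^sup>2) \<le> B * (F * (4 * (z - x)\<^sup>2))"
      using B[of 0] F by (intro mult_left_mono) auto
    ultimately show ?thesis by (simp add: mult.assoc)
  next
    case False
    then show ?thesis using B[of 0] F by (auto simp: bump_term_def)
  qed
  then show ?thesis using x that[of "B * F * 4"] by (simp add: bump_term_def)
qed

lemma bump_term_has_derivative:
  "(bump_term P k has_real_derivative bump_term (bump_deriv P k) (k + 2) x) (at x)"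
proof (cases "\<bar>x\<bar> < 1")
  case True
  let ?v = "\<lambda>x::real. inverse (1 - x\<^sup>2)"
  have y: "1 - x\<^sup>2 \<noteq> 0" using True abs_square_less_1[of x] by auto
  have v: "(?v has_real_derivative 2 * x * (?v x)\<^sup>2) (at x)"
    using y by (auto intro!: derivative_eq_intros simp: power2_eq_square)
  have vk: "((\<lambda>x. ?v x ^ k) has_real_derivative 2 * x * k * ?v x ^ (k + 1)) (at x)"
    using DERIV_power[OF v, of k] by (cases k) (auto simp: power2_eq_square algebra_simps)
  have e: "((\<lambda>x. exp (- ?v x)) has_real_derivative exp (- ?v x) * (- (2 * x * (?v x)\<^sup>2))) (at x)"
    by (rule DERIV_fun_exp[OF DERIV_minus[OF v]])
  have "((\<lambda>x. poly P x * ?v x ^ k * exp (- ?v x)) has_real_derivative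
      (poly P x * (2 * x * k * ?v x ^ (k + 1)) + poly (pderiv P) x * ?v x ^ k) * exp (- ?v x)
      + exp (- ?v x) * (- (2 * x * (?v x)\<^sup>2)) * (poly P x * ?v x ^ k)) (at x)"
    by (rule derivative_eq_intros poly_DERIV vk e refl | simp add: algebra_simps)+
  moreover have "(poly P x * (2 * x * k * ?v x ^ (k + 1)) + poly (pderiv P) x * ?v x ^ k) * exp (- ?v x)
      + exp (- ?v x) * (- (2 * x * (?v x)\<^sup>2)) * (poly P x * ?v x ^ k) = bump_term (bump_deriv P k) (k + 2) x"
  proof -
    have "poly (bump_deriv P k) x * ?v x ^ (k + 2) =
       (poly (pderiv P) x * ((1 - x\<^sup>2) * ?v x)\<^sup>2 + 2 * k * x * poly P x * ((1 - x\<^sup>2) * ?v x) * ?v x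
         - 2 * x * poly P x * (?v x)\<^sup>2) * ?v x ^ k"
      by (simp add: bump_deriv_def algebra_simps power2_eq_square)
    also have "(1 - x\<^sup>2) * ?v x = 1" using y by simp
    finally have *: "poly (bump_deriv P k) x * ?v x ^ (k + 2) =
       (poly (pderiv P) x + 2 * k * x * poly P x * ?v x - 2 * x * poly P x * (?v x)\<^sup>2) * ?v x ^ k"
      by simp
    have "bump_term (bump_deriv P k) (k + 2) x = poly (bump_deriv P k) x * ?v x ^ (k + 2) * exp (- ?v x)"
      using True by (simp add: bump_term_def)
    then show ?thesis unfolding * by (simp add: algebra_simps power2_eq_square)
  qed
  ultimately have "((\<lambda>x. poly P x * ?v x ^ k * exp (- ?v x)) has_real_derivative bump_term (bump_deriv P k) (k + 2) x) (at x)"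
    by simp
  then show ?thesis
    by (rule has_field_derivative_transform_within_open[of _ _ _ "{-1<..<1}"])
       (use True in \<open>auto simp: bump_term_def\<close>)
next
  case False
  then obtain C where "\<And>z. \<bar>bump_term P k z - bump_term P k x\<bar> \<le> C * (z - x)\<^sup>2"
    using bump_term_quadratic by (metis linorder_not_less)
  then have "(bump_term P k has_real_derivative 0) (at x)"
    by (rule has_real_derivative_zero_if_quadratic)
  then show ?thesis using False by (simp add: bump_term_def)
qed

lemma test_function_bump_term: "test_function (bump_term P k)"
proof -
  have d: "deriv (bump_term P k) = bump_term (bump_deriv P k) (k + 2)" for P k
    using bump_term_has_derivative by (auto intro!: DERIV_imp_deriv)
  have "\<exists>Q m. (deriv ^^ n) (bump_term P k) = bump_term Q m" for n
    by (induction n) (use d in auto, metis d)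
  then have "(deriv ^^ n) (bump_term P k) differentiable at x" for n x
    using bump_term_has_derivative by (metis real_differentiable_def)
  then show ?thesis
    unfolding test_function_def by (auto intro!: exI[of _ 1] simp: bump_term_def)
qed

lemma test_function_affine:
  assumes "test_function \<phi>" and a: "a \<noteq> 0"
  shows "test_function (\<lambda>y. c * \<phi> (a * y + b))"
proof -
  have sm: "(deriv ^^ k) \<phi> differentiable at x" for k x
    using assms(1) unfolding test_function_def by auto
  have D: "((\<lambda>y. c * a ^ k * (deriv ^^ k) \<phi> (a * y + b)) has_real_derivative
     c * a ^ Suc k * (deriv ^^ Suc k) \<phi> (a * y + b)) (at y)" for k y
  proof -
    have "((deriv ^^ k) \<phi> has_real_derivative (deriv ^^ Suc k) \<phi> (a * y + b)) (at (a * y + b))"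
      using sm[of k "a * y + b"] by (simp add: DERIV_deriv_iff_real_differentiable)
    moreover have "((\<lambda>y. a * y + b) has_real_derivative a) (at y)"
      by (auto intro!: derivative_eq_intros)
    ultimately have "((\<lambda>y. (deriv ^^ k) \<phi> (a * y + b)) has_real_derivative (deriv ^^ Suc k) \<phi> (a * y + b) * a) (at y)"
      by (rule DERIV_chain2)
    from DERIV_cmult[OF this, of "c * a ^ k"] show ?thesis by (simp add: algebra_simps)
  qed
  have eq: "(deriv ^^ k) (\<lambda>y. c * \<phi> (a * y + b)) = (\<lambda>y. c * a ^ k * (deriv ^^ k) \<phi> (a * y + b))" for k
  proof (induction k)
    case (Suc k)
    then show ?case using D[of k] by (auto intro!: DERIV_imp_deriv)
  qed simp
  obtain R where R: "\<And>x. \<bar>x\<bar> > R \<Longrightarrow> \<phi> x = 0"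
    using assms(1) unfolding test_function_def by auto
  have "c * \<phi> (a * y + b) = 0" if "\<bar>y\<bar> > (\<bar>R\<bar> + \<bar>b\<bar>) / \<bar>a\<bar>" for y
  proof -
    have "\<bar>R\<bar> + \<bar>b\<bar> < \<bar>a * y\<bar>" using that a by (simp add: abs_mult field_simps)
    then have "\<bar>a * y + b\<bar> > R" by linarith
    then show ?thesis using R by simp
  qed
  then show ?thesis
    unfolding test_function_def eq using D by (auto simp: real_differentiable_def)
qed

text \<open>\<open>bump_term 1 0\<close> is the standard bump exp(-1/(1 - x^2)), normalised here to
  integral 1.\<close>

definition mollifier :: "real \<Rightarrow> real" where
  "mollifier x = bump_term 1 0 x / (LINT y|lborel. bump_term 1 0 y)"

text \<open>A numerical constant that enters every later transport constant; the supremum is shown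
  to be finite on the way to \<open>deriv_mollifier_le\<close>.\<close>

definition mollifier_slope :: real where
  "mollifier_slope = (SUP x. \<bar>deriv mollifier x\<bar>)"

lemma mollifier:
  shows test_function_mollifier: "test_function mollifier"
    and mollifier_nonneg: "0 \<le> mollifier x"
    and mollifier_support: "1 \<le> \<bar>x\<bar> \<Longrightarrow> mollifier x = 0"
    and mollifier_has_derivative: "(mollifier has_real_derivative deriv mollifier x) (at x)"
    and deriv_mollifier_support: "1 \<le> \<bar>x\<bar> \<Longrightarrow> deriv mollifier x = 0"
    and continuous_deriv_mollifier: "continuous_on UNIV (deriv mollifier)"
    and deriv_mollifier_le: "\<bar>deriv mollifier x\<bar> \<le> mollifier_slope"
    and integral_mollifier: "(LINT x|lborel. mollifier x) = 1"
proof -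
  let ?b = "bump_term 1 0" let ?b' = "bump_term (bump_deriv 1 0) 2"
  have D: "(?b has_real_derivative ?b' x) (at x)" for x
    using bump_term_has_derivative[of 1 0 x] by (simp add: numeral_2_eq_2)
  have cont: "continuous_on A (bump_term P k)" for A P k
    using bump_term_has_derivative by (intro continuous_at_imp_continuous_on ballI DERIV_isCont)
  have int: "integrable lborel ?b"
  proof -
    have "integrable lborel (\<lambda>x. indicator {-1..1} x *\<^sub>R ?b x)"
      by (rule borel_integrable_compact) (auto intro: cont)
    moreover have "(\<lambda>x. indicator {-1..1} x *\<^sub>R ?b x) = ?b"
      by (auto simp: bump_term_def indicator_def fun_eq_iff)
    ultimately show ?thesis by simp
  qed
  define I where "I = (LINT x|lborel. ?b x)"
  have "I \<noteq> 0"
  proof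
    assume "I = 0"
    then have ae: "AE x in lborel. ?b x = 0"
      unfolding I_def using integral_nonneg_eq_0_iff_AE[OF int] by (auto simp: bump_term_def)
    have "AE x in lborel. x \<notin> {-1<..<(1::real)}"
      using ae by eventually_elim (auto simp: bump_term_def split: if_splits)
    then have "emeasure lborel {-1<..<(1::real)} = 0"
      by (subst (asm) AE_iff_measurable[of "{-1<..<1}"]) auto
    then show False by simp
  qed
  moreover have "0 \<le> I" unfolding I_def by (rule integral_nonneg_AE) (auto simp: bump_term_def)
  ultimately have I: "0 < I" by simp
  have "bounded (?b' ` {-1..1})"
    by (intro compact_imp_bounded compact_continuous_image cont) simp
  then obtain B where "\<forall>y\<in>?b' ` {-1..1}. norm y \<le> B"
    unfolding bounded_iff by blast
  then have B: "\<bar>?b' z\<bar> \<le> B" if "\<bar>z\<bar> \<le> 1" for z using that by (auto simp: abs_le_iff)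
  have B': "\<bar>?b' z\<bar> \<le> B" for z
  proof (cases "\<bar>z\<bar> < 1")
    case False
    then have "?b' z = 0" by (simp add: bump_term_def)
    then show ?thesis using B[of 0] by linarith
  qed (use B in simp)
  have eq: "mollifier = (\<lambda>x. (1 / I) * ?b (1 * x + 0))"
    unfolding mollifier_def I_def by auto
  have d: "(mollifier has_real_derivative (1 / I) * ?b' x) (at x)" for x
    unfolding eq using DERIV_cmult[OF D[of x], of "1 / I"] by simp
  then have d': "deriv mollifier = (\<lambda>x. (1 / I) * ?b' x)" by (auto intro!: DERIV_imp_deriv)
  have le: "\<bar>deriv mollifier x\<bar> \<le> B / I" for x
    unfolding d' using B'[of x] I by (simp add: abs_mult divide_right_mono)
  show "test_function mollifier" unfolding eq by (rule test_function_affine[OF test_function_bump_term]) simp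
  show "(LINT x|lborel. mollifier x) = 1" unfolding eq using I by (simp add: I_def)
  show "continuous_on UNIV (deriv mollifier)" unfolding d' by (intro continuous_intros cont)
  show "\<bar>deriv mollifier x\<bar> \<le> mollifier_slope"
    unfolding mollifier_slope_def by (rule cSUP_upper) (auto intro!: bdd_aboveI2 le)
  show "(mollifier has_real_derivative deriv mollifier x) (at x)" using d[of x] by (simp add: d')
  show "0 \<le> mollifier x" unfolding eq using I by (simp add: bump_term_def)
  show "mollifier x = 0" "deriv mollifier x = 0" if "1 \<le> \<bar>x\<bar>"
    unfolding d' unfolding eq using that by (auto simp: bump_term_def)
qed

section \<open>Approximate characteristics\<close>

text \<open>Replaces integration of |D'| by an explicit antiderivative \<open>G\<close> of a
  majorant, so neither continuity nor integrability of \<open>D'\<close> is required.\<close>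

lemma abs_diff_le_of_derivative_bound:
  fixes D G D' G' :: "real \<Rightarrow> real"
  assumes "a \<le> b"
    and "\<And>t. t \<in> {a..b} \<Longrightarrow> (D has_real_derivative D' t) (at t within {a..b})"
    and "\<And>t. t \<in> {a..b} \<Longrightarrow> (G has_real_derivative G' t) (at t within {a..b})"
    and "\<And>t. t \<in> {a..b} \<Longrightarrow> \<bar>D' t\<bar> \<le> G' t"
  shows "\<bar>D b - D a\<bar> \<le> G b - G a"
proof (cases "a = b")
  case False
  have at: "at t within {a..b} = at t" if "t \<in> {a<..<b}" for t
    using that by (intro at_within_interior) (simp add: interior_atLeastAtMost_real)
  have "norm (D b - D a) \<le> G b - G a"
  proof (rule differentiable_bound_general[of a b D G D' G'])
    show "continuous_on {a..b} D" by (rule DERIV_continuous_on) (rule assms(2))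
    show "continuous_on {a..b} G" by (rule DERIV_continuous_on) (rule assms(3))
    show "(D has_vector_derivative D' x) (at x)" "(G has_vector_derivative G' x) (at x)"
      if "a < x" "x < b" for x
      using assms(2,3)[of x] at[of x] that
      by (auto simp: has_real_derivative_iff_has_vector_derivative[symmetric])
  qed (use assms False in auto)
  then show ?thesis by simp
qed simp

text \<open>A Picard iterate is already close enough to a characteristic, so no flow has to be constructed.\<close>

lemma approximate_characteristic:
  fixes a :: "real \<Rightarrow> real \<Rightarrow> real"
  assumes T: "0 \<le> T" and cont: "continuous_on ({0..T} \<times> UNIV) (\<lambda>(t, x). a t x)"
    and bd: "\<And>t x. t \<in> {0..T} \<Longrightarrow> \<bar>a t x\<bar> \<le> A"
    and lip: "\<And>t x y. t \<in> {0..T} \<Longrightarrow> \<bar>a t x - a t y\<bar> \<le> L * \<bar>x - y\<bar>"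
    and e: "0 < e"
  obtains X X' where "X T = x1"
    "\<And>t. t \<in> {0..T} \<Longrightarrow> (X has_real_derivative X' t) (at t within {0..T})"
    "\<And>t. t \<in> {0..T} \<Longrightarrow> \<bar>X' t - a t (X t)\<bar> \<le> e"
    "\<And>t. t \<in> {0..T} \<Longrightarrow> \<bar>X' t\<bar> \<le> A"
proof -
  \<comment> \<open>A strictly positive Lipschitz constant, so that it can serve as a rate and be
    cancelled.\<close>
  define l where "l = \<bar>L\<bar> + 1"
  have l: "0 < l" unfolding l_def by simp
  have lip': "\<bar>a t x - a t y\<bar> \<le> l * \<bar>x - y\<bar>" if "t \<in> {0..T}" for t x y
  proof -
    have "L * \<bar>x - y\<bar> \<le> l * \<bar>x - y\<bar>" unfolding l_def by (intro mult_right_mono) auto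
    then show ?thesis using lip[OF that, of x y] by linarith
  qed
  have A: "0 \<le> A" using bd[of 0 0] T by simp
  \<comment> \<open>Subtracting the integral over \<open>{0..T}\<close> prescribes the value at the
    final time: the curve is followed backwards from the point where the solution is to be
    estimated.\<close>
  define X :: "nat \<Rightarrow> real \<Rightarrow> real" where "X = rec_nat (\<lambda>t. x1)
     (\<lambda>n Y t. x1 + integral {0..t} (\<lambda>s. a s (Y s)) - integral {0..T} (\<lambda>s. a s (Y s)))"
  have X0: "X 0 = (\<lambda>t. x1)" and XS: "X (Suc n) = (\<lambda>t. x1 + integral {0..t} (\<lambda>s. a s (X n s)) - integral {0..T} (\<lambda>s. a s (X n s)))" for n
    unfolding X_def by auto
  have XT: "X n T = x1" for n by (cases n) (auto simp: X0 XS)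
  have ac: "continuous_on {0..T} (\<lambda>s. a s (Y s))" if "continuous_on {0..T} Y" for Y
  proof -
    have "continuous_on {0..T} (\<lambda>s. (\<lambda>(t, x). a t x) (s, Y s))"
      by (rule continuous_on_compose2[OF cont]) (use that in \<open>auto intro!: continuous_intros\<close>)
    then show ?thesis by simp
  qed
  have step: "(X (Suc n) has_real_derivative a t (X n t)) (at t within {0..T})"
    if "continuous_on {0..T} (X n)" "t \<in> {0..T}" for n t
    unfolding XS using integral_has_real_derivative[OF ac[OF that(1)] that(2)]
    by (auto intro!: derivative_eq_intros)
  have Xc: "continuous_on {0..T} (X n)" for n
  proof (induction n)
    case (Suc n)
    then show ?case using step by (intro DERIV_continuous_on) auto
  qed (simp add: X0)
  note D = step[OF Xc]
  define c where "c = (\<lambda>n::nat. A * T * (1 / 2) ^ n)"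
  \<comment> \<open>Picard's contraction in an exponentially weighted norm: integrating the majorant
    \<open>l * (c n * exp (2 * l * (T - s)))\<close> divides by \<open>2 * l\<close>, so each
    iteration gains a factor 1/2 on the whole interval, however long.\<close>
  have close: "\<bar>X (Suc n) t - X n t\<bar> \<le> c n * exp (2 * l * (T - t))" if "t \<in> {0..T}" for n t
    using that
  proof (induction n arbitrary: t)
    case 0
    have "\<bar>X 1 T - X 1 t\<bar> \<le> A * T - A * t"
    proof (rule abs_diff_le_of_derivative_bound[where D' = "\<lambda>s. a s (X 0 s)" and G' = "\<lambda>s. A"])
      show "(X 1 has_real_derivative a s (X 0 s)) (at s within {t..T})" if "s \<in> {t..T}" for s
        using D[of s 0] that 0 by (auto intro: has_field_derivative_subset)
    qed (use 0 bd in \<open>auto intro!: derivative_eq_intros\<close>)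
    also have "\<dots> \<le> A * T * 1" using A 0 by simp
    also have "\<dots> \<le> A * T * exp (2 * l * (T - t))"
      using A T 0 l by (intro mult_left_mono) auto
    finally show ?case using XT[of 1] by (simp add: X0 c_def abs_minus_commute)
  next
    case (Suc n)
    let ?D = "\<lambda>t. X (Suc (Suc n)) t - X (Suc n) t"
    let ?G = "\<lambda>t. - (c n / 2) * exp (2 * l * (T - t))"
    have "\<bar>?D T - ?D t\<bar> \<le> ?G T - ?G t"
    proof (rule abs_diff_le_of_derivative_bound[where D' = "\<lambda>s. a s (X (Suc n) s) - a s (X n s)"
          and G' = "\<lambda>s. l * (c n * exp (2 * l * (T - s)))"])
      fix s assume s: "s \<in> {t..T}"
      then have s': "s \<in> {0..T}" using Suc.prems by auto
      show "(?D has_real_derivative a s (X (Suc n) s) - a s (X n s)) (at s within {t..T})"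
        by (intro DERIV_diff has_field_derivative_subset[OF D[OF s']]) (use Suc.prems in auto)
      show "(?G has_real_derivative l * (c n * exp (2 * l * (T - s)))) (at s within {t..T})"
        by (auto intro!: derivative_eq_intros)
      show "\<bar>a s (X (Suc n) s) - a s (X n s)\<bar> \<le> l * (c n * exp (2 * l * (T - s)))"
        using lip'[OF s'] Suc.IH[OF s'] l by (meson mult_le_cancel_left_pos order_trans)
    qed (use Suc.prems in auto)
    also have "\<dots> \<le> c n / 2 * exp (2 * l * (T - t))" using A T by (simp add: c_def)
    also have "c n / 2 = c (Suc n)" by (simp add: c_def)
    finally show ?case using XT by simp
  qed
  have "(\<lambda>n. l * (A * T * (1 / 2) ^ n * exp (2 * l * T))) \<longlonglongrightarrow> l * (A * T * 0 * exp (2 * l * T))"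
    by (intro tendsto_intros LIMSEQ_power_zero) simp
  then have "\<forall>\<^sub>F n in sequentially. l * (A * T * (1 / 2) ^ n * exp (2 * l * T)) < e"
    using e by (intro order_tendstoD(2)) auto
  then obtain n where n: "l * (c n * exp (2 * l * T)) < e"
    unfolding eventually_sequentially c_def by auto
  show ?thesis
  \<comment> \<open>The velocity of iterate n + 1 is \<open>a\<close> along iterate n, so the defect
    is at most \<open>l\<close> times the distance of the two iterates, which \<open>n\<close> was
    chosen to make small.\<close>
  proof (rule that[of "X (Suc n)" "\<lambda>t. a t (X n t)"])
    fix t assume t: "t \<in> {0..T}"
    show "(X (Suc n) has_real_derivative a t (X n t)) (at t within {0..T})" by (rule D[OF t])
    show "\<bar>a t (X n t)\<bar> \<le> A" by (rule bd[OF t])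
    have "\<bar>a t (X n t) - a t (X (Suc n) t)\<bar> \<le> l * \<bar>X (Suc n) t - X n t\<bar>"
      using lip'[OF t] by (metis abs_minus_commute)
    also have "\<dots> \<le> l * (c n * exp (2 * l * (T - t)))"
      using l close[OF t] by (intro mult_left_mono) auto
    also have "\<dots> \<le> l * (c n * exp (2 * l * T))"
      using l t A T by (intro mult_left_mono) (auto simp: c_def)
    finally show "\<bar>a t (X n t) - a t (X (Suc n) t)\<bar> \<le> e" using n by simp
  qed (rule XT)
qed

section \<open>The mollifier at scale e\<close>

definition mol :: "real \<Rightarrow> real \<Rightarrow> real" where
  "mol e z = mollifier (z / e) / e"

definition mol' :: "real \<Rightarrow> real \<Rightarrow> real" where
  "mol' e z = deriv mollifier (z / e) / e\<^sup>2"

lemma mollifier_slope_nonneg: "0 \<le> mollifier_slope"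
  using deriv_mollifier_le[of 0] by linarith

context
  fixes e :: real
  assumes e: "0 < e"
begin

lemma mol_nonneg: "0 \<le> mol e z"
  unfolding mol_def using e mollifier_nonneg by simp

lemma mol_support: "e \<le> \<bar>z\<bar> \<Longrightarrow> mol e z = 0" "e \<le> \<bar>z\<bar> \<Longrightarrow> mol' e z = 0"
  unfolding mol_def mol'_def using e mollifier_support[of "z / e"] deriv_mollifier_support[of "z / e"]
  by (auto simp: field_simps)

lemma mol_has_derivative: "(mol e has_real_derivative mol' e z) (at z)"
proof -
  have "((\<lambda>z. z / e) has_real_derivative 1 / e) (at z)"
    using e by (auto intro!: derivative_eq_intros)
  from DERIV_cdivide[OF DERIV_chain2[OF mollifier_has_derivative this], of e] show ?thesis
    unfolding mol_def[abs_def] mol'_def by (simp add: power2_eq_square)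
qed

lemma mol'_le: "\<bar>mol' e z\<bar> \<le> mollifier_slope / e\<^sup>2"
  unfolding mol'_def using deriv_mollifier_le[of "z / e"] by (simp add: divide_right_mono)

lemma continuous_mol: "continuous_on A (mol e)"
  using mol_has_derivative by (intro continuous_at_imp_continuous_on ballI DERIV_isCont)

lemma continuous_mol': "continuous_on A (mol' e)"
proof -
  have "continuous_on A (\<lambda>z. deriv mollifier (z / e))"
    by (rule continuous_on_compose2[OF continuous_deriv_mollifier]) (use e in \<open>auto intro!: continuous_intros\<close>)
  then show ?thesis unfolding mol'_def using e by (intro continuous_intros) auto
qed

lemma mol_lipschitz: "\<bar>mol e z - mol e w\<bar> \<le> mollifier_slope / e\<^sup>2 * \<bar>z - w\<bar>"
proof -
  have "norm (mol e z - mol e w) \<le> mollifier_slope / e\<^sup>2 * norm (z - w)"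
    by (rule field_differentiable_bound[of UNIV _ "mol' e"]) (use mol_has_derivative mol'_le in auto)
  then show ?thesis by simp
qed

lemma test_function_mol: "test_function (\<lambda>y. mol e (x - y))"
proof -
  have "(\<lambda>y. mol e (x - y)) = (\<lambda>y. (1 / e) * mollifier ((- 1 / e) * y + x / e))"
    unfolding mol_def by (auto simp: diff_divide_distrib)
  then show ?thesis
    using test_function_affine[OF test_function_mollifier, of "- 1 / e" "1 / e" "x / e"] e by simp
qed

lemma deriv_mol: "deriv (\<lambda>y. mol e (x - y)) y = - mol' e (x - y)"
proof -
  have "((\<lambda>y. x - y) has_real_derivative - 1) (at y)"
    by (auto intro!: derivative_eq_intros)
  from DERIV_chain2[OF mol_has_derivative this] show ?thesis
    by (auto intro!: DERIV_imp_deriv)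
qed

lemma integral_mol: "(LINT y|lborel. mol e (x - y)) = 1"
  using lborel_integral_real_affine[of "- 1 / e" mollifier "x / e"] integral_mollifier e
  by (simp add: mol_def diff_divide_distrib)

end

lemma compact_support_integral:
  fixes h :: "real \<Rightarrow> real"
  assumes e: "0 < e" and cont: "continuous_on UNIV h" and supp: "\<And>y. e \<le> \<bar>x - y\<bar> \<Longrightarrow> h y = 0"
  shows "integrable lborel h"
    and "(\<And>y. \<bar>x - y\<bar> < e \<Longrightarrow> \<bar>h y\<bar> \<le> B) \<Longrightarrow> \<bar>LINT y|lborel. h y\<bar> \<le> 2 * e * B"
proof -
  have "integrable lborel (\<lambda>y. indicator {x - e..x + e} y *\<^sub>R h y)"
    by (rule borel_integrable_compact) (auto intro: continuous_on_subset[OF cont])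
  also have "(\<lambda>y. indicator {x - e..x + e} y *\<^sub>R h y) = h"
    using supp by (force simp: indicator_def fun_eq_iff abs_le_iff)
  finally show int: "integrable lborel h" .
  assume B: "\<And>y. \<bar>x - y\<bar> < e \<Longrightarrow> \<bar>h y\<bar> \<le> B"
  have B0: "0 \<le> B" using B[of x] e by simp
  have le: "\<bar>h y\<bar> \<le> indicator {x - e..x + e} y * B" for y
  proof (cases "\<bar>x - y\<bar> < e")
    case True
    then have "y \<in> {x - e..x + e}" by auto
    then show ?thesis using B[OF True] by simp
  next
    case False
    then show ?thesis using supp[of y] B0 by simp
  qed
  have i: "integrable lborel (\<lambda>y. indicator {x - e..x + e} y * B)"
    by (intro integrable_mult_left) (simp add: integrable_indicator_iff emeasure_lborel_Icc_eq)
  have "\<bar>LINT y|lborel. h y\<bar> \<le> (LINT y|lborel. \<bar>h y\<bar>)" by (rule integral_abs_bound)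
  also have "\<dots> \<le> (LINT y|lborel. indicator {x - e..x + e} y * B)"
    by (rule integral_mono[OF integrable_abs[OF int] i le])
  also have "\<dots> = 2 * e * B" using e by simp
  finally show "\<bar>LINT y|lborel. h y\<bar> \<le> 2 * e * B" .
qed

section \<open>Weak transport equations\<close>

text \<open>Time enters through \<open>f\<close> and through the centre \<open>X\<close>. The
  difference quotient is split into moving the centre with \<open>f\<close> taken at the new time,
  handled by dominated convergence, and changing the time with the centre frozen at
  \<open>X t\<close>, where the weak equation applies. Pointwise continuity of \<open>f\<close> in
  time is enough.\<close>

lemma pairing_along_curve_has_derivative:
  fixes f :: "real \<Rightarrow> real \<Rightarrow> real"
  assumes e: "0 < e" and t: "t \<in> S"
    and f_cont: "\<And>r. r \<in> S \<Longrightarrow> continuous_on UNIV (f r)"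
    and f_bd: "\<And>r x. r \<in> S \<Longrightarrow> \<bar>f r x\<bar> \<le> F"
    and f_time: "\<And>x. ((\<lambda>r. f r x) \<longlongrightarrow> f t x) (at t within S)"
    and X: "(X has_real_derivative X') (at t within S)"
    and X_lip: "\<And>r. r \<in> S \<Longrightarrow> \<bar>X r - X t\<bar> \<le> A * \<bar>r - t\<bar>"
    and weak: "((\<lambda>r. LINT y|lborel. f r y * mol e (X t - y)) has_real_derivative W) (at t within S)"
  shows "((\<lambda>r. LINT y|lborel. f r y * mol e (X r - y)) has_real_derivative
    (LINT y|lborel. f t y * (mol' e (X t - y) * X')) + W) (at t within S)"
  unfolding has_field_derivative_iff
proof -
  let ?I = "\<lambda>r x. LINT y|lborel. f r y * mol e (x - y)"
  have int: "integrable lborel (\<lambda>y. f r y * mol e (x - y))" if "r \<in> S" for r x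
    by (rule compact_support_integral(1)[OF e, where x = x])
       (use e f_cont[OF that] mol_support(1)[OF e] in
         \<open>auto intro!: continuous_intros continuous_on_compose2[OF continuous_mol[OF e, of UNIV]]\<close>)
  have split: "(?I r (X r) - ?I t (X t)) / (r - t) =
     (?I r (X r) - ?I r (X t)) / (r - t) + (?I r (X t) - ?I t (X t)) / (r - t)" for r
    by (simp add: add_divide_distrib[symmetric])
  have A: "\<bar>X r - X t\<bar> \<le> \<bar>A\<bar> * \<bar>r - t\<bar>" if "r \<in> S" for r
    using X_lip[OF that] by (rule order_trans) (intro mult_right_mono, auto)
  have "((\<lambda>r. (?I r (X r) - ?I r (X t)) / (r - t)) \<longlongrightarrow> (LINT y|lborel. f t y * (mol' e (X t - y) * X'))) (at t within S)"
    unfolding tendsto_at_iff_sequentially comp_def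
  proof (intro allI impI)
    fix Y :: "nat \<Rightarrow> real" assume Y: "\<forall>i. Y i \<in> S - {t}" "Y \<longlonglongrightarrow> t"
    then have "bounded (range Y)" by (intro convergent_imp_bounded) (auto simp: convergent_def)
    then obtain R0 where "\<forall>y\<in>range Y. norm y \<le> R0" unfolding bounded_iff by blast
    then have R0: "\<bar>Y n\<bar> \<le> R0" for n by auto
    \<comment> \<open>A window around \<open>X t\<close> that contains the supports of all
      mollifiers centred at \<open>X (Y n)\<close>, so that one compactly supported majorant works
      for every \<open>n\<close>.\<close>
    define R where "R = \<bar>A\<bar> * (R0 + \<bar>t\<bar>) + e"
    define M where "M = F * (mollifier_slope / e\<^sup>2 * \<bar>A\<bar>)"
    have YS: "Y n \<in> S" "Y n - t \<noteq> 0" for n using Y(1) by auto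
    have F0: "0 \<le> F" using f_bd[OF t, of 0] by linarith
    have XR: "\<bar>X (Y n) - X t\<bar> + e \<le> R" for n
    proof -
      have "\<bar>A\<bar> * \<bar>Y n - t\<bar> \<le> \<bar>A\<bar> * (R0 + \<bar>t\<bar>)"
        using R0[of n] by (intro mult_left_mono) auto
      then show ?thesis using A[OF YS(1)[of n]] by (simp add: R_def)
    qed
    let ?q = "\<lambda>n y. f (Y n) y * ((mol e (X (Y n) - y) - mol e (X t - y)) / (Y n - t))"
    have "(?I (Y n) (X (Y n)) - ?I (Y n) (X t)) / (Y n - t) = (LINT y|lborel. ?q n y)" for n
    proof -
      have "?I (Y n) (X (Y n)) - ?I (Y n) (X t) = (LINT y|lborel. f (Y n) y * mol e (X (Y n) - y) - f (Y n) y * mol e (X t - y))"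
        using int[OF YS(1)] by simp
      then show ?thesis by (simp add: right_diff_distrib flip: integral_divide_zero)
    qed
    moreover have "(\<lambda>n. LINT y|lborel. ?q n y) \<longlonglongrightarrow> (LINT y|lborel. f t y * (mol' e (X t - y) * X'))"
    proof (rule integral_dominated_convergence[where w = "\<lambda>y. indicator {X t - R..X t + R} y * M"])
      show "(\<lambda>y. f t y * (mol' e (X t - y) * X')) \<in> borel_measurable lborel"
        using f_cont[OF t]
        by (auto intro!: borel_measurable_continuous_onI continuous_intros continuous_on_compose2[OF continuous_mol'[OF e, of UNIV]])
      show "(\<lambda>y. ?q n y) \<in> borel_measurable lborel" for n
        using f_cont[OF YS(1)] YS(2)
        by (auto intro!: borel_measurable_continuous_onI continuous_intros continuous_on_compose2[OF continuous_mol[OF e, of UNIV]])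
      show "integrable lborel (\<lambda>y. indicator {X t - R..X t + R} y * M)"
        by (intro integrable_mult_left) (simp add: integrable_indicator_iff emeasure_lborel_Icc_eq)
      show "AE y in lborel. (\<lambda>n. ?q n y) \<longlonglongrightarrow> f t y * (mol' e (X t - y) * X')"
      proof (rule AE_I2)
        fix y
        have "((\<lambda>r. X r - y) has_real_derivative X' - 0) (at t within S)"
          by (intro DERIV_diff X DERIV_const)
        then have "((\<lambda>r. mol e (X r - y)) has_real_derivative mol' e (X t - y) * X') (at t within S)"
          using DERIV_chain2[OF mol_has_derivative[OF e]] by fastforce
        then have "((\<lambda>r. (mol e (X r - y) - mol e (X t - y)) / (r - t)) \<longlongrightarrow> mol' e (X t - y) * X') (at t within S)"
          unfolding has_field_derivative_iff .
        then have "((\<lambda>r. f r y * ((mol e (X r - y) - mol e (X t - y)) / (r - t))) \<longlongrightarrow> f t y * (mol' e (X t - y) * X')) (at t within S)"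
          by (intro tendsto_mult f_time)
        then show "(\<lambda>n. ?q n y) \<longlonglongrightarrow> f t y * (mol' e (X t - y) * X')"
          unfolding tendsto_at_iff_sequentially comp_def using Y by blast
      qed
      show "AE y in lborel. norm (?q n y) \<le> indicator {X t - R..X t + R} y * M" for n
      proof (rule AE_I2)
        fix y
        show "norm (?q n y) \<le> indicator {X t - R..X t + R} y * M"
        proof (cases "\<bar>X t - y\<bar> \<le> R")
          case True
          have "\<bar>mol e (X (Y n) - y) - mol e (X t - y)\<bar> \<le> mollifier_slope / e\<^sup>2 * \<bar>X (Y n) - X t\<bar>"
            using mol_lipschitz[OF e, of "X (Y n) - y" "X t - y"] by simp
          also have "\<dots> \<le> mollifier_slope / e\<^sup>2 * (\<bar>A\<bar> * \<bar>Y n - t\<bar>)"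
            using mollifier_slope_nonneg by (intro mult_left_mono A YS) auto
          finally have "\<bar>(mol e (X (Y n) - y) - mol e (X t - y)) / (Y n - t)\<bar> \<le> mollifier_slope / e\<^sup>2 * \<bar>A\<bar>"
            using YS(2)[of n] by (simp add: field_simps)
          then have "\<bar>?q n y\<bar> \<le> M"
            unfolding M_def abs_mult using f_bd[OF YS(1)] F0 by (intro mult_mono) auto
          moreover have "y \<in> {X t - R..X t + R}" using True by (auto simp: abs_le_iff)
          ultimately show ?thesis by simp
        next
          case False
          then have "e \<le> \<bar>X (Y n) - y\<bar>" "e \<le> \<bar>X t - y\<bar>" using XR[of n] by linarith+
          moreover have "0 \<le> M" unfolding M_def using F0 mollifier_slope_nonneg by auto
          ultimately show ?thesis using mol_support(1)[OF e] by simp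
        qed
      qed
    qed
    ultimately show "(\<lambda>n. (?I (Y n) (X (Y n)) - ?I (Y n) (X t)) / (Y n - t)) \<longlonglongrightarrow> (LINT y|lborel. f t y * (mol' e (X t - y) * X'))"
      by (simp only:)
  qed
  moreover have "((\<lambda>r. (?I r (X t) - ?I t (X t)) / (r - t)) \<longlongrightarrow> W) (at t within S)"
    using weak unfolding has_field_derivative_iff .
  ultimately show "((\<lambda>r. (?I r (X r) - ?I t (X t)) / (r - t)) \<longlongrightarrow> (LINT y|lborel. f t y * (mol' e (X t - y) * X')) + W) (at t within S)"
    unfolding split by (rule tendsto_add)
qed

text \<open>The cap \<open>e \<le> 1\<close> keeps the mollified tube within distance 1 of the
  curve; it is the source of the \<open>+ 1\<close> in the exponent \<open>A * T + 1\<close> of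
  \<open>transport_bound\<close>.\<close>

lemma mollification_tendsto:
  assumes cont: "continuous_on UNIV (f :: real \<Rightarrow> real)" and d: "0 < d"
  obtains e where "0 < e" "e \<le> 1" "\<bar>(LINT y|lborel. f y * mol e (x - y)) - f x\<bar> \<le> d"
proof -
  obtain e0 where e0: "0 < e0" "\<And>y. \<bar>x - y\<bar> < e0 \<Longrightarrow> \<bar>f y - f x\<bar> \<le> d"
    using cont d unfolding continuous_on_eq_continuous_at[OF open_UNIV] continuous_at_eps_delta
    by (metis UNIV_I abs_minus_commute dist_real_def less_imp_le)
  define e where "e = min e0 1"
  have e: "0 < e" "e \<le> 1" "e \<le> e0" unfolding e_def using e0 by auto
  have int: "integrable lborel (\<lambda>y. g y * mol e (x - y))" if "continuous_on UNIV g" for g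
    by (rule compact_support_integral(1)[OF e(1), where x = x])
       (use e that mol_support(1)[OF e(1)] in
         \<open>auto intro!: continuous_intros continuous_on_compose2[OF continuous_mol[OF e(1), of UNIV]]\<close>)
  have m: "integrable lborel (\<lambda>y. mol e (x - y))" using int[of "\<lambda>_. 1"] by simp
  have "(LINT y|lborel. f y * mol e (x - y)) - f x = (LINT y|lborel. f y * mol e (x - y)) - (LINT y|lborel. f x * mol e (x - y))"
    using integral_mol[OF e(1)] by simp
  also have "\<dots> = (LINT y|lborel. (f y - f x) * mol e (x - y))"
    using int[OF cont] m by (simp add: left_diff_distrib)
  also have "\<bar>\<dots>\<bar> \<le> (LINT y|lborel. \<bar>(f y - f x) * mol e (x - y)\<bar>)" by (rule integral_abs_bound)
  also have "\<dots> \<le> (LINT y|lborel. d * mol e (x - y))"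
  proof (rule integral_mono)
    show "integrable lborel (\<lambda>y. \<bar>(f y - f x) * mol e (x - y)\<bar>)"
      by (intro integrable_abs int continuous_intros cont)
    show "integrable lborel (\<lambda>y. d * mol e (x - y))" using m by simp
    show "\<bar>(f y - f x) * mol e (x - y)\<bar> \<le> d * mol e (x - y)" for y
    proof (cases "\<bar>x - y\<bar> < e")
      case True
      then show ?thesis using e0(2)[of y] e mol_nonneg[OF e(1)] by (auto simp: abs_mult intro!: mult_right_mono)
    qed (use mol_support(1)[OF e(1)] in simp)
  qed
  also have "\<dots> = d" using integral_mol[OF e(1)] by simp
  finally show ?thesis using that e by blast
qed

text \<open>Weak form of the balance law f_t + (a f)_x = g. In divergence form no derivative of
  \<open>f\<close> or \<open>a\<close> appears. The bound \<open>F\<close> serves only to make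
  suprema finite; the estimates below depend on \<open>A\<close> and \<open>L\<close> but not on
  \<open>F\<close>.\<close>

locale transport =
  fixes f g a :: "real \<Rightarrow> real \<Rightarrow> real" and T F A L :: real
  assumes T: "0 \<le> T"
    and f_cont: "\<And>t. t \<in> {0..T} \<Longrightarrow> continuous_on UNIV (f t)"
    and g_cont: "\<And>t. t \<in> {0..T} \<Longrightarrow> continuous_on UNIV (g t)"
    and f_bd: "\<And>t x. t \<in> {0..T} \<Longrightarrow> \<bar>f t x\<bar> \<le> F"
    and f_time: "\<And>t x. t \<in> {0..T} \<Longrightarrow> ((\<lambda>r. f r x) \<longlongrightarrow> f t x) (at t within {0..T})"
    and a_cont: "continuous_on ({0..T} \<times> UNIV) (\<lambda>(t, x). a t x)"
    and a_bd: "\<And>t x. t \<in> {0..T} \<Longrightarrow> \<bar>a t x\<bar> \<le> A"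
    and a_lip: "\<And>t x y. t \<in> {0..T} \<Longrightarrow> \<bar>a t x - a t y\<bar> \<le> L * \<bar>x - y\<bar>"
    and weak: "\<And>\<phi> t. test_function \<phi> \<Longrightarrow> t \<in> {0..T} \<Longrightarrow>
      ((\<lambda>r. LINT x|lborel. f r x * \<phi> x) has_real_derivative
        (LINT x|lborel. f t x * a t x * deriv \<phi> x + g t x * \<phi> x)) (at t within {0..T})"
begin

lemma a_cont_space: "continuous_on UNIV (a t)" if "t \<in> {0..T}"
proof -
  have "continuous_on UNIV (\<lambda>x. (\<lambda>(t, x). a t x) (t, x))"
    by (rule continuous_on_compose2[OF a_cont]) (use that in \<open>auto intro!: continuous_intros\<close>)
  then show ?thesis by simp
qed

lemma A_nonneg: "0 \<le> A" and L_nonneg: "0 \<le> L"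
  using a_bd[of 0 0] a_lip[of 0 0 1] T by auto

text \<open>The transport terms cancel up to $X'-a$, which is $O(e)$ on the support of the mollifier. Its
  derivative is $O(e^{-2})$ on an interval of length $2e$, so the error stays bounded as $e\to 0$, which suffices.\<close>

lemma mollified_transport:
  assumes t1: "t1 \<in> {0..T}" and e: "0 < e"
    and X: "\<And>t. t \<in> {0..t1} \<Longrightarrow> (X has_real_derivative X' t) (at t within {0..t1})"
    and X1: "\<And>t. t \<in> {0..t1} \<Longrightarrow> \<bar>X' t - a t (X t)\<bar> \<le> e" "\<And>t. t \<in> {0..t1} \<Longrightarrow> \<bar>X' t\<bar> \<le> A"
    and P: "\<And>t y. t \<in> {0..t1} \<Longrightarrow> \<bar>X t - y\<bar> < e \<Longrightarrow> \<bar>f t y\<bar> \<le> P t"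
    and Q: "\<And>t y. t \<in> {0..t1} \<Longrightarrow> \<bar>X t - y\<bar> < e \<Longrightarrow> \<bar>g t y\<bar> \<le> Q t"
    and G: "\<And>t. t \<in> {0..t1} \<Longrightarrow> (G has_real_derivative 2 * mollifier_slope * (1 + L) * P t + Q t) (at t within {0..t1})"
  shows "\<bar>(LINT y|lborel. f t1 y * mol e (X t1 - y)) - (LINT y|lborel. f 0 y * mol e (X 0 - y))\<bar> \<le> G t1 - G 0"
proof (rule abs_diff_le_of_derivative_bound)
  show "0 \<le> t1" using t1 by simp
  fix t assume t: "t \<in> {0..t1}"
  have sub: "{0..t1} \<subseteq> {0..T}" and tT: "t \<in> {0..T}" using t t1 by auto
  let ?W = "LINT x|lborel. f t x * a t x * deriv (\<lambda>y. mol e (X t - y)) x + g t x * mol e (X t - x)"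
  let ?V = "LINT y|lborel. f t y * (mol' e (X t - y) * X' t)"
  have X_lip: "\<bar>X r - X t\<bar> \<le> A * \<bar>r - t\<bar>" if "r \<in> {0..t1}" for r
  proof -
    have "norm (X r - X t) \<le> A * norm (r - t)"
      by (rule field_differentiable_bound[of "{0..t1}" X X']) (use X X1(2) t that in auto)
    then show ?thesis by simp
  qed
  show "((\<lambda>r. LINT y|lborel. f r y * mol e (X r - y)) has_real_derivative ?V + ?W) (at t within {0..t1})"
  proof (rule pairing_along_curve_has_derivative[where F = F, OF e t _ _ _ X[OF t] X_lip])
    show "((\<lambda>r. LINT y|lborel. f r y * mol e (X t - y)) has_real_derivative ?W) (at t within {0..t1})"
      by (rule has_field_derivative_subset[OF weak[OF test_function_mol[OF e] tT] sub])
    show "((\<lambda>r. f r x) \<longlongrightarrow> f t x) (at t within {0..t1})" for x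
      by (rule tendsto_within_subset[OF f_time[OF tT] sub])
  qed (use f_cont f_bd sub in auto)
  show "(G has_real_derivative 2 * mollifier_slope * (1 + L) * P t + Q t) (at t within {0..t1})"
    by (rule G[OF t])
  have ci: "continuous_on UNIV (\<lambda>y. mol e (X t - y))" "continuous_on UNIV (\<lambda>y. mol' e (X t - y))"
    by (auto intro!: continuous_intros continuous_on_compose2[OF continuous_mol[OF e, of UNIV]]
       continuous_on_compose2[OF continuous_mol'[OF e, of UNIV]])
  note supp = mol_support[OF e]
  \<comment> \<open>The motion of the centre contributes \<open>X' * mol'\<close>, and the flux
    contributes \<open>- a * mol'\<close> because differentiating \<open>mol e (X t - y)\<close> in
    \<open>y\<close> changes the sign.\<close>
  let ?h = "\<lambda>y. f t y * (X' t - a t y) * mol' e (X t - y)" and ?k = "\<lambda>y. g t y * mol e (X t - y)"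
  have h: "continuous_on UNIV ?h" and k: "continuous_on UNIV ?k"
    using ci f_cont[OF tT] g_cont[OF tT] a_cont_space[OF tT] by (auto intro!: continuous_intros)
  have ih: "integrable lborel ?h" and ik: "integrable lborel ?k"
    by (rule compact_support_integral(1)[OF e h, of "X t"], use supp in simp)
       (rule compact_support_integral(1)[OF e k, of "X t"], use supp in simp)
  have i1: "integrable lborel (\<lambda>y. f t y * (mol' e (X t - y) * X' t))"
    by (rule compact_support_integral(1)[OF e, of _ "X t"])
       (use supp ci f_cont[OF tT] in \<open>auto intro!: continuous_intros\<close>)
  have i2: "integrable lborel (\<lambda>y. f t y * a t y * deriv (\<lambda>y. mol e (X t - y)) y + g t y * mol e (X t - y))"
    unfolding deriv_mol[OF e]
    by (rule compact_support_integral(1)[OF e, of _ "X t"])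
       (use supp ci f_cont[OF tT] g_cont[OF tT] a_cont_space[OF tT] in \<open>auto intro!: continuous_intros\<close>)
  have "?V + ?W = (LINT y|lborel. ?h y + ?k y)"
    using i1 i2 by (simp only: Bochner_Integration.integral_add[symmetric]) (simp add: deriv_mol[OF e] algebra_simps)
  also have "\<dots> = (LINT y|lborel. ?h y) + (LINT y|lborel. ?k y)"
    using ih ik by simp
  finally have VW: "?V + ?W = (LINT y|lborel. ?h y) + (LINT y|lborel. ?k y)" .
  have P0: "0 \<le> P t" using P[OF t, of "X t"] e by simp
  have "\<bar>LINT y|lborel. ?h y\<bar> \<le> 2 * e * (P t * ((1 + L) * e) * (mollifier_slope / e\<^sup>2))"
  proof (rule compact_support_integral(2)[OF e h, of "X t"])
    fix y assume y: "\<bar>X t - y\<bar> < e"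
    have "L * \<bar>X t - y\<bar> \<le> L * e" using y L_nonneg by (intro mult_left_mono) auto
    then have "\<bar>X' t - a t y\<bar> \<le> (1 + L) * e"
      using X1(1)[OF t] a_lip[OF tT, of "X t" y] by (simp add: algebra_simps)
    then show "\<bar>?h y\<bar> \<le> P t * ((1 + L) * e) * (mollifier_slope / e\<^sup>2)"
      unfolding abs_mult using P[OF t y] mol'_le[OF e] P0 e L_nonneg by (intro mult_mono) auto
  qed (use supp in simp)
  also have "\<dots> = 2 * mollifier_slope * (1 + L) * P t"
    using e by (simp add: power2_eq_square)
  finally have 1: "\<bar>LINT y|lborel. ?h y\<bar> \<le> 2 * mollifier_slope * (1 + L) * P t" .
  have im: "integrable lborel (\<lambda>y. mol e (X t - y))"
    by (rule compact_support_integral(1)[OF e ci(1), of "X t"]) (use supp in simp)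
  have "\<bar>LINT y|lborel. ?k y\<bar> \<le> (LINT y|lborel. \<bar>?k y\<bar>)" by (rule integral_abs_bound)
  also have "\<dots> \<le> (LINT y|lborel. Q t * mol e (X t - y))"
  proof (rule integral_mono[OF integrable_abs[OF ik]])
    show "integrable lborel (\<lambda>y. Q t * mol e (X t - y))" using im by simp
    show "\<bar>?k y\<bar> \<le> Q t * mol e (X t - y)" for y
      using Q[OF t, of y] mol_nonneg[OF e] supp(1)
      by (cases "\<bar>X t - y\<bar> < e") (auto simp: abs_mult intro!: mult_right_mono)
  qed
  also have "\<dots> = Q t" using integral_mol[OF e] by simp
  finally show "\<bar>?V + ?W\<bar> \<le> 2 * mollifier_slope * (1 + L) * P t + Q t"
    unfolding VW using 1 by linarith
qed

text \<open>The weight $e^{-|x-x_1|}$ localises the estimate at $x_1$; the factor $e^{-lt}$ makes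
  the zero-order terms absorbable into the supremum being estimated.\<close>

theorem transport_bound:
  assumes t: "t \<in> {0..T}" and C: "0 \<le> C" and H: "0 \<le> H" and K: "0 \<le> K"
    and f0: "\<And>x. \<bar>f 0 x\<bar> \<le> C * exp \<bar>x - x1\<bar>"
    and g: "\<And>t x. t \<in> {0..T} \<Longrightarrow> \<bar>g t x\<bar> \<le> K * \<bar>f t x\<bar> + H * exp \<bar>x - x1\<bar>"
  defines "D \<equiv> exp (A * T + 1)" and "k \<equiv> 2 * mollifier_slope * (1 + L) + K + 1"
  shows "\<bar>f t x1\<bar> \<le> 2 * D * (C + H * T) * exp (2 * D * k * T)"
proof -
  \<comment> \<open>Chosen so that the time integration, which yields
    \<open>D * k * \<Phi> / l\<close>, returns exactly half of \<Phi>.\<close>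
  define l where "l = 2 * D * k"
  have k: "1 \<le> k" unfolding k_def using mollifier_slope_nonneg L_nonneg K by simp
  have D: "1 \<le> D" unfolding D_def using A_nonneg T by simp
  have l: "0 < l" unfolding l_def using k D by simp
  \<comment> \<open>Finite because \<open>f\<close> is bounded and the weight is at most 1;
    otherwise the final absorption of half of \<Phi> would prove nothing.\<close>
  define \<Phi> where "\<Phi> = (SUP (t, x)\<in>{0..T} \<times> UNIV. exp (- \<bar>x - x1\<bar> - l * t) * \<bar>f t x\<bar>)"
  have bdd: "bdd_above ((\<lambda>(t, x). exp (- \<bar>x - x1\<bar> - l * t) * \<bar>f t x\<bar>) ` ({0..T} \<times> UNIV))"
  proof (rule bdd_aboveI2, clarify)
    fix t x :: real assume t: "t \<in> {0..T}"
    have "0 \<le> l * t" using l t by simp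
    then have "exp (- \<bar>x - x1\<bar> - l * t) \<le> 1" by simp
    then have "exp (- \<bar>x - x1\<bar> - l * t) * \<bar>f t x\<bar> \<le> 1 * F"
      using f_bd[OF t] by (intro mult_mono) auto
    then show "exp (- \<bar>x - x1\<bar> - l * t) * \<bar>f t x\<bar> \<le> F" by simp
  qed
  have \<Phi>: "\<bar>f t x\<bar> \<le> \<Phi> * exp (l * t) * exp \<bar>x - x1\<bar>" if "t \<in> {0..T}" for t x
  proof -
    have "exp (- \<bar>x - x1\<bar> - l * t) * \<bar>f t x\<bar> \<le> \<Phi>"
      unfolding \<Phi>_def using cSUP_upper[OF _ bdd, of "(t, x)"] that by simp
    then have "exp (l * t) * exp \<bar>x - x1\<bar> * (exp (- \<bar>x - x1\<bar> - l * t) * \<bar>f t x\<bar>) \<le> exp (l * t) * exp \<bar>x - x1\<bar> * \<Phi>"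
      by (intro mult_left_mono) auto
    moreover have "exp (l * t) * exp \<bar>x - x1\<bar> * exp (- \<bar>x - x1\<bar> - l * t) = 1"
      by (simp flip: exp_add)
    ultimately show ?thesis by (simp only: mult.assoc[symmetric] mult_1) (simp only: mult_ac)
  qed
  have \<Phi>0: "0 \<le> \<Phi>"
    using \<Phi>[of 0 x1] T by (simp add: order_trans[OF abs_ge_zero])
  have key: "exp (- \<bar>x - x1\<bar> - l * t1) * \<bar>f t1 x\<bar> \<le> D * (C + H * T) + \<Phi> / 2"
    if t1: "t1 \<in> {0..T}" for t1 x
  proof -
    \<comment> \<open>Bounds exp |y - x1| on the whole tube around the curve ending at
      \<open>x\<close>: the curve moves by at most \<open>A * T\<close> and the tube has radius at
      most 1.\<close>
    define E where "E = exp \<bar>x - x1\<bar> * D"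
    have E: "0 \<le> E" unfolding E_def using D by simp
    have main: "\<bar>f t1 x\<bar> \<le> E * (C + H * T) + E * k * \<Phi> * exp (l * t1) / l + d" if d: "0 < d" for d
    proof -
      obtain e where e: "0 < e" "e \<le> 1" "\<bar>(LINT y|lborel. f t1 y * mol e (x - y)) - f t1 x\<bar> \<le> d"
        by (rule mollification_tendsto[OF f_cont[OF t1] d])
      have sub: "{0..t1} \<subseteq> {0..T}" using t1 by auto
      have ac: "continuous_on ({0..t1} \<times> UNIV) (\<lambda>(t, x). a t x)"
        by (rule continuous_on_subset[OF a_cont]) (use sub in auto)
      obtain X X' where X: "X t1 = x"
        "\<And>t. t \<in> {0..t1} \<Longrightarrow> (X has_real_derivative X' t) (at t within {0..t1})"
        "\<And>t. t \<in> {0..t1} \<Longrightarrow> \<bar>X' t - a t (X t)\<bar> \<le> e"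
        "\<And>t. t \<in> {0..t1} \<Longrightarrow> \<bar>X' t\<bar> \<le> A"
        by (rule approximate_characteristic[OF _ ac, of A L e x]) (use t1 sub a_bd a_lip e(1) in auto)
      have near: "exp \<bar>y - x1\<bar> \<le> E" if t: "t \<in> {0..t1}" and y: "\<bar>X t - y\<bar> < e" for t y
      proof -
        have "norm (X t1 - X t) \<le> A * norm (t1 - t)"
          by (rule field_differentiable_bound[of "{0..t1}" X X']) (use X t in auto)
        also have "\<dots> \<le> A * T" using A_nonneg t t1 by (intro mult_left_mono) auto
        finally have "\<bar>X t - x\<bar> \<le> A * T" using X(1) by (simp add: abs_minus_commute)
        then have "\<bar>y - x1\<bar> \<le> \<bar>x - x1\<bar> + (A * T + 1)" using y e(2) by linarith
        then show ?thesis unfolding E_def D_def by (simp flip: exp_add)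
      qed
      define P where "P = (\<lambda>t. \<Phi> * exp (l * t) * E)"
      \<comment> \<open>An antiderivative of \<open>k * P t + H * E\<close> after adding the
        mollification error and \<open>q t\<close>; its growing exponential supplies the division by
        \<open>l\<close>.\<close>
      define G where "G = (\<lambda>t. E * k * \<Phi> * exp (l * t) / l + E * H * t)"
      \<comment> \<open>The coefficient of \<open>P t\<close> equals K + 1, written as a difference
        so that it recombines with the mollification error to \<open>k\<close>.\<close>
      define q where "q = (\<lambda>t. (k - 2 * mollifier_slope * (1 + L)) * P t + H * E)"
      have fP: "\<bar>f t y\<bar> \<le> P t" if "t \<in> {0..t1}" "\<bar>X t - y\<bar> < e" for t y
        unfolding P_def
        by (rule order_trans[OF \<Phi> mult_left_mono[OF near[OF that]]]) (use that sub \<Phi>0 in auto)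
      have P0: "0 \<le> P t" for t unfolding P_def using \<Phi>0 E by simp
      have diff: "\<bar>(LINT y|lborel. f t1 y * mol e (X t1 - y)) - (LINT y|lborel. f 0 y * mol e (X 0 - y))\<bar> \<le> G t1 - G 0"
      proof (rule mollified_transport[OF t1 e(1) X(2,3,4) fP])
        fix t y assume *: "t \<in> {0..t1}" "\<bar>X t - y\<bar> < e"
        have "\<bar>g t y\<bar> \<le> K * \<bar>f t y\<bar> + H * exp \<bar>y - x1\<bar>" using g[of t y] * sub by auto
        also have "\<dots> \<le> (K + 1) * P t + H * E"
          using fP[OF *] near[OF *] H K P0[of t] by (intro add_mono mult_mono mult_left_mono) auto
        also have "\<dots> = q t" unfolding q_def k_def by simp
        finally show "\<bar>g t y\<bar> \<le> q t" .
      next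
        fix t
        have "(G has_real_derivative E * k * \<Phi> * (exp (l * t) * l) / l + E * H) (at t within {0..t1})"
          unfolding G_def by (auto intro!: derivative_eq_intros)
        also have "E * k * \<Phi> * (exp (l * t) * l) / l + E * H = 2 * mollifier_slope * (1 + L) * P t + q t"
          using l unfolding q_def P_def by (simp add: algebra_simps)
        finally show "(G has_real_derivative 2 * mollifier_slope * (1 + L) * P t + q t) (at t within {0..t1})" .
      qed
      have t0: "0 \<in> {0..t1}" using t1 by simp
      have init: "\<bar>LINT y|lborel. f 0 y * mol e (X 0 - y)\<bar> \<le> C * E"
      proof -
        have c0: "continuous_on UNIV (f 0)" using f_cont[of 0] T by simp
        have cm: "continuous_on UNIV (\<lambda>y. mol e (X 0 - y))"
          by (auto intro!: continuous_intros continuous_on_compose2[OF continuous_mol[OF e(1), of UNIV]])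
        have i: "integrable lborel (\<lambda>y. f 0 y * mol e (X 0 - y))" "integrable lborel (\<lambda>y. mol e (X 0 - y))"
          by (rule compact_support_integral(1)[OF e(1), of _ "X 0"],
              use mol_support(1)[OF e(1)] c0 cm in \<open>auto intro!: continuous_intros\<close>)+
        have "\<bar>LINT y|lborel. f 0 y * mol e (X 0 - y)\<bar> \<le> (LINT y|lborel. \<bar>f 0 y * mol e (X 0 - y)\<bar>)"
          by (rule integral_abs_bound)
        also have "\<dots> \<le> (LINT y|lborel. C * E * mol e (X 0 - y))"
        proof (rule integral_mono[OF integrable_abs[OF i(1)]])
          show "integrable lborel (\<lambda>y. C * E * mol e (X 0 - y))" using i(2) by simp
          show "\<bar>f 0 y * mol e (X 0 - y)\<bar> \<le> C * E * mol e (X 0 - y)" for y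
          proof (cases "\<bar>X 0 - y\<bar> < e")
            case True
            have "\<bar>f 0 y\<bar> \<le> C * E"
              by (rule order_trans[OF f0 mult_left_mono[OF near[OF t0 True] C]])
            then show ?thesis using mol_nonneg[OF e(1)] by (simp add: abs_mult mult_right_mono)
          qed (use mol_support(1)[OF e(1)] in simp)
        qed
        also have "\<dots> = C * E" using integral_mol[OF e(1)] by simp
        finally show ?thesis .
      qed
      have "G t1 - G 0 \<le> G t1"
        unfolding G_def using E k \<Phi>0 l by simp
      moreover have "G t1 \<le> E * k * \<Phi> * exp (l * t1) / l + E * H * T"
        unfolding G_def using E H t1 by (auto intro!: mult_left_mono)
      ultimately have "\<bar>f t1 x\<bar> \<le> C * E + (E * k * \<Phi> * exp (l * t1) / l + E * H * T) + d"
        using diff init e(3) unfolding X(1) by linarith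
      then show ?thesis by (simp add: algebra_simps)
    qed
    \<comment> \<open>The other terms do not depend on the scale \<open>e\<close>, so the
      mollification error \<open>d\<close> may be sent to 0.\<close>
    have "\<bar>f t1 x\<bar> \<le> E * (C + H * T) + E * k * \<Phi> * exp (l * t1) / l"
      by (rule field_le_epsilon) (use main in simp)
    then have "exp (- \<bar>x - x1\<bar> - l * t1) * \<bar>f t1 x\<bar> \<le>
        exp (- \<bar>x - x1\<bar> - l * t1) * (E * (C + H * T) + E * k * \<Phi> * exp (l * t1) / l)"
      by (rule mult_left_mono) simp
    also have "\<dots> = exp (- l * t1) * (D * (C + H * T)) + D * k * \<Phi> / l"
    proof -
      have "exp (- \<bar>x - x1\<bar> - l * t1) * E = exp (- l * t1) * D" "exp (- l * t1) * exp (l * t1) = 1"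
        unfolding E_def by (simp_all flip: exp_add mult.assoc)
      moreover have "u * (E * p + E * k * \<Phi> * v / l) = u * E * p + u * E * v * (k * \<Phi> / l)" for u v p
        by (simp add: algebra_simps)
      moreover have "u * D * p + u * D * v * (k * \<Phi> / l) = u * (D * p) + (u * v) * (D * k * \<Phi> / l)" for u v p
        by (simp add: algebra_simps)
      ultimately show ?thesis by (simp only: mult_1)
    qed
    also have "\<dots> \<le> 1 * (D * (C + H * T)) + D * k * \<Phi> / l"
      using D C H T l t1 by (intro add_mono mult_right_mono) auto
    also have "D * k * \<Phi> / l = \<Phi> / 2" unfolding l_def using D k by simp
    finally show ?thesis by simp
  qed
  have "\<Phi> \<le> D * (C + H * T) + \<Phi> / 2"
    unfolding \<Phi>_def by (rule cSUP_least) (use T key[unfolded \<Phi>_def] in auto)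
  then have "\<Phi> \<le> 2 * D * (C + H * T)" by simp
  moreover have "exp (l * t) \<le> exp (l * T)" using l t by simp
  ultimately have "\<Phi> * exp (l * t) \<le> 2 * D * (C + H * T) * exp (l * T)"
    using \<Phi>0 by (intro mult_mono) auto
  moreover have "\<bar>f t x1\<bar> \<le> \<Phi> * exp (l * t)" using \<Phi>[OF t, of x1] by simp
  ultimately show ?thesis unfolding l_def by linarith
qed

end

section \<open>The logarithmic weight\<close>

definition log_weight :: "real \<Rightarrow> real \<Rightarrow> real" where
  "log_weight \<beta> x = ln (exp 1 + \<beta> + \<bar>x\<bar>) powr \<beta>"

lemma ln_weight_argument_ge_1:
  assumes "0 < (\<beta>::real)"
  shows "1 \<le> ln (exp 1 + \<beta> + \<bar>x\<bar>)"
proof -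
  have "ln (exp 1) \<le> ln (exp 1 + \<beta> + \<bar>x\<bar>)"
    using assms by (subst ln_le_cancel_iff) (auto simp: add_pos_nonneg)
  then show ?thesis by simp
qed

lemma log_weight_pos: "0 < \<beta> \<Longrightarrow> 0 < log_weight \<beta> x"
  unfolding log_weight_def using ln_weight_argument_ge_1[of \<beta> x] by simp

lemma continuous_log_weight: "0 < \<beta> \<Longrightarrow> continuous_on UNIV (log_weight \<beta>)"
proof -
  assume b: "0 < \<beta>"
  have "exp 1 + \<beta> + \<bar>x\<bar> \<noteq> 0" for x :: real
    using b by (smt (verit) exp_gt_zero)
  moreover have "ln (exp 1 + \<beta> + \<bar>x\<bar>) \<noteq> 0" for x
    using ln_weight_argument_ge_1[OF b, of x] by linarith
  ultimately show ?thesis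
    unfolding log_weight_def by (intro continuous_intros) auto
qed

text \<open>The shift by $e+\beta$ in the weight makes this exponent smaller than $1$, the decay rate of
  the kernel of $(1-\partial_x^2)^{-1}$.\<close>

lemma log_weight_le:
  assumes b: "0 < \<beta>"
  shows "log_weight \<beta> x \<le> log_weight \<beta> y * exp (\<beta> / (exp 1 + \<beta>) * \<bar>x - y\<bar>)"
proof -
  define p q where "p = exp 1 + \<beta> + \<bar>x\<bar>" and "q = exp 1 + \<beta> + \<bar>y\<bar>"
  have e: "0 < exp 1 + \<beta>" using b by (simp add: add_pos_pos)
  have pq: "0 < p" "0 < q" "exp 1 + \<beta> \<le> q" unfolding p_def q_def using e by auto
  have l: "1 \<le> ln p" "1 \<le> ln q" unfolding p_def q_def using ln_weight_argument_ge_1[OF b] by auto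
  \<comment> \<open>The derivative of ln ln is 1/(p ln p), at most 1/(e + \<beta>) on the relevant
    range; the argument applies ln z <= z - 1 twice instead of the mean value theorem.\<close>
  have "ln (ln p) - ln (ln q) \<le> \<bar>x - y\<bar> / (exp 1 + \<beta>)"
  proof (cases "p \<le> q")
    case True
    then have "ln p \<le> ln q" using pq by simp
    then have "ln (ln p) \<le> ln (ln q)" using l by (subst ln_le_cancel_iff) linarith+
    moreover have "0 \<le> \<bar>x - y\<bar> / (exp 1 + \<beta>)" using e by simp
    ultimately show ?thesis by linarith
  next
    case False
    have d0: "0 \<le> ln p - ln q" using pq False by simp
    have "ln (ln p) - ln (ln q) = ln (ln p / ln q)" using l by (simp add: ln_div)
    also have "\<dots> \<le> ln p / ln q - 1" using l by (intro ln_le_minus_one) auto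
    also have "\<dots> = (ln p - ln q) / ln q" using l by (simp add: field_simps)
    also have "\<dots> \<le> (ln p - ln q) / 1"
      by (rule divide_left_mono[OF l(2) d0]) (use l in linarith)
    also have "\<dots> = ln (p / q)" using pq by (simp add: ln_div)
    also have "\<dots> \<le> p / q - 1" using pq by (intro ln_le_minus_one) auto
    also have "\<dots> = (p - q) / q" using pq by (simp add: field_simps)
    also have "\<dots> \<le> (p - q) / (exp 1 + \<beta>)" using pq e False by (intro divide_left_mono) auto
    also have "\<dots> \<le> \<bar>x - y\<bar> / (exp 1 + \<beta>)"
      using e unfolding p_def q_def by (intro divide_right_mono) auto
    finally show ?thesis .
  qed
  then have "\<beta> * ln (ln p) \<le> \<beta> * (ln (ln q) + \<bar>x - y\<bar> / (exp 1 + \<beta>))"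
    using b by (intro mult_left_mono) auto
  then have "exp (\<beta> * ln (ln p)) \<le> exp (\<beta> * ln (ln q)) * exp (\<beta> / (exp 1 + \<beta>) * \<bar>x - y\<bar>)"
    by (simp add: algebra_simps flip: exp_add)
  then show ?thesis
    using l unfolding log_weight_def powr_def p_def[symmetric] q_def[symmetric] by auto
qed

section \<open>Passing decay from u - u_xx to u and u_x\<close>

text \<open>\<open>P\<close> has derivative exp(-y) (u'' - u), and boundedness of u and u' makes
  \<open>P\<close> vanish at plus infinity, so integrating from \<open>x0\<close> leaves only the
  majorant \<open>G\<close>. Its integral is finite because k < 1; the a priori bound
  \<open>U\<close> disappears in the limit.\<close>

lemma elliptic_bound_sum:
  fixes u u' u'' :: "real \<Rightarrow> real"
  assumes u: "\<And>x. (u has_real_derivative u' x) (at x)" "\<And>x. (u' has_real_derivative u'' x) (at x)"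
    and U: "\<And>x. \<bar>u x\<bar> \<le> U" "\<And>x. \<bar>u' x\<bar> \<le> U"
    and k: "k < 1" and B: "\<And>x. \<bar>u x - u'' x\<bar> \<le> B * exp (k * \<bar>x - x0\<bar>)"
  shows "\<bar>u x0 + u' x0\<bar> \<le> B / (1 - k)"
proof -
  define P where "P = (\<lambda>y. exp (- y) * (u y + u' y))"
  define G where "G = (\<lambda>y. - (B / (1 - k)) * exp (k * (y - x0) - y))"
  have PG: "\<bar>P z - P x0\<bar> \<le> G z - G x0" if "x0 \<le> z" for z
  proof (rule abs_diff_le_of_derivative_bound[OF that])
    fix t assume t: "t \<in> {x0..z}"
    show "(P has_real_derivative exp (- t) * (u'' t - u t)) (at t within {x0..z})"
      unfolding P_def
      by (rule has_field_derivative_at_within) (auto intro!: derivative_eq_intros u simp: algebra_simps)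
    have "(G has_real_derivative - (B / (1 - k)) * (exp (k * (t - x0) - t) * (k - 1))) (at t within {x0..z})"
      unfolding G_def using k by (auto intro!: derivative_eq_intros)
    also have "- (B / (1 - k)) * (exp (k * (t - x0) - t) * (k - 1)) = B * exp (k * (t - x0) - t)"
    proof -
      have "B / (1 - k) * (1 - k) = B" using k by simp
      moreover have "- r * (E * (k - 1)) = r * (1 - k) * E" for r E
        by (simp add: algebra_simps)
      ultimately show ?thesis by (simp only:)
    qed
    finally show "(G has_real_derivative B * exp (k * (t - x0) - t)) (at t within {x0..z})" .
    have "\<bar>exp (- t) * (u'' t - u t)\<bar> \<le> exp (- t) * (B * exp (k * \<bar>t - x0\<bar>))"
      unfolding abs_mult using B[of t] by (auto simp: abs_minus_commute)
    also have "\<dots> = B * exp (k * (t - x0) - t)" 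
    proof -
      have "\<bar>t - x0\<bar> = t - x0" using t by simp
      moreover have "exp (- t) * exp (k * (t - x0)) = exp (k * (t - x0) - t)"
        by (simp flip: exp_add)
      ultimately show ?thesis by (simp add: mult_ac)
    qed
    finally show "\<bar>exp (- t) * (u'' t - u t)\<bar> \<le> B * exp (k * (t - x0) - t)" .
  qed
  have B0: "0 \<le> B" using B[of x0] by simp
  have le: "\<bar>P x0\<bar> \<le> exp (- z) * (2 * U) + B / (1 - k) * exp (- x0)" if "x0 \<le> z" for z
  proof -
    have "\<bar>P z\<bar> \<le> exp (- z) * (2 * U)"
      unfolding P_def abs_mult using U[of z] by (auto intro!: mult_left_mono)
    moreover have "G z \<le> 0" unfolding G_def using B0 k by simp
    moreover have "G x0 = - (B / (1 - k) * exp (- x0))" unfolding G_def by simp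
    ultimately show ?thesis using PG[OF that] by linarith
  qed
  have "((\<lambda>z. exp (- z) * (2 * U) + B / (1 - k) * exp (- x0)) \<longlongrightarrow> 0 * (2 * U) + B / (1 - k) * exp (- x0)) at_top"
    by (intro tendsto_intros filterlim_compose[OF exp_at_bot] filterlim_uminus_at_top_at_bot[THEN filterlim_compose] filterlim_uminus_at_bot_at_top)
  then have "\<bar>P x0\<bar> \<le> 0 * (2 * U) + B / (1 - k) * exp (- x0)"
  proof (rule tendsto_lowerbound)
    show "\<forall>\<^sub>F z in at_top. \<bar>P x0\<bar> \<le> exp (- z) * (2 * U) + B / (1 - k) * exp (- x0)"
      by (rule eventually_at_top_linorderI[of x0]) (rule le)
  qed simp
  then have "exp (- x0) * \<bar>u x0 + u' x0\<bar> \<le> exp (- x0) * (B / (1 - k))"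
    unfolding P_def abs_mult by (simp add: mult.commute)
  then show ?thesis by (subst (asm) mult_le_cancel_left_pos) auto
qed

text \<open>The reflection x to -x preserves u - u'' and reverses the sign of u'; hence both u + u'
  and u - u' are controlled.\<close>

lemma elliptic_bound:
  fixes u u' u'' :: "real \<Rightarrow> real"
  assumes u: "\<And>x. (u has_real_derivative u' x) (at x)" "\<And>x. (u' has_real_derivative u'' x) (at x)"
    and U: "\<And>x. \<bar>u x\<bar> \<le> U" "\<And>x. \<bar>u' x\<bar> \<le> U"
    and k: "k < 1" and B: "\<And>x. \<bar>u x - u'' x\<bar> \<le> B * exp (k * \<bar>x - x0\<bar>)"
  shows "\<bar>u x0\<bar> \<le> B / (1 - k)" "\<bar>u' x0\<bar> \<le> B / (1 - k)"
proof -
  have m: "((\<lambda>x. - x) has_real_derivative - 1) (at x)" for x :: real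
    by (auto intro!: derivative_eq_intros)
  have 1: "\<bar>u x0 + u' x0\<bar> \<le> B / (1 - k)"
    by (rule elliptic_bound_sum[OF u U k B])
  have "\<bar>u (- (- x0)) + (- u' (- (- x0)))\<bar> \<le> B / (1 - k)"
  proof (rule elliptic_bound_sum[where u = "\<lambda>x. u (- x)" and u' = "\<lambda>x. - u' (- x)" and u'' = "\<lambda>x. u'' (- x)" and U = U])
    show "((\<lambda>x. u (- x)) has_real_derivative - u' (- x)) (at x)" for x
      using DERIV_chain2[OF u(1) m] by simp
    show "((\<lambda>x. - u' (- x)) has_real_derivative u'' (- x)) (at x)" for x
      using DERIV_minus[OF DERIV_chain2[OF u(2) m]] by simp
    show "\<bar>u (- x) - u'' (- x)\<bar> \<le> B * exp (k * \<bar>x - - x0\<bar>)" for x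
    proof -
      have "\<bar>- x - x0\<bar> = \<bar>x - - x0\<bar>" by linarith
      then show ?thesis using B[of "- x"] by metis
    qed
  qed (use U k in auto)
  then have 2: "\<bar>u x0 - u' x0\<bar> \<le> B / (1 - k)" by simp
  show "\<bar>u x0\<bar> \<le> B / (1 - k)" "\<bar>u' x0\<bar> \<le> B / (1 - k)" using 1 2 by linarith+
qed

section \<open>Essential suprema of continuous functions\<close>

lemma AE_lborel_imp_everywhere:
  fixes h :: "real \<Rightarrow> real"
  assumes cont: "continuous_on UNIV h" and ae: "AE x in lborel. h x \<le> c"
  shows "h x \<le> c"
proof (rule ccontr)
  assume "\<not> h x \<le> c"
  then have "0 < h x - c" by simp
  then obtain d where d: "0 < d" "\<And>y. \<bar>y - x\<bar> < d \<Longrightarrow> \<bar>h y - h x\<bar> < h x - c"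
    using cont unfolding continuous_on_eq_continuous_at[OF open_UNIV] continuous_at_eps_delta
    by (metis UNIV_I dist_real_def)
  have "AE y in lborel. y \<notin> {x - d<..<x + d}"
    using ae
  proof eventually_elim
    case (elim y)
    show ?case using d(2)[of y] elim by (auto simp: abs_less_iff)
  qed
  then have "emeasure lborel {x - d<..<x + d} = 0"
    by (subst (asm) AE_iff_measurable[of "{x - d<..<x + d}"]) auto
  then show False using d(1) by simp
qed

lemma Linf_norm_nonneg: "0 \<le> Linf_norm f"
proof (rule ccontr)
  assume neg: "\<not> 0 \<le> Linf_norm f"
  \<comment> \<open>A null measure would have essential supremum minus infinity. Applying
    \<open>AE_lborel_imp_everywhere\<close> to the zero function rules this out for Lebesgue
    measure.\<close>
  have "AE x in lborel. 0 * x \<le> (-1 :: real)"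
    using esssup_AE[of "\<lambda>x. ereal \<bar>f x\<bar>" lborel]
  proof eventually_elim
    case (elim x)
    have "0 \<le> ereal \<bar>f x\<bar>" by simp
    then show ?case using elim neg unfolding Linf_norm_def by (meson order_trans)
  qed
  then have "0 * 0 \<le> (- 1 :: real)"
    by (rule AE_lborel_imp_everywhere[rotated]) (intro continuous_intros)
  then show False by simp
qed

lemma Linf_norm_le_iff:
  assumes "continuous_on UNIV f"
  shows "Linf_norm f \<le> ereal c \<longleftrightarrow> (\<forall>x. \<bar>f x\<bar> \<le> c)"
proof
  assume le: "Linf_norm f \<le> ereal c"
  have "AE x in lborel. \<bar>f x\<bar> \<le> c"
    using esssup_AE[of "\<lambda>x. ereal \<bar>f x\<bar>" lborel]
  proof eventually_elim
    case (elim x)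
    then show ?case using order_trans[OF elim le[unfolded Linf_norm_def]] by simp
  qed
  then show "\<forall>x. \<bar>f x\<bar> \<le> c"
    using AE_lborel_imp_everywhere[of "\<lambda>x. \<bar>f x\<bar>" c] assms by (auto intro: continuous_intros)
next
  assume "\<forall>x. \<bar>f x\<bar> \<le> c"
  moreover have "f \<in> borel_measurable borel" using assms by (rule borel_measurable_continuous_onI)
  ultimately show "Linf_norm f \<le> ereal c"
    unfolding Linf_norm_def by (intro esssup_I) auto
qed

section \<open>Persistence of the weighted bounds\<close>

text \<open>The bound of \<open>transport_bound\<close> with \<open>D\<close> and \<open>k\<close>
  written out. It is linear in the pair (C, H), so a common factor 1 / w x of both can be pulled
  out.\<close>

definition transport_growth :: "real \<Rightarrow> real \<Rightarrow> real \<Rightarrow> real \<Rightarrow> real \<Rightarrow> real \<Rightarrow> real" where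
  "transport_growth A L K C H T = 2 * exp (A * T + 1) * (C + H * T) *
     exp (2 * exp (A * T + 1) * (2 * mollifier_slope * (1 + L) + K + 1) * T)"

text \<open>Allows the actual time \<open>T0\<close> to be replaced by the fixed horizon \<tau> in
  all constants.\<close>

lemma transport_growth_mono:
  assumes "0 \<le> A" "0 \<le> L" "0 \<le> K" "0 \<le> C" "0 \<le> H" "0 \<le> T" "T \<le> T'"
  shows "transport_growth A L K C H T \<le> transport_growth A L K C H T'"
proof -
  have E: "exp (A * T + 1) \<le> exp (A * T' + 1)" using assms by (simp add: mult_left_mono)
  have C: "C + H * T \<le> C + H * T'" using assms by (simp add: mult_left_mono)
  have k: "0 \<le> 2 * mollifier_slope * (1 + L) + K + 1" using assms mollifier_slope_nonneg by simp
  have "2 * exp (A * T + 1) * (2 * mollifier_slope * (1 + L) + K + 1) * T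
     \<le> 2 * exp (A * T' + 1) * (2 * mollifier_slope * (1 + L) + K + 1) * T'"
    using E k assms by (intro mult_mono mult_nonneg_nonneg) auto
  then show "transport_growth A L K C H T \<le> transport_growth A L K C H T'"
    unfolding transport_growth_def using E C assms
    by (intro mult_mono mult_nonneg_nonneg add_nonneg_nonneg) auto
qed

text \<open>Slow variation gives 1 / w y <= exp |y - x| / w x, so the localised estimate can be
  applied at every \<open>x\<close> separately with data \<open>C / w x\<close> and
  \<open>H / w x\<close>. Nothing has to be known about w f beforehand except at time 0.\<close>

lemma (in transport) weighted_transport_bound:
  assumes t: "t \<in> {0..T}" and C: "0 \<le> C" and H: "0 \<le> H" and K: "0 \<le> K"
    and w: "\<And>x. 0 < w x" "\<And>x y. w x \<le> w y * exp \<bar>x - y\<bar>"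
    and f0: "\<And>x. \<bar>f 0 x\<bar> \<le> C / w x"
    and g: "\<And>t x. t \<in> {0..T} \<Longrightarrow> \<bar>g t x\<bar> \<le> K * \<bar>f t x\<bar> + H / w x"
  shows "\<bar>f t x\<bar> \<le> transport_growth A L K C H T / w x"
proof -
  have wle: "B / w y \<le> B / w x * exp \<bar>y - x\<bar>" if "0 \<le> B" for B y
  proof -
    have "B * w x \<le> B * (w y * exp \<bar>y - x\<bar>)"
      using w(2)[of x y] that by (intro mult_left_mono) (auto simp: abs_minus_commute)
    then show ?thesis using w(1)[of x] w(1)[of y] by (simp add: field_simps)
  qed
  have "\<bar>f t x\<bar> \<le> 2 * exp (A * T + 1) * (C / w x + H / w x * T) *
     exp (2 * exp (A * T + 1) * (2 * mollifier_slope * (1 + L) + K + 1) * T)"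
  proof (rule transport_bound[OF t])
    show "\<bar>f 0 y\<bar> \<le> C / w x * exp \<bar>y - x\<bar>" for y
      using f0[of y] wle[OF C, of y] by linarith
    show "\<bar>g t y\<bar> \<le> K * \<bar>f t y\<bar> + H / w x * exp \<bar>y - x\<bar>" if "t \<in> {0..T}" for t y
      using g[OF that, of y] wle[OF H, of y] by linarith
  qed (use C H K w(1)[of x] in auto)
  also have "\<dots> = transport_growth A L K C H T / w x"
    unfolding transport_growth_def by (simp add: add_divide_distrib distrib_left distrib_right)
  finally show ?thesis .
qed

section \<open>From continuity in Sobolev norm to uniform continuity in time\<close>

lemma continuous_into_sobolev_mem:
  "continuous_into_sobolev s T f \<Longrightarrow> t \<in> time_interval T \<Longrightarrow> f t \<in> sobolev_cont s"
  unfolding continuous_into_sobolev_def by auto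

lemma deriv_iter_diff:
  fixes f g :: "real \<Rightarrow> real"
  assumes "\<And>i x. i < j \<Longrightarrow> (deriv ^^ i) f differentiable at x" "\<And>i x. i < j \<Longrightarrow> (deriv ^^ i) g differentiable at x"
  shows "(deriv ^^ j) (\<lambda>x. f x - g x) = (\<lambda>x. (deriv ^^ j) f x - (deriv ^^ j) g x)"
  using assms
proof (induction j)
  case (Suc j)
  have "((\<lambda>x. (deriv ^^ j) f x - (deriv ^^ j) g x) has_real_derivative
      (deriv ^^ Suc j) f x - (deriv ^^ Suc j) g x) (at x)" for x
    using Suc.prems[of j x] by (auto intro!: DERIV_diff simp: DERIV_deriv_iff_real_differentiable)
  then show ?case using Suc by (auto intro!: DERIV_imp_deriv)
qed simp

text \<open>The embedding is applied to the difference of two time slices, whose derivatives are the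
  differences of the derivatives.\<close>

lemma continuous_into_sobolev_uniform:
  assumes f: "continuous_into_sobolev s T f" and s: "s > real k + 1 / 2" and j: "j \<le> k"
    and t: "t \<in> time_interval T" and e: "0 < e"
  shows "\<forall>\<^sub>F r in at t within time_interval T. \<forall>x. \<bar>(deriv ^^ j) (f r) x - (deriv ^^ j) (f t) x\<bar> < e"
proof -
  obtain K where K: "0 \<le> K" "\<And>f j x. f \<in> sobolev_cont s \<Longrightarrow> j \<le> k \<Longrightarrow>
     \<bar>(deriv ^^ j) f x\<bar> \<le> K * sobolev_norm s f \<and> (j < k \<longrightarrow> (deriv ^^ j) f differentiable at x)"
    using sobolev_embedding[OF s] by blast
  have "((\<lambda>r. K * sobolev_norm s (\<lambda>x. f r x - f t x)) \<longlongrightarrow> K * 0) (at t within time_interval T)"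
    using f t unfolding continuous_into_sobolev_def by (intro tendsto_mult tendsto_const) auto
  then have "\<forall>\<^sub>F r in at t within time_interval T. K * sobolev_norm s (\<lambda>x. f r x - f t x) < e"
    using e by (intro order_tendstoD(2)) auto
  moreover have "\<forall>\<^sub>F r in at t within time_interval T. r \<in> time_interval T"
    unfolding eventually_at_filter by (rule always_eventually) simp
  ultimately show ?thesis
  proof eventually_elim
    case (elim r)
    note m = continuous_into_sobolev_mem[OF f elim(2)] continuous_into_sobolev_mem[OF f t]
    have "(deriv ^^ j) (\<lambda>x. f r x - f t x) = (\<lambda>x. (deriv ^^ j) (f r) x - (deriv ^^ j) (f t) x)"
      using K(2)[OF m(1)] K(2)[OF m(2)] j by (intro deriv_iter_diff) auto
    then have "\<bar>(deriv ^^ j) (f r) x - (deriv ^^ j) (f t) x\<bar> \<le> K * sobolev_norm s (\<lambda>x. f r x - f t x)" for x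
      using K(2)[OF sobolev_cont_diff[OF m] j, of x] by metis
    then show ?case using elim(1) by (meson le_less_trans)
  qed
qed

lemma continuous_into_sobolev_pointwise:
  assumes f: "continuous_into_sobolev s T f" and s: "s > real k + 1 / 2" and j: "j \<le> k"
    and t: "t \<in> time_interval T"
  shows "((\<lambda>r. (deriv ^^ j) (f r) x) \<longlongrightarrow> (deriv ^^ j) (f t) x) (at t within time_interval T)"
proof (rule tendstoI)
  fix e :: real assume "0 < e"
  from continuous_into_sobolev_uniform[OF f s j t this]
  show "\<forall>\<^sub>F r in at t within time_interval T. dist ((deriv ^^ j) (f r) x) ((deriv ^^ j) (f t) x) < e"
    by eventually_elim (simp add: dist_real_def)
qed

text \<open>Closeness in time being uniform in space, joint continuity reduces to continuity of the
  single slice \<open>f t\<close>.\<close>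

lemma continuous_into_sobolev_jointly:
  assumes f: "continuous_into_sobolev s T f" and s: "s > 1 / 2"
  shows "continuous_on (time_interval T \<times> UNIV) (\<lambda>(t, x). f t x)"
  unfolding continuous_on_def
proof clarify
  fix t x assume t: "t \<in> time_interval T"
  have u: "\<forall>\<^sub>F r in at t within time_interval T. \<forall>x. \<bar>f r x - f t x\<bar> < e" if "0 < e" for e
    using continuous_into_sobolev_uniform[OF f, of 0 0 t e] s t that by simp
  have c: "isCont (f t) x"
    using continuous_into_sobolev_mem[OF f t] unfolding sobolev_cont_def
    by (auto simp: continuous_on_eq_continuous_at)
  show "((\<lambda>(t, x). f t x) \<longlongrightarrow> f t x) (at (t, x) within time_interval T \<times> UNIV)"
  proof (rule tendstoI)
    fix e :: real assume e: "0 < e"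
    obtain d1 where d1: "0 < d1" "\<And>r y. r \<in> time_interval T \<Longrightarrow> r \<noteq> t \<Longrightarrow> dist r t < d1 \<Longrightarrow> \<bar>f r y - f t y\<bar> < e / 2"
      using u[of "e / 2"] e unfolding eventually_at by auto
    obtain d2 where d2: "0 < d2" "\<And>y. dist y x < d2 \<Longrightarrow> \<bar>f t y - f t x\<bar> < e / 2"
      using c e unfolding continuous_at_eps_delta dist_real_def by (meson half_gt_zero)
    show "\<forall>\<^sub>F p in at (t, x) within time_interval T \<times> UNIV. dist (case p of (t, x) \<Rightarrow> f t x) (f t x) < e"
      unfolding eventually_at
    proof (intro exI[of _ "min d1 d2"] conjI ballI impI)
      fix p :: "real \<times> real" assume p: "p \<in> time_interval T \<times> UNIV" "p \<noteq> (t, x) \<and> dist p (t, x) < min d1 d2"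
      obtain r y where ry: "p = (r, y)" by (cases p)
      have "dist r t < d1" "dist y x < d2"
        using p(2) dist_fst_le[of p "(t, x)"] dist_snd_le[of p "(t, x)"] unfolding ry by auto
      then have "\<bar>f r y - f t y\<bar> < e / 2" "\<bar>f t y - f t x\<bar> < e / 2"
        using d1(2)[of r y] d2(2)[of y] p(1) e unfolding ry by (cases "r = t"; auto)+
      then show "dist (case p of (t, x) \<Rightarrow> f t x) (f t x) < e"
        unfolding ry dist_real_def prod.case by linarith
    qed (use d1 d2 in simp)
  qed
qed

lemma le_sup_sobolev_norm:
  assumes \<rho>: "continuous_into_sobolev (s - 1) T \<rho>" and u: "continuous_into_sobolev s T u"
    and v: "continuous_into_sobolev s T v" and T0: "ereal T0 < T" and t: "t \<in> {0..T0}"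
  shows "sobolev_norm (s - 1) (\<rho> t) + sobolev_norm s (u t) + sobolev_norm s (v t) \<le> sup_sobolev_norm s T0 \<rho> u v"
proof -
  obtain B1 B2 B3 where "\<forall>t\<in>{0..T0}. sobolev_norm (s - 1) (\<rho> t) \<le> B1"
    "\<forall>t\<in>{0..T0}. sobolev_norm s (u t) \<le> B2" "\<forall>t\<in>{0..T0}. sobolev_norm s (v t) \<le> B3"
    using continuous_into_sobolev_bounded[OF \<rho> T0] continuous_into_sobolev_bounded[OF u T0]
      continuous_into_sobolev_bounded[OF v T0] by blast
  then have "bdd_above ((\<lambda>t. sobolev_norm (s - 1) (\<rho> t) + sobolev_norm s (u t) + sobolev_norm s (v t)) ` {0..T0})"
    by (intro bdd_aboveI2[of _ _ "B1 + B2 + B3"] add_mono) auto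
  then show ?thesis unfolding sup_sobolev_norm_def using t by (rule cSUP_upper[rotated])
qed

lemma ereal_le_sum_list:
  fixes x :: ereal
  assumes "x \<in> set xs" and "\<And>y. y \<in> set xs \<Longrightarrow> 0 \<le> y"
  shows "x \<le> sum_list xs"
  using assms
proof (induction xs)
  case (Cons y ys)
  have "0 \<le> sum_list ys" using Cons.prems(2) by (intro sum_list_nonneg) auto
  then show ?case
    using Cons by (auto intro: add_increasing add_increasing2)
qed simp

text \<open>The dictionary between the norm and pointwise decay, in both directions. Continuity
  upgrades almost everywhere to everywhere, and nonnegativity of the summands lets each be bounded
  by the sum. In the second part \<open>B\<close> covers u, u_x, v, v_x and \<open>B'\<close> covers
  the two second derivatives.\<close>

lemma weighted_norm_bounds:
  assumes b: "0 < \<beta>" and c: "continuous_on UNIV \<rho>" "continuous_on UNIV u" "continuous_on UNIV (deriv u)"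
      "continuous_on UNIV (deriv (deriv u))" "continuous_on UNIV v" "continuous_on UNIV (deriv v)"
      "continuous_on UNIV (deriv (deriv v))"
  shows "weighted_norm \<beta> \<rho> u v \<le> ereal C \<Longrightarrow> f \<in> {\<rho>, u, deriv u, deriv (deriv u), v, deriv v, deriv (deriv v)} \<Longrightarrow>
      \<bar>f x\<bar> \<le> C / log_weight \<beta> x"
    and "(\<And>x. \<bar>\<rho> x\<bar> \<le> R / log_weight \<beta> x) \<Longrightarrow> (\<And>x. \<bar>u x\<bar> \<le> B / log_weight \<beta> x) \<Longrightarrow>
      (\<And>x. \<bar>deriv u x\<bar> \<le> B / log_weight \<beta> x) \<Longrightarrow> (\<And>x. \<bar>deriv (deriv u) x\<bar> \<le> B' / log_weight \<beta> x) \<Longrightarrow>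
      (\<And>x. \<bar>v x\<bar> \<le> B / log_weight \<beta> x) \<Longrightarrow> (\<And>x. \<bar>deriv v x\<bar> \<le> B / log_weight \<beta> x) \<Longrightarrow>
      (\<And>x. \<bar>deriv (deriv v) x\<bar> \<le> B' / log_weight \<beta> x) \<Longrightarrow>
      weighted_norm \<beta> \<rho> u v \<le> ereal (R + 4 * B + 2 * B')"
proof -
  note w = log_weight_pos[OF b]
  define n where "n = (\<lambda>f. Linf_norm (\<lambda>x. f x * log_weight \<beta> x))"
  have wn: "weighted_norm \<beta> \<rho> u v = n \<rho> + (n u + (n (deriv u) + (n (deriv (deriv u)) + (n v + (n (deriv v) + n (deriv (deriv v)))))))"
    by (simp add: weighted_norm_def n_def log_weight_def)
  have n_iff: "n f \<le> ereal C \<longleftrightarrow> (\<forall>x. \<bar>f x\<bar> \<le> C / log_weight \<beta> x)" if "continuous_on UNIV f" for f C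
  proof -
    have "n f \<le> ereal C \<longleftrightarrow> (\<forall>x. \<bar>f x * log_weight \<beta> x\<bar> \<le> C)"
      unfolding n_def by (intro Linf_norm_le_iff continuous_on_mult that continuous_log_weight b)
    moreover have "\<bar>f x * log_weight \<beta> x\<bar> \<le> C \<longleftrightarrow> \<bar>f x\<bar> \<le> C / log_weight \<beta> x" for x
      using w[of x] by (simp add: abs_mult field_simps)
    ultimately show ?thesis by simp
  qed
  have n0: "0 \<le> n f" for f unfolding n_def by (rule Linf_norm_nonneg)
  show "\<bar>f x\<bar> \<le> C / log_weight \<beta> x" if le: "weighted_norm \<beta> \<rho> u v \<le> ereal C"
    and f: "f \<in> {\<rho>, u, deriv u, deriv (deriv u), v, deriv v, deriv (deriv v)}"
  proof -
    have "n f \<le> (\<Sum>f\<leftarrow>[\<rho>, u, deriv u, deriv (deriv u), v, deriv v, deriv (deriv v)]. n f)"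
      by (rule ereal_le_sum_list) (use f n0 in auto)
    then have "n f \<le> weighted_norm \<beta> \<rho> u v"
      by (simp add: wn)
    then have "n f \<le> ereal C" using le by (rule order_trans)
    moreover have "continuous_on UNIV f" using f c by auto
    ultimately show ?thesis using n_iff by blast
  qed
  show "weighted_norm \<beta> \<rho> u v \<le> ereal (R + 4 * B + 2 * B')"
    if "\<And>x. \<bar>\<rho> x\<bar> \<le> R / log_weight \<beta> x" "\<And>x. \<bar>u x\<bar> \<le> B / log_weight \<beta> x"
      "\<And>x. \<bar>deriv u x\<bar> \<le> B / log_weight \<beta> x" "\<And>x. \<bar>deriv (deriv u) x\<bar> \<le> B' / log_weight \<beta> x"
      "\<And>x. \<bar>v x\<bar> \<le> B / log_weight \<beta> x" "\<And>x. \<bar>deriv v x\<bar> \<le> B / log_weight \<beta> x"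
      "\<And>x. \<bar>deriv (deriv v) x\<bar> \<le> B' / log_weight \<beta> x"
  proof -
    have "weighted_norm \<beta> \<rho> u v \<le> ereal R + (ereal B + (ereal B + (ereal B' + (ereal B + (ereal B + ereal B')))))"
      unfolding wn by (intro add_mono iffD2[OF n_iff] c allI that)
    then show ?thesis by (simp add: add.assoc)
  qed
qed

lemma sobolev_cont_C2:
  assumes "s > 5 / 2" and "f \<in> sobolev_cont s"
  shows "(f has_real_derivative deriv f x) (at x)"
    and "(deriv f has_real_derivative deriv (deriv f) x) (at x)"
    and "continuous_on UNIV f" "continuous_on UNIV (deriv f)" "continuous_on UNIV (deriv (deriv f))"
proof -
  have s: "s > real 2 + 1 / 2" using assms(1) by simp
  have E: "isCont ((deriv ^^ j) f) x" "j < 2 \<Longrightarrow> (deriv ^^ j) f differentiable at x" if "j \<le> 2" for j x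
    using sobolev_embedding[OF s] assms(2) that by blast+
  show "(f has_real_derivative deriv f x) (at x)" "(deriv f has_real_derivative deriv (deriv f) x) (at x)"
    using E(2)[of 0] E(2)[of 1] by (auto simp: DERIV_deriv_iff_real_differentiable)
  show "continuous_on UNIV f" "continuous_on UNIV (deriv f)" "continuous_on UNIV (deriv (deriv f))"
    using E(1)[of 0] E(1)[of 1] E(1)[of 2] by (auto simp: continuous_on_eq_continuous_at numeral_2_eq_2)
qed

section \<open>Decay of the momenta transported by the velocity uv\<close>

lemma abs_mult_le_square:
  fixes p q N :: real
  shows "\<bar>p\<bar> \<le> N \<Longrightarrow> \<bar>q\<bar> \<le> N \<Longrightarrow> \<bar>p * q\<bar> \<le> N\<^sup>2"
  unfolding abs_mult power2_eq_square by (intro mult_mono) auto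

text \<open>All dependence on M is packed into the single number \<open>N\<close>, later the
  embedding constants times M. From here on u v counts as a given velocity with bound N^2 and
  Lipschitz constant 2 N^2.\<close>

locale bounded_velocity =
  fixes s \<beta> N T0 :: real and T :: ereal and u v :: "real \<Rightarrow> real \<Rightarrow> real"
  assumes s: "s > 5 / 2" and \<beta>: "0 < \<beta>" and T0: "0 \<le> T0" "ereal T0 < T"
    and u: "continuous_into_sobolev s T u" and v: "continuous_into_sobolev s T v"
    and u_le: "\<And>t x. t \<in> {0..T0} \<Longrightarrow> \<bar>u t x\<bar> \<le> N"
      "\<And>t x. t \<in> {0..T0} \<Longrightarrow> \<bar>deriv (u t) x\<bar> \<le> N"
      "\<And>t x. t \<in> {0..T0} \<Longrightarrow> \<bar>deriv (deriv (u t)) x\<bar> \<le> N"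
    and v_le: "\<And>t x. t \<in> {0..T0} \<Longrightarrow> \<bar>v t x\<bar> \<le> N"
      "\<And>t x. t \<in> {0..T0} \<Longrightarrow> \<bar>deriv (v t) x\<bar> \<le> N"
      "\<And>t x. t \<in> {0..T0} \<Longrightarrow> \<bar>deriv (deriv (v t)) x\<bar> \<le> N"
begin

lemma interval_subset: "{0..T0} \<subseteq> time_interval T"
  using T0 by (auto simp: time_interval_def intro: le_less_trans[of _ "ereal T0"])

lemma mem: "t \<in> {0..T0} \<Longrightarrow> u t \<in> sobolev_cont s" "t \<in> {0..T0} \<Longrightarrow> v t \<in> sobolev_cont s"
  using continuous_into_sobolev_mem u v interval_subset by blast+

lemma velocity_has_derivative:
  assumes t: "t \<in> {0..T0}"
  shows "((\<lambda>x. u t x * v t x) has_real_derivative deriv (u t) x * v t x + u t x * deriv (v t) x) (at x)"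
  using DERIV_mult[OF sobolev_cont_C2(1)[OF s mem(1)[OF t]] sobolev_cont_C2(1)[OF s mem(2)[OF t]], of x]
  by (simp add: algebra_simps)

lemma transport_velocity:
  assumes "\<And>t. t \<in> {0..T0} \<Longrightarrow> continuous_on UNIV (f t)"
    and "\<And>t. t \<in> {0..T0} \<Longrightarrow> continuous_on UNIV (g t)"
    and "\<And>t x. t \<in> {0..T0} \<Longrightarrow> \<bar>f t x\<bar> \<le> F"
    and time: "\<And>t x. t \<in> {0..T0} \<Longrightarrow> ((\<lambda>r. f r x) \<longlongrightarrow> f t x) (at t within time_interval T)"
    and weak: "\<And>\<phi> t. test_function \<phi> \<Longrightarrow> t \<in> {0..T0} \<Longrightarrow>
      ((\<lambda>r. LINT x|lborel. f r x * \<phi> x) has_real_derivative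
        (LINT x|lborel. f t x * (u t x * v t x) * deriv \<phi> x + g t x * \<phi> x)) (at t within time_interval T)"
  shows "transport f g (\<lambda>t x. u t x * v t x) T0 F (N\<^sup>2) (2 * N\<^sup>2)"
proof
  show "((\<lambda>r. f r x) \<longlongrightarrow> f t x) (at t within {0..T0})" if "t \<in> {0..T0}" for t x
    by (rule tendsto_within_subset[OF time[OF that] interval_subset])
  show "((\<lambda>r. LINT x|lborel. f r x * \<phi> x) has_real_derivative
        (LINT x|lborel. f t x * (u t x * v t x) * deriv \<phi> x + g t x * \<phi> x)) (at t within {0..T0})"
    if "test_function \<phi>" "t \<in> {0..T0}" for \<phi> t
    by (rule has_field_derivative_subset[OF weak[OF that] interval_subset])
  have "continuous_on ({0..T0} \<times> UNIV) (\<lambda>(t, x). h t x)" if "continuous_into_sobolev s T h" for h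
    by (rule continuous_on_subset[OF continuous_into_sobolev_jointly[OF that]]) (use s interval_subset in auto)
  from continuous_on_mult[OF this[OF u] this[OF v]]
  show "continuous_on ({0..T0} \<times> UNIV) (\<lambda>(t, x). u t x * v t x)"
    by (simp add: case_prod_unfold)
  show "\<bar>u t x * v t x\<bar> \<le> N\<^sup>2" if "t \<in> {0..T0}" for t x
    using that by (intro abs_mult_le_square u_le v_le)
  show "\<bar>u t x * v t x - u t y * v t y\<bar> \<le> 2 * N\<^sup>2 * \<bar>x - y\<bar>" if t: "t \<in> {0..T0}" for t x y
  proof -
    have "norm (u t x * v t x - u t y * v t y) \<le> 2 * N\<^sup>2 * norm (x - y)"
    proof (rule field_differentiable_bound[of UNIV])
      show "((\<lambda>x. u t x * v t x) has_real_derivative deriv (u t) z * v t z + u t z * deriv (v t) z) (at z within UNIV)" for z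
        using velocity_has_derivative[OF t] by simp
      show "norm (deriv (u t) z * v t z + u t z * deriv (v t) z) \<le> 2 * N\<^sup>2" for z
        using abs_mult_le_square[OF u_le(2)[OF t, of z] v_le(1)[OF t, of z]]
          abs_mult_le_square[OF u_le(1)[OF t, of z] v_le(2)[OF t, of z]] by simp
    qed auto
    then show ?thesis by simp
  qed
qed (use assms T0 in auto)

lemma weight: "0 < log_weight \<beta> x" "log_weight \<beta> x \<le> log_weight \<beta> y * exp \<bar>x - y\<bar>"
proof -
  show p: "0 < log_weight \<beta> x" for x by (rule log_weight_pos[OF \<beta>])
  have "\<beta> / (exp 1 + \<beta>) * \<bar>x - y\<bar> \<le> 1 * \<bar>x - y\<bar>"
    using \<beta> by (intro mult_right_mono) (auto simp: add_pos_pos)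
  then have "log_weight \<beta> y * exp (\<beta> / (exp 1 + \<beta>) * \<bar>x - y\<bar>) \<le> log_weight \<beta> y * exp \<bar>x - y\<bar>"
    using p[of y] by simp
  then show "log_weight \<beta> x \<le> log_weight \<beta> y * exp \<bar>x - y\<bar>"
    using log_weight_le[OF \<beta>, of x y] by linarith
qed

text \<open>Treats m and n together: \<open>f\<close> is u or v, \<open>c\<close> the zero-order
  coefficient and \<open>r\<close> the source containing \<rho>^2. Transport gives the decay
  constant \<open>B\<close> of the momentum, the elliptic step costs 1 / (1 - \<kappa>), and the
  second derivative is recovered as f minus its momentum.\<close>

lemma momentum_weighted_bound:
  assumes f: "continuous_into_sobolev s T f"
    and f_le: "\<And>t x. t \<in> {0..T0} \<Longrightarrow> \<bar>f t x\<bar> \<le> N" "\<And>t x. t \<in> {0..T0} \<Longrightarrow> \<bar>deriv (f t) x\<bar> \<le> N"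
      "\<And>t x. t \<in> {0..T0} \<Longrightarrow> \<bar>deriv (deriv (f t)) x\<bar> \<le> N"
    and c: "\<And>t. t \<in> {0..T0} \<Longrightarrow> continuous_on UNIV (c t)" "\<And>t x. t \<in> {0..T0} \<Longrightarrow> \<bar>c t x\<bar> \<le> K"
    and r: "\<And>t. t \<in> {0..T0} \<Longrightarrow> continuous_on UNIV (r t)" "\<And>t x. t \<in> {0..T0} \<Longrightarrow> \<bar>r t x\<bar> \<le> H / log_weight \<beta> x"
    and weak: "\<And>\<phi> t. test_function \<phi> \<Longrightarrow> t \<in> {0..T0} \<Longrightarrow>
      ((\<lambda>r. LINT x|lborel. momentum (f r) x * \<phi> x) has_real_derivative
        (LINT x|lborel. momentum (f t) x * (u t x * v t x) * deriv \<phi> x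
           + (c t x * momentum (f t) x + r t x) * \<phi> x)) (at t within time_interval T)"
    and f0: "\<And>x. \<bar>f 0 x\<bar> \<le> C / log_weight \<beta> x" "\<And>x. \<bar>deriv (deriv (f 0)) x\<bar> \<le> C / log_weight \<beta> x"
    and t: "t \<in> {0..T0}" and T0': "T0 \<le> \<tau>"
  defines "B \<equiv> transport_growth (N\<^sup>2) (2 * N\<^sup>2) K (2 * C) H \<tau>" and "\<kappa> \<equiv> \<beta> / (exp 1 + \<beta>)"
  shows "\<bar>f t x\<bar> \<le> B / (1 - \<kappa>) / log_weight \<beta> x" "\<bar>deriv (f t) x\<bar> \<le> B / (1 - \<kappa>) / log_weight \<beta> x"
    and "\<bar>deriv (deriv (f t)) x\<bar> \<le> (B / (1 - \<kappa>) + B) / log_weight \<beta> x"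
proof -
  have f_mem: "f t \<in> sobolev_cont s" if "t \<in> {0..T0}" for t
    using continuous_into_sobolev_mem[OF f] interval_subset that by blast
  note C2 = sobolev_cont_C2[OF s f_mem]
  have z: "0 \<in> {0..T0}" using T0(1) by simp
  have pos: "0 \<le> p" if "\<bar>q\<bar> \<le> p / log_weight \<beta> y" for p q y
    using that weight(1)[of y] by (smt (verit) divide_neg_pos)
  have C: "0 \<le> C" by (rule pos[OF f0(1)[of 0]])
  have H: "0 \<le> H" by (rule pos[OF r(2)[OF z, of 0]])
  have K: "0 \<le> K" using c(2)[OF z, of 0] by linarith
  have m_cont: "continuous_on UNIV (momentum (f t))" if "t \<in> {0..T0}" for t
    unfolding momentum_def[abs_def] using C2(3,5)[OF that] by (intro continuous_intros)
  have tr: "transport (\<lambda>t. momentum (f t)) (\<lambda>t x. c t x * momentum (f t) x + r t x) (\<lambda>t x. u t x * v t x) T0 (2 * N) (N\<^sup>2) (2 * N\<^sup>2)"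
  proof (rule transport_velocity[OF m_cont _ _ _ weak])
    show "continuous_on UNIV (\<lambda>x. c t x * momentum (f t) x + r t x)" if "t \<in> {0..T0}" for t
      by (intro continuous_intros c r m_cont that)
    show "\<bar>momentum (f t) x\<bar> \<le> 2 * N" if "t \<in> {0..T0}" for t x
      unfolding momentum_def using f_le(1)[OF that, of x] f_le(3)[OF that, of x] by linarith
    show "((\<lambda>r. momentum (f r) x) \<longlongrightarrow> momentum (f t) x) (at t within time_interval T)" if "t \<in> {0..T0}" for t x
    proof -
      have "t \<in> time_interval T" using that interval_subset by blast
      then have "((\<lambda>r. (deriv ^^ j) (f r) x) \<longlongrightarrow> (deriv ^^ j) (f t) x) (at t within time_interval T)" if "j \<le> 2" for j
        using s that by (intro continuous_into_sobolev_pointwise[OF f, where k = 2]) auto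
      from this[of 0] this[of 2] show ?thesis
        unfolding momentum_def by (auto simp: numeral_2_eq_2 intro: tendsto_diff)
    qed
  qed
  have mB: "\<bar>momentum (f t) x\<bar> \<le> B / log_weight \<beta> x" for x
  proof -
    have "\<bar>momentum (f t) x\<bar> \<le> transport_growth (N\<^sup>2) (2 * N\<^sup>2) K (2 * C) H T0 / log_weight \<beta> x"
    proof (rule transport.weighted_transport_bound[OF tr t _ H K weight])
      show "\<bar>momentum (f 0) x\<bar> \<le> 2 * C / log_weight \<beta> x" for x
      proof -
        have "2 * C / log_weight \<beta> x = C / log_weight \<beta> x + C / log_weight \<beta> x" by simp
        then show ?thesis unfolding momentum_def using f0(1)[of x] f0(2)[of x] by linarith
      qed
      show "\<bar>c t x * momentum (f t) x + r t x\<bar> \<le> K * \<bar>momentum (f t) x\<bar> + H / log_weight \<beta> x"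
        if "t \<in> {0..T0}" for t x
      proof -
        have "\<bar>c t x * momentum (f t) x\<bar> \<le> K * \<bar>momentum (f t) x\<bar>"
          unfolding abs_mult using c(2)[OF that] by (intro mult_right_mono) auto
        then show ?thesis using r(2)[OF that, of x] by linarith
      qed
    qed (use C in simp)
    also have "\<dots> \<le> B / log_weight \<beta> x"
      unfolding B_def using C H K T0(1) T0' weight(1)[of x]
      by (intro divide_right_mono transport_growth_mono) auto
    finally show ?thesis .
  qed
  have k: "\<kappa> < 1" unfolding \<kappa>_def using \<beta> by (simp add: add_pos_pos)
  have B: "0 \<le> B" by (rule pos[OF mB[of 0]])
  \<comment> \<open>\<open>log_weight_le\<close> turns decay of the momentum at \<open>y\<close>
    into growth at rate \<kappa> < 1 away from the fixed point \<open>x\<close>, the form that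
    \<open>elliptic_bound\<close> can integrate.\<close>
  have el: "\<bar>f t y - deriv (deriv (f t)) y\<bar> \<le> B / log_weight \<beta> x * exp (\<kappa> * \<bar>y - x\<bar>)" for y
  proof -
    have "B * log_weight \<beta> x \<le> B * (log_weight \<beta> y * exp (\<kappa> * \<bar>y - x\<bar>))"
      unfolding \<kappa>_def using log_weight_le[OF \<beta>, of x y] B by (intro mult_left_mono) (auto simp: abs_minus_commute)
    then have "B / log_weight \<beta> y \<le> B / log_weight \<beta> x * exp (\<kappa> * \<bar>y - x\<bar>)"
      using weight(1)[of x] weight(1)[of y] by (simp add: field_simps)
    then show ?thesis using mB[of y] unfolding momentum_def by linarith
  qed
  have 1: "\<bar>f t x\<bar> \<le> B / log_weight \<beta> x / (1 - \<kappa>)" "\<bar>deriv (f t) x\<bar> \<le> B / log_weight \<beta> x / (1 - \<kappa>)"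
    by (rule elliptic_bound[OF C2(1,2)[OF t] f_le(1)[OF t] f_le(2)[OF t] k el])+
  then show "\<bar>f t x\<bar> \<le> B / (1 - \<kappa>) / log_weight \<beta> x" "\<bar>deriv (f t) x\<bar> \<le> B / (1 - \<kappa>) / log_weight \<beta> x"
    by (simp_all add: mult.commute)
  then show "\<bar>deriv (deriv (f t)) x\<bar> \<le> (B / (1 - \<kappa>) + B) / log_weight \<beta> x"
    using mB[of x] unfolding momentum_def by (simp only: add_divide_distrib)
qed

end

text \<open>\<open>R\<close> bounds w \<rho>, \<open>B\<close> bounds w m and w n, \<open>B'\<close>
  bounds w times u, u_x, v, v_x, and \<open>B' + B\<close> the second derivatives.
  \<open>2 * C\<close> bounds w m at time 0, where m = u - u_xx.\<close>

definition persistence_bound :: "real \<Rightarrow> real \<Rightarrow> real \<Rightarrow> real \<Rightarrow> real" where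
  "persistence_bound \<beta> \<tau> N C =
     (let R = transport_growth (N\<^sup>2) (2 * N\<^sup>2) 0 C 0 \<tau>;
          B = transport_growth (N\<^sup>2) (2 * N\<^sup>2) (5 * N\<^sup>2) (2 * C) (N\<^sup>2 * R) \<tau>;
          B' = B / (1 - \<beta> / (exp 1 + \<beta>))
      in R + 4 * B' + 2 * (B' + B))"

lemma persistence:
  assumes bv: "bounded_velocity s \<beta> N T0 T u v"
    and sol: "is_solution s \<rho>0 u0 v0 T \<rho> u v"
    and \<rho>_le: "\<And>t x. t \<in> {0..T0} \<Longrightarrow> \<bar>\<rho> t x\<bar> \<le> N"
    and init: "weighted_norm \<beta> \<rho>0 u0 v0 \<le> ereal C" and t: "t \<in> {0..T0}" and \<tau>: "T0 \<le> \<tau>"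
  shows "weighted_norm \<beta> (\<rho> t) (u t) (v t) \<le> ereal (persistence_bound \<beta> \<tau> N C)"
proof -
  interpret bounded_velocity s \<beta> N T0 T u v by (rule bv)
  have \<rho>: "continuous_into_sobolev (s - 1) T \<rho>" and z: "\<rho> 0 = \<rho>0" "u 0 = u0" "v 0 = v0"
    using sol unfolding is_solution_def by auto
  have \<rho>_cont: "continuous_on UNIV (\<rho> t)" if "t \<in> {0..T0}" for t
    using continuous_into_sobolev_mem[OF \<rho>] interval_subset that unfolding sobolev_cont_def by blast
  note uC = sobolev_cont_C2[OF s mem(1)] and vC = sobolev_cont_C2[OF s mem(2)]
  have zT: "0 \<in> {0..T0}" using T0(1) by simp
  note w0 = weighted_norm_bounds(1)[OF \<beta> \<rho>_cont[OF zT] uC(3-5)[OF zT] vC(3-5)[OF zT], unfolded z, OF init]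
  define R where "R = transport_growth (N\<^sup>2) (2 * N\<^sup>2) 0 C 0 \<tau>"
  have C: "0 \<le> C"
    using w0[of \<rho>0 0] weight(1)[of 0] by (smt (verit) divide_neg_pos insertI1)
  have tr: "transport \<rho> (\<lambda>t x. 0) (\<lambda>t x. u t x * v t x) T0 N (N\<^sup>2) (2 * N\<^sup>2)"
  proof (rule transport_velocity[OF \<rho>_cont _ \<rho>_le])
    show "((\<lambda>r. \<rho> r x) \<longlongrightarrow> \<rho> t x) (at t within time_interval T)" if "t \<in> {0..T0}" for t x
      using continuous_into_sobolev_pointwise[OF \<rho>, of 0 0 t x] s that interval_subset by auto
    show "((\<lambda>r. LINT x|lborel. \<rho> r x * \<phi> x) has_real_derivative
        (LINT x|lborel. \<rho> t x * (u t x * v t x) * deriv \<phi> x + 0 * \<phi> x)) (at t within time_interval T)"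
      if "test_function \<phi>" "t \<in> {0..T0}" for \<phi> t
      using sol that interval_subset unfolding is_solution_def by (simp add: mult.assoc subset_iff)
  qed auto
  have \<rho>w: "\<bar>\<rho> t x\<bar> \<le> R / log_weight \<beta> x" if t: "t \<in> {0..T0}" for t x
  proof -
    have "\<bar>\<rho> t x\<bar> \<le> transport_growth (N\<^sup>2) (2 * N\<^sup>2) 0 C 0 T0 / log_weight \<beta> x"
      by (rule transport.weighted_transport_bound[OF tr t C _ _ weight]) (use w0[of \<rho>0] z in auto)
    also have "\<dots> \<le> R / log_weight \<beta> x"
      unfolding R_def using C T0(1) \<tau> weight(1)[of x]
      by (intro divide_right_mono transport_growth_mono) auto
    finally show ?thesis .
  qed
  \<comment> \<open>One factor \<rho> carries the weight; the other and \<open>h\<close> are merely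
    bounded by \<open>N\<close>.\<close>
  have \<rho>2: "\<bar>(\<rho> t x)\<^sup>2 * h\<bar> \<le> N\<^sup>2 * R / log_weight \<beta> x" if t: "t \<in> {0..T0}" and h: "\<bar>h\<bar> \<le> N" for t x h
  proof -
    have "\<bar>\<rho> t x * h\<bar> * \<bar>\<rho> t x\<bar> \<le> N\<^sup>2 * (R / log_weight \<beta> x)"
      by (intro mult_mono abs_mult_le_square \<rho>_le \<rho>w t h) auto
    then show ?thesis by (simp add: power2_eq_square abs_mult mult_ac)
  qed
  \<comment> \<open>The zero-order coefficients are (uv)_x - 3 v u_x and (uv)_x - 3 u v_x: five
    products, each at most N^2.\<close>
  have coef: "\<bar>p * q + p' * q' - 3 * h * k\<bar> \<le> 5 * N\<^sup>2"
    if "\<bar>p\<bar> \<le> N" "\<bar>q\<bar> \<le> N" "\<bar>p'\<bar> \<le> N" "\<bar>q'\<bar> \<le> N" "\<bar>h\<bar> \<le> N" "\<bar>k\<bar> \<le> N" for p q p' q' h k :: real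
    using abs_mult_le_square[OF that(1,2)] abs_mult_le_square[OF that(3,4)] abs_mult_le_square[OF that(5,6)]
    unfolding mult.assoc[of 3 h k] by linarith
  \<comment> \<open>Expanding the derivative of u v \<phi> brings the transport term to divergence
    form and moves (uv)_x into the zero-order coefficient.\<close>
  have product: "deriv (\<lambda>y. u t y * v t y * \<phi> y) x =
      (deriv (u t) x * v t x + u t x * deriv (v t) x) * \<phi> x + u t x * v t x * deriv \<phi> x"
    if "test_function \<phi>" "t \<in> {0..T0}" for \<phi> t x
  proof -
    have "(deriv ^^ 0) \<phi> differentiable at x" using that(1) unfolding test_function_def by blast
    then have "(\<phi> has_real_derivative deriv \<phi> x) (at x)"
      by (simp add: DERIV_deriv_iff_real_differentiable)
    from DERIV_imp_deriv[OF DERIV_mult[OF velocity_has_derivative[OF that(2)] this]] show ?thesis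
      by (simp add: algebra_simps)
  qed
  have weak_m: "((\<lambda>r. LINT x|lborel. momentum (u r) x * \<phi> x) has_real_derivative
        (LINT x|lborel. momentum (u t) x * (u t x * v t x) * deriv \<phi> x
           + ((deriv (u t) x * v t x + u t x * deriv (v t) x - 3 * v t x * deriv (u t) x) * momentum (u t) x
             + (- ((\<rho> t x)\<^sup>2 * u t x))) * \<phi> x)) (at t within time_interval T)"
    if "test_function \<phi>" "t \<in> {0..T0}" for \<phi> t
  proof -
    have "((\<lambda>r. LINT x|lborel. momentum (u r) x * \<phi> x) has_real_derivative
           (LINT x|lborel. momentum (u t) x * deriv (\<lambda>y. u t y * v t y * \<phi> y) x
              - 3 * v t x * deriv (u t) x * momentum (u t) x * \<phi> x
              - (\<rho> t x)\<^sup>2 * u t x * \<phi> x))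
          (at t within time_interval T)"
      using sol that interval_subset unfolding is_solution_def by blast
    then show ?thesis unfolding product[OF that] by (simp add: algebra_simps)
  qed
  have weak_n: "((\<lambda>r. LINT x|lborel. momentum (v r) x * \<phi> x) has_real_derivative
        (LINT x|lborel. momentum (v t) x * (u t x * v t x) * deriv \<phi> x
           + ((deriv (u t) x * v t x + u t x * deriv (v t) x - 3 * deriv (v t) x * u t x) * momentum (v t) x
             + (\<rho> t x)\<^sup>2 * v t x) * \<phi> x)) (at t within time_interval T)"
    if "test_function \<phi>" "t \<in> {0..T0}" for \<phi> t
  proof -
    have "((\<lambda>r. LINT x|lborel. momentum (v r) x * \<phi> x) has_real_derivative
           (LINT x|lborel. momentum (v t) x * deriv (\<lambda>y. u t y * v t y * \<phi> y) x
              - 3 * deriv (v t) x * u t x * momentum (v t) x * \<phi> x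
              + (\<rho> t x)\<^sup>2 * v t x * \<phi> x))
          (at t within time_interval T)"
      using sol that interval_subset unfolding is_solution_def by blast
    then show ?thesis unfolding product[OF that] by (simp add: algebra_simps)
  qed
  define B where "B = transport_growth (N\<^sup>2) (2 * N\<^sup>2) (5 * N\<^sup>2) (2 * C) (N\<^sup>2 * R) \<tau>"
  define B' where "B' = B / (1 - \<beta> / (exp 1 + \<beta>))"
  have c_cont: "continuous_on UNIV (\<lambda>x. deriv (u t) x * v t x + u t x * deriv (v t) x - 3 * v t x * deriv (u t) x)"
    "continuous_on UNIV (\<lambda>x. deriv (u t) x * v t x + u t x * deriv (v t) x - 3 * deriv (v t) x * u t x)"
    "continuous_on UNIV (\<lambda>x. - ((\<rho> t x)\<^sup>2 * u t x))" "continuous_on UNIV (\<lambda>x. (\<rho> t x)\<^sup>2 * v t x)"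
    if "t \<in> {0..T0}" for t
    by (intro continuous_intros uC(3,4)[OF that] vC(3,4)[OF that] \<rho>_cont that)+
  have c_le: "\<bar>deriv (u t) x * v t x + u t x * deriv (v t) x - 3 * v t x * deriv (u t) x\<bar> \<le> 5 * N\<^sup>2"
    "\<bar>deriv (u t) x * v t x + u t x * deriv (v t) x - 3 * deriv (v t) x * u t x\<bar> \<le> 5 * N\<^sup>2"
    if "t \<in> {0..T0}" for t x
    by (intro coef u_le[OF that] v_le[OF that])+
  have r_le: "\<bar>- ((\<rho> t x)\<^sup>2 * u t x)\<bar> \<le> N\<^sup>2 * R / log_weight \<beta> x"
    "\<bar>(\<rho> t x)\<^sup>2 * v t x\<bar> \<le> N\<^sup>2 * R / log_weight \<beta> x" if "t \<in> {0..T0}" for t x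
    using \<rho>2[OF that u_le(1)[OF that]] \<rho>2[OF that v_le(1)[OF that]] by simp_all
  have i: "\<bar>u 0 x\<bar> \<le> C / log_weight \<beta> x" "\<bar>deriv (deriv (u 0)) x\<bar> \<le> C / log_weight \<beta> x"
    "\<bar>v 0 x\<bar> \<le> C / log_weight \<beta> x" "\<bar>deriv (deriv (v 0)) x\<bar> \<le> C / log_weight \<beta> x" for x
    unfolding z by (auto intro: w0)
  note ub = momentum_weighted_bound[OF u u_le c_cont(1) c_le(1) c_cont(3) r_le(1) weak_m i(1,2) t \<tau>,
      folded B_def, folded B'_def]
  note vb = momentum_weighted_bound[OF v v_le c_cont(2) c_le(2) c_cont(4) r_le(2) weak_n i(3,4) t \<tau>,
      folded B_def, folded B'_def]
  have "weighted_norm \<beta> (\<rho> t) (u t) (v t) \<le> ereal (R + 4 * B' + 2 * (B' + B))"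
    by (rule weighted_norm_bounds(2)[OF \<beta> \<rho>_cont[OF t] uC(3-5)[OF t] vC(3-5)[OF t] \<rho>w[OF t] ub vb])
  then show ?thesis
    unfolding persistence_bound_def Let_def R_def B_def B'_def .
qed

text \<open>\<open>C1\<close> has to be found before the data, the solution and \<open>T0\<close>.
  The transport constants grow with the length of the time interval, so they are evaluated at
  \<tau>; the embedding constants depend on \<open>s\<close> alone.\<close>

theorem theorem1p5:
  fixes s \<beta> \<tau> :: real
  assumes "s > 5 / 2" and "\<beta> > 0"
  shows "\<exists>C1 :: real \<Rightarrow> real \<Rightarrow> real \<Rightarrow> real.
    \<forall>(\<rho>0 :: real \<Rightarrow> real) (u0 :: real \<Rightarrow> real) (v0 :: real \<Rightarrow> real)
      (\<rho> :: real \<Rightarrow> real \<Rightarrow> real) (u :: real \<Rightarrow> real \<Rightarrow> real) (v :: real \<Rightarrow> real \<Rightarrow> real)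
      (T :: ereal) (T0 :: real) (C\<beta> :: real) (C0 :: real).
      \<rho>0 \<in> sobolev_cont (s - 1) \<longrightarrow> u0 \<in> sobolev_cont s \<longrightarrow> v0 \<in> sobolev_cont s \<longrightarrow>
      T = lifespan s \<rho>0 u0 v0 \<longrightarrow> 0 < T \<longrightarrow> is_solution s \<rho>0 u0 v0 T \<rho> u v \<longrightarrow>
      weighted_norm \<beta> \<rho>0 u0 v0 \<le> ereal C0 \<longrightarrow>
      convolution_constant \<beta> C\<beta> \<longrightarrow>
      0 < T0 \<longrightarrow> ereal T0 < T \<longrightarrow> T0 \<le> \<tau> \<longrightarrow>
      (\<forall>t\<in>{0..T0}. weighted_norm \<beta> (\<rho> t) (u t) (v t)
         \<le> ereal (C1 (sup_sobolev_norm s T0 \<rho> u v) C\<beta> C0))"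
proof -
  have s1: "s - 1 > real 0 + 1 / 2" and s2: "s > real 2 + 1 / 2" using assms(1) by simp_all
  obtain K1 where K1: "0 \<le> K1" "\<And>f x. f \<in> sobolev_cont (s - 1) \<Longrightarrow> \<bar>f x\<bar> \<le> K1 * sobolev_norm (s - 1) f"
    using sobolev_embedding[OF s1] by fastforce
  obtain K2 where K2: "0 \<le> K2" "\<And>f x j. f \<in> sobolev_cont s \<Longrightarrow> j \<le> 2 \<Longrightarrow> \<bar>(deriv ^^ j) f x\<bar> \<le> K2 * sobolev_norm s f"
    using sobolev_embedding[OF s2] by blast
  show ?thesis
  \<comment> \<open>\<open>K1\<close> bounds \<rho>, and \<open>K2\<close> bounds u and v with two
    derivatives; their sum times M serves as the common bound \<open>N\<close>.\<close>
  proof (rule exI[of _ "\<lambda>M _ C. persistence_bound \<beta> \<tau> ((K1 + K2) * M) C"], intro allI impI ballI)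
    fix \<rho>0 u0 v0 \<rho> u v T T0 C\<beta> C0 t
    assume sol: "is_solution s \<rho>0 u0 v0 T \<rho> u v" and init: "weighted_norm \<beta> \<rho>0 u0 v0 \<le> ereal C0"
      and T0: "0 < T0" "ereal T0 < T" "T0 \<le> \<tau>" and t: "t \<in> {0..T0}"
    define M where "M = sup_sobolev_norm s T0 \<rho> u v"
    have c: "continuous_into_sobolev (s - 1) T \<rho>" "continuous_into_sobolev s T u" "continuous_into_sobolev s T v"
      using sol unfolding is_solution_def by auto
    have norms: "sobolev_norm (s - 1) (\<rho> t) \<le> M" "sobolev_norm s (u t) \<le> M" "sobolev_norm s (v t) \<le> M" "0 \<le> M"
      if "t \<in> {0..T0}" for t
      using le_sup_sobolev_norm[OF c T0(2) that] sobolev_norm_nonneg[of "s - 1" "\<rho> t"]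
        sobolev_norm_nonneg[of s "u t"] sobolev_norm_nonneg[of s "v t"] unfolding M_def by linarith+
    have mem: "\<rho> t \<in> sobolev_cont (s - 1)" "u t \<in> sobolev_cont s" "v t \<in> sobolev_cont s" if "t \<in> {0..T0}" for t
    proof -
      have "t \<in> time_interval T"
        using that T0(2) by (auto simp: time_interval_def intro: le_less_trans[of _ "ereal T0"])
      then show "\<rho> t \<in> sobolev_cont (s - 1)" "u t \<in> sobolev_cont s" "v t \<in> sobolev_cont s"
        using c continuous_into_sobolev_mem by blast+
    qed
    have le: "K * n \<le> (K1 + K2) * M" if "K \<le> K1 + K2" "n \<le> M" "0 \<le> n" for K n
      using that K1(1) K2(1) by (intro mult_mono) auto
    have \<rho>_le: "\<bar>\<rho> t x\<bar> \<le> (K1 + K2) * M" if t: "t \<in> {0..T0}" for t x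
      using K1(2)[OF mem(1)[OF t], of x] le[OF _ norms(1)[OF t] sobolev_norm_nonneg, of K1] K2(1) by linarith
    have d_le: "\<bar>(deriv ^^ j) (u t) x\<bar> \<le> (K1 + K2) * M" "\<bar>(deriv ^^ j) (v t) x\<bar> \<le> (K1 + K2) * M"
      if t: "t \<in> {0..T0}" and j: "j \<le> 2" for t x j
      using K2(2)[OF mem(2)[OF t] j, of x] le[OF _ norms(2)[OF t] sobolev_norm_nonneg, of K2]
        K2(2)[OF mem(3)[OF t] j, of x] le[OF _ norms(3)[OF t] sobolev_norm_nonneg, of K2] K1(1) by linarith+
    have bv: "bounded_velocity s \<beta> ((K1 + K2) * M) T0 T u v"
      by unfold_locales
        (use assms T0 c d_le[where j = 0] d_le[where j = 1] d_le[where j = 2] in \<open>auto simp: numeral_2_eq_2\<close>)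
    show "weighted_norm \<beta> (\<rho> t) (u t) (v t)
         \<le> ereal (persistence_bound \<beta> \<tau> ((K1 + K2) * sup_sobolev_norm s T0 \<rho> u v) C0)"
      unfolding M_def[symmetric] by (rule persistence[OF bv sol \<rho>_le init t T0(3)])
  qed
qed

end
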